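(* For $\vec{x}=(a,b,c,d,e,f,g)^T\in V$, $$A(1-a,e-a,f-a,g-a)\,B_3(\vec{x})\,K_{p_0}(\vec{x})$$ $$+\,S(e-a)\,A(f-a,f-b,f-c,f-d)\,A(g-a,g-b,g-c,g-d)\,A(a,b,c,d)\,L_{\overline{6}}(\vec{x})-A(e-a,e-b,e-c,e-d)\,B_4(\vec{x})\,L_6(\vec{x})=0.$$
   Context: $V=\{(a,b,c,d,e,f,g)^T\in\mathbb{C}^7: e+f+g-a-b-c-d=1\}$. ${}_4F_3\left[\begin{smallmatrix}a,b,c,d\\ e,f,g\end{smallmatrix};1\right]=\sum_{n\ge0}\frac{(a)_n(b)_n(c)_n(d)_n}{n!(e)_n(f)_n(g)_n}$, with $(a)_n$ the rising factorial. For $(a,b,c,d,e,f,g)^T\in V$, $$K(a;b,c,d;e,f,g)=\frac{{}_4F_3\left[\begin{smallmatrix}a,b,c,d\\ e,f,g\end{smallmatrix};1\right]}{\sin\pi a\,\Gamma(a)\Gamma(1+a-e)\Gamma(1+a-f)\Gamma(1+a-g)\Gamma(e)\Gamma(f)\Gamma(g)}+\frac{{}_4F_3\left[\begin{smallmatrix}a,1+a-e,1+a-f,1+a-g\\ 1+a-b,1+a-c,1+a-d\end{smallmatrix};1\right]}{\sin\pi a\,\Gamma(a)\Gamma(b)\Gamma(c)\Gamma(d)\Gamma(1+a-b)\Gamma(1+a-c)\Gamma(1+a-d)},$$ $$L(a,b,c,d;e;f,g)=\frac{{}_4F_3\left[\begin{smallmatrix}a,b,c,d\\ e,f,g\end{smallmatrix};1\right]}{\sin\pi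 e\,\Gamma(1+a-e)\Gamma(1+b-e)\Gamma(1+c-e)\Gamma(1+d-e)\Gamma(e)\Gamma(f)\Gamma(g)}-\frac{{}_4F_3\left[\begin{smallmatrix}1+a-e,1+b-e,1+c-e,1+d-e\\ 2-e,1+f-e,1+g-e\end{smallmatrix};1\right]}{\sin\pi e\,\Gamma(a)\Gamma(b)\Gamma(c)\Gamma(d)\Gamma(2-e)\Gamma(1+f-e)\Gamma(1+g-e)}.$$ Notation: $S(a_1,\dots,a_n)=\sin\pi a_1\cdots\sin\pi a_n$; $A(x,y,z,w)=\frac{1}{\Gamma(x)\Gamma(y)\Gamma(z)\Gamma(w)}$ (with $1/\Gamma=0$ at nonpositive integers). The relation is asserted for those $\vec{x}\in V$ at which the functions occurring are defined (no lower parameter of an occurring series is a nonpositive integer, no sine in an occurring denominator, including $S(f-g)$, vanishes). Here $K_{p_0}(\vec{x})=K(a;b,c,d;e,f,g)$, $L_6(\vec{x})=L(a,b,c,d;e;f,g)$, $L_{\overline{6}}(\vec{x})=L(1-a,1-b,1-c,1-d;2-e;2-f,2-g)$, and $B_3(\vec{x})=\dfrac{1}{\pi^4S(f-g)}[S(f,f-e,g-a,g-b,g-c,g-d)-S(g,g-e,f-a,f-b,f-c,f-d)]$, $B_4(\vec{x})=\pi^{-4}S(f-a,g-a)\,[S(b,c,d)+S(e-a,f,g)]$. *)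

theory Defs
  imports "HOL-Analysis.Analysis"
begin

type_synonym complex7 =
  "complex \<times> complex \<times> complex \<times> complex \<times> complex \<times> complex \<times> complex"

definition V :: "complex7 set" where
  "V = {(a, b, c, d, e, f, g). e + f + g - a - b - c - d = 1}"

text \<open>
  The series \<open>\<^sub>4F\<^sub>3[a,b,c,d; e,f,g; 1]\<close>.  It is meaningful only if
  no lower parameter is a nonpositive integer; this is the predicate \<open>F43_defined\<close> below.
\<close>

definition F43 ::
  "complex \<Rightarrow> complex \<Rightarrow> complex \<Rightarrow> complex \<Rightarrow> complex \<Rightarrow> complex \<Rightarrow> complex \<Rightarrow> complex" where
  "F43 a b c d e f g =
     (\<Sum>n. (pochhammer a n * pochhammer b n * pochhammer c n * pochhammer d n) /
          (fact n * pochhammer e n * pochhammer f n * pochhammer g n))"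

definition F43_defined :: "complex \<Rightarrow> complex \<Rightarrow> complex \<Rightarrow> bool" where
  "F43_defined e f g \<longleftrightarrow> e \<notin> \<int>\<^sub>\<le>\<^sub>0 \<and> f \<notin> \<int>\<^sub>\<le>\<^sub>0 \<and> g \<notin> \<int>\<^sub>\<le>\<^sub>0"

definition S :: "complex list \<Rightarrow> complex" where
  "S zs = (\<Prod>z\<leftarrow>zs. sin (of_real pi * z))"

text \<open>
  Reciprocals of Gamma values are written with the entire function \<open>rGamma\<close>, which
  is \<open>1 / Gamma\<close> and vanishes at the nonpositive integers.
\<close>

definition A :: "complex \<Rightarrow> complex \<Rightarrow> complex \<Rightarrow> complex \<Rightarrow> complex" where
  "A x y z w = rGamma x * rGamma y * rGamma z * rGamma w"

definition K ::
  "complex \<Rightarrow> complex \<Rightarrow> complex \<Rightarrow> complex \<Rightarrow> complex \<Rightarrow> complex \<Rightarrow> complex \<Rightarrow> complex" where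
  "K a b c d e f g =
     F43 a b c d e f g *
       (rGamma a * rGamma (1 + a - e) * rGamma (1 + a - f) * rGamma (1 + a - g) *
        rGamma e * rGamma f * rGamma g) / sin (of_real pi * a) +
     F43 a (1 + a - e) (1 + a - f) (1 + a - g) (1 + a - b) (1 + a - c) (1 + a - d) *
       (rGamma a * rGamma b * rGamma c * rGamma d *
        rGamma (1 + a - b) * rGamma (1 + a - c) * rGamma (1 + a - d)) / sin (of_real pi * a)"

definition K_defined ::
  "complex \<Rightarrow> complex \<Rightarrow> complex \<Rightarrow> complex \<Rightarrow> complex \<Rightarrow> complex \<Rightarrow> complex \<Rightarrow> bool" where
  "K_defined a b c d e f g \<longleftrightarrow>
     F43_defined e f g \<and>
     F43_defined (1 + a - b) (1 + a - c) (1 + a - d) \<and>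
     sin (of_real pi * a) \<noteq> 0"

definition L ::
  "complex \<Rightarrow> complex \<Rightarrow> complex \<Rightarrow> complex \<Rightarrow> complex \<Rightarrow> complex \<Rightarrow> complex \<Rightarrow> complex" where
  "L a b c d e f g =
     F43 a b c d e f g *
       (rGamma (1 + a - e) * rGamma (1 + b - e) * rGamma (1 + c - e) * rGamma (1 + d - e) *
        rGamma e * rGamma f * rGamma g) / sin (of_real pi * e) -
     F43 (1 + a - e) (1 + b - e) (1 + c - e) (1 + d - e) (2 - e) (1 + f - e) (1 + g - e) *
       (rGamma a * rGamma b * rGamma c * rGamma d *
        rGamma (2 - e) * rGamma (1 + f - e) * rGamma (1 + g - e)) / sin (of_real pi * e)"

definition L_defined ::
  "complex \<Rightarrow> complex \<Rightarrow> complex \<Rightarrow> complex \<Rightarrow> complex \<Rightarrow> complex \<Rightarrow> complex \<Rightarrow> bool" where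
  "L_defined a b c d e f g \<longleftrightarrow>
     F43_defined e f g \<and>
     F43_defined (2 - e) (1 + f - e) (1 + g - e) \<and>
     sin (of_real pi * e) \<noteq> 0"

fun K_p0 :: "complex7 \<Rightarrow> complex" where
  "K_p0 (a, b, c, d, e, f, g) = K a b c d e f g"

fun L_6 :: "complex7 \<Rightarrow> complex" where
  "L_6 (a, b, c, d, e, f, g) = L a b c d e f g"

fun L_6bar :: "complex7 \<Rightarrow> complex" where
  "L_6bar (a, b, c, d, e, f, g) = L (1 - a) (1 - b) (1 - c) (1 - d) (2 - e) (2 - f) (2 - g)"

fun B_3 :: "complex7 \<Rightarrow> complex" where
  "B_3 (a, b, c, d, e, f, g) =
     1 / (of_real pi ^ 4 * S [f - g]) *
     (S [f, f - e, g - a, g - b, g - c, g - d] - S [g, g - e, f - a, f - b, f - c, f - d])"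

fun B_4 :: "complex7 \<Rightarrow> complex" where
  "B_4 (a, b, c, d, e, f, g) =
     1 / of_real pi ^ 4 * S [f - a, g - a] * (S [b, c, d] + S [e - a, f, g])"

text \<open>
  The points at which all the functions occurring in the relation are defined: no lower
  parameter of an occurring series is a nonpositive integer, and no sine in an occurring
  denominator vanishes.
\<close>

fun relation_defined :: "complex7 \<Rightarrow> bool" where
  "relation_defined (a, b, c, d, e, f, g) \<longleftrightarrow>
     K_defined a b c d e f g \<and>
     L_defined a b c d e f g \<and>
     L_defined (1 - a) (1 - b) (1 - c) (1 - d) (2 - e) (2 - f) (2 - g) \<and>
     S [f - g] \<noteq> 0"

end

theory Submission
  imports Defs "HOL-Complex_Analysis.Complex_Analysis"
begin

text \<open>
  Let \<open>\<theta>\<close> be the entire function \<open>1/(\<Gamma>(1-a-w)\<cdots>\<Gamma>(1-d-w) \<Gamma>(1+w)\<Gamma>(e+w)\<Gamma>(f+w)\<Gamma>(g+w))\<close>.  The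
  Saalschuetz condition makes \<open>\<theta>\<close> decay quadratically along integer translates, so that
  \<open>G(t) = \<Sum>n\<in>\<int>. \<theta>(t + n)\<close> is entire and 1-periodic, and it is \<open>o(exp(4\<pi>\<bar>Im t\<bar>))\<close>; hence it is a
  combination of \<open>exp(2\<pi>\<i>t)\<close>, \<open>1\<close>, \<open>exp(-2\<pi>\<i>t)\<close>.  Its values at \<open>0\<close>, \<open>1-e\<close>, \<open>1-f\<close>, \<open>1-g\<close>, \<open>-a\<close> are the
  \<open>\<^sub>4F\<^sub>3(1)\<close> series in \<open>K\<close>, \<open>L(a,b,c,d;e;f,g)\<close> and \<open>L(1+a-g,1+b-g,1+c-g,1+d-g;1+f-g;2-g,1+e-g)\<close>, so any
  linear relation between these reduces to a trigonometric identity.  The last function equals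
  \<open>L(1-a,1-b,1-c,1-d;2-e;2-f,2-g)\<close> by two applications of the invariance
  \<open>L(a,b,c,d;e;f,g) = L(f-b,g-b,a,1+a-e;1+a-b;1+a+c-e,1+a+d-e)\<close>.

  For that invariance, shift \<open>a,b,f,g\<close> by \<open>z\<close>.  The difference of the two sides vanishes at the poles of
  \<open>\<Gamma>(a+z)\<Gamma>(b+z)\<Gamma>(1+a-e+z)\<Gamma>(1+b-e+z)\<close>, where all series terminate and the identity compares two
  factorisations of a product of two \<open>\<^sub>2F\<^sub>1\<close> power series; multiplied by these gamma factors it is
  therefore entire, it is bounded, and it tends to \<open>0\<close> along the positive integers.

  The analytic estimates are made for real parameters near one point, and the final relation, with
  all denominators cleared, is extended to all parameters by analytic continuation along lines.
\<close>

text \<open>Any four values of a combination of exp(2 pi i t), 1 and exp(-2 pi i t) satisfy a linear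
  relation with sine coefficients. The little-o is what leaves only three exponentials: each of the
  four pairs of reciprocal gamma functions in the summand grows at most like cosh(pi Im t), and this
  bound alone would still admit exp(4 pi i t) and exp(-4 pi i t). The obstacle is
  \<open>L_6bar\<close>: its series have the parameters 1 - a, ..., 2 - g and do not occur as values
  of the bilateral sum, so the invariance of \<open>L\<close> has to be established separately. That
  argument is in the style of Carlson's theorem, passing from the terminating case to the general
  one. It shifts a, b, f, g together because then only two upper and two lower parameters move in
  each series, and each moving pair becomes a gamma quotient with a constant increment. The
  estimates need positive increments and convergent majorants, which are open conditions. With the
  reciprocal gamma functions built into the series and the sines multiplied out, every term is
  entire along lines in the hyperplane \<open>V\<close>, so a small real box is enough.\<close>

unbundle no vec_syntax

section \<open>Sequences with a balanced ratio\<close>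

text \<open>In the expanded product, the terms of degree at least two belong to the subsets with at
  least two elements, and each is at most the square of the bound because that bound is at most 1.
  The induction carries their exact number, 2^n - n - 1, which is sharper than the
  conclusion.\<close>

lemma norm_prod_list_one_plus:
  fixes xs :: "complex list"
  assumes "\<And>x. x \<in> set xs \<Longrightarrow> norm x \<le> \<epsilon>" and "0 \<le> \<epsilon>" "\<epsilon> \<le> 1"
  shows "norm (prod_list (map (\<lambda>x. 1 + x) xs) - 1 - sum_list xs) \<le> 2 ^ length xs * \<epsilon>\<^sup>2"
proof -
  have "norm (prod_list (map (\<lambda>x. 1 + x) xs) - 1 - sum_list xs)
          \<le> (2 ^ length xs - real (length xs) - 1) * \<epsilon>\<^sup>2 \<and>
        norm (sum_list xs) \<le> length xs * \<epsilon>"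
    using assms(1)
  proof (induction xs)
    case (Cons x xs)
    let ?P = "prod_list (map (\<lambda>x. 1 + x) xs)" and ?s = "sum_list xs" and ?l = "real (length xs)"
    have IH: "norm (?P - 1 - ?s) \<le> (2 ^ length xs - ?l - 1) * \<epsilon>\<^sup>2" "norm ?s \<le> ?l * \<epsilon>"
      using Cons by auto
    have x: "norm x \<le> \<epsilon>" using Cons by auto
    have eq: "(1 + x) * ?P - 1 - (x + ?s) = (?P - 1 - ?s) * (1 + x) + ?s * x"
      by (simp add: algebra_simps)
    have "norm (1 + x) \<le> 2"
      using norm_triangle_ineq[of 1 x] x assms(3) by simp
    then have "norm ((?P - 1 - ?s) * (1 + x)) \<le> ((2 ^ length xs - ?l - 1) * \<epsilon>\<^sup>2) * 2"
      unfolding norm_mult using order.trans[OF norm_ge_zero IH(1)] IH(1) by (intro mult_mono) auto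
    moreover have "norm (?s * x) \<le> (?l * \<epsilon>) * \<epsilon>"
      unfolding norm_mult using IH(2) x assms(2) by (intro mult_mono) auto
    ultimately have "norm ((1 + x) * ?P - 1 - (x + ?s))
        \<le> ((2 ^ length xs - ?l - 1) * \<epsilon>\<^sup>2) * 2 + (?l * \<epsilon>) * \<epsilon>"
      unfolding eq by (intro order.trans[OF norm_triangle_ineq] add_mono)
    also have "\<dots> = (2 ^ length (x # xs) - real (length (x # xs)) - 1) * \<epsilon>\<^sup>2"
      by (simp add: algebra_simps power2_eq_square)
    finally have "norm ((1 + x) * ?P - 1 - (x + ?s))
        \<le> (2 ^ length (x # xs) - real (length (x # xs)) - 1) * \<epsilon>\<^sup>2" .
    moreover have "norm (x + ?s) \<le> real (length (x # xs)) * \<epsilon>"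
      using norm_triangle_ineq[of x ?s] x IH(2) by (simp add: algebra_simps)
    ultimately show ?case by simp
  qed simp
  moreover have "(2 ^ length xs - real (length xs) - 1) * \<epsilon>\<^sup>2 \<le> 2 ^ length xs * \<epsilon>\<^sup>2"
    by (intro mult_right_mono) auto
  ultimately show ?thesis by linarith
qed

lemma norm_prod_list_ge:
  fixes xs :: "complex list"
  assumes "\<And>x. x \<in> set xs \<Longrightarrow> c \<le> norm x" and "0 \<le> c"
  shows "c ^ length xs \<le> norm (prod_list xs)"
  using assms(1)
proof (induction xs)
  case (Cons x xs)
  then show ?case using assms(2) by (auto simp: norm_mult intro!: mult_mono)
qed simp

lemma prod_list_map_const_mult:
  fixes c :: "'a :: comm_monoid_mult"
  shows "prod_list (map (\<lambda>x. c * f x) xs) = c ^ length xs * prod_list (map f xs)"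
  by (induction xs) (auto simp: mult_ac)

text \<open>Put N = n + 1 and write x + n as N (1 + (x - 1)/N). The extra factor is (1 + 1/N)^2, so
  two entries 1/N are adjoined to the numerator list; the condition on the sums then makes the
  first-order terms of both products equal. The second-order errors amount to 2^6 + 2^4 = 80
  squares, and the denominator product is at least (1/2)^4, whence 1280 = 80 * 16.\<close>

lemma balanced_ratio:
  fixes xs ys :: "complex list"
  assumes M: "\<And>x. x \<in> set xs \<union> set ys \<Longrightarrow> norm x \<le> M" and "0 \<le> M"
    and len: "length xs = 4" "length ys = 4"
    and sum: "sum_list ys - sum_list xs = 2"
    and n: "2 * (M + 1) \<le> real n + 1"
  shows "(real n + 2)\<^sup>2 / (real n + 1)\<^sup>2 * norm (\<Prod>x\<leftarrow>xs. x + of_nat n)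
           \<le> (1 + 1280 * (M + 1)\<^sup>2 / (real n + 1)\<^sup>2) * norm (\<Prod>y\<leftarrow>ys. y + of_nat n)"
    and "(\<Prod>y\<leftarrow>ys. y + of_nat n) \<noteq> 0"
proof -
  define N where "N = real n + 1"
  define \<epsilon> where "\<epsilon> = (M + 1) / N"
  have N: "N > 0" unfolding N_def by simp
  have eps: "0 \<le> \<epsilon>" "\<epsilon> \<le> 1/2" using n N \<open>0 \<le> M\<close> unfolding \<epsilon>_def N_def[symmetric]
    by (auto simp: field_simps)
  let ?X = "of_real (1/N) # of_real (1/N) # map (\<lambda>x. (x - 1) / of_real N) xs"
  let ?Y = "map (\<lambda>x. (x - 1) / of_real N) ys"
  have norm_le: "norm ((x - 1) / of_real N) \<le> \<epsilon>" if "x \<in> set xs \<union> set ys" for x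
  proof -
    have "norm (x - 1) \<le> M + 1" using M[OF that] norm_triangle_ineq4[of x 1] by simp
    then show ?thesis using N by (simp add: norm_divide \<epsilon>_def divide_right_mono)
  qed
  have "norm (complex_of_real (1/N)) \<le> \<epsilon>"
    using N \<open>0 \<le> M\<close> by (simp add: \<epsilon>_def divide_right_mono norm_divide)
  then have X: "norm (prod_list (map (\<lambda>x. 1 + x) ?X) - 1 - sum_list ?X) \<le> 2 ^ length ?X * \<epsilon>\<^sup>2"
    using eps norm_le by (intro norm_prod_list_one_plus) auto
  have Y: "norm (prod_list (map (\<lambda>x. 1 + x) ?Y) - 1 - sum_list ?Y) \<le> 2 ^ length ?Y * \<epsilon>\<^sup>2"
    using eps norm_le by (intro norm_prod_list_one_plus) auto
  have sl: "sum_list (map (\<lambda>x. (x - 1) / of_real N) zs) = (sum_list zs - of_nat (length zs)) / of_real N"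
    for zs :: "complex list"
    by (induction zs) (simp_all add: add_divide_distrib diff_divide_distrib)
  have "sum_list ys = sum_list xs + 2" using sum by (simp add: algebra_simps)
  then have "sum_list ?X = sum_list ?Y"
    using N by (simp only: sl sum_list.Cons len) (simp add: field_simps)
  then have "prod_list (map (\<lambda>x. 1 + x) ?X) - prod_list (map (\<lambda>x. 1 + x) ?Y) =
     (prod_list (map (\<lambda>x. 1 + x) ?X) - 1 - sum_list ?X) - (prod_list (map (\<lambda>x. 1 + x) ?Y) - 1 - sum_list ?Y)"
    by (simp only:) (simp add: algebra_simps)
  then have "norm (prod_list (map (\<lambda>x. 1 + x) ?X) - prod_list (map (\<lambda>x. 1 + x) ?Y))
      \<le> 2 ^ length ?X * \<epsilon>\<^sup>2 + 2 ^ length ?Y * \<epsilon>\<^sup>2"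
    by (simp only:) (rule order.trans[OF norm_triangle_ineq4 add_mono[OF X Y]])
  also have "\<dots> = 80 * \<epsilon>\<^sup>2" by (simp add: len)
  finally have diff: "norm (prod_list (map (\<lambda>x. 1 + x) ?X))
      \<le> norm (prod_list (map (\<lambda>x. 1 + x) ?Y)) + 80 * \<epsilon>\<^sup>2"
    using norm_triangle_ineq2[of "prod_list (map (\<lambda>x. 1 + x) ?X)" "prod_list (map (\<lambda>x. 1 + x) ?Y)"] by linarith
  have "(1/2) ^ length (map (\<lambda>x. 1 + x) ?Y) \<le> norm (prod_list (map (\<lambda>x. 1 + x) ?Y))"
  proof (rule norm_prod_list_ge)
    fix z assume "z \<in> set (map (\<lambda>x. 1 + x) ?Y)"
    then obtain y where y: "y \<in> set ys" "z = 1 + (y - 1) / of_real N" by auto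
    have "norm ((y - 1) / of_real N) \<le> 1/2" using norm_le[of y] y eps by auto
    moreover have "1 \<le> norm z + norm ((y - 1) / of_real N)"
      using norm_triangle_ineq4[of z "(y - 1) / of_real N"] y by simp
    ultimately show "1/2 \<le> norm z" by linarith
  qed simp
  then have ge: "1/16 \<le> norm (prod_list (map (\<lambda>x. 1 + x) ?Y))"
    by (simp add: len power_divide)
  have "80 * \<epsilon>\<^sup>2 \<le> 80 * \<epsilon>\<^sup>2 * (16 * norm (prod_list (map (\<lambda>x. 1 + x) ?Y)))"
    using ge mult_left_mono[of 1 "16 * norm (prod_list (map (\<lambda>x. 1 + x) ?Y))" "80 * \<epsilon>\<^sup>2"] by simp
  then have main: "norm (prod_list (map (\<lambda>x. 1 + x) ?X))
      \<le> (1 + 1280 * \<epsilon>\<^sup>2) * norm (prod_list (map (\<lambda>x. 1 + x) ?Y))"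
    using diff by (simp add: algebra_simps)
  have shift: "1 + (x - 1) / of_real N = inverse (of_real N) * (x + of_nat n)" for x :: complex
  proof -
    have Nc: "complex_of_real N = of_nat n + 1" by (simp add: N_def)
    have "complex_of_real N \<noteq> 0" using N by simp
    then show ?thesis unfolding Nc by (simp add: divide_simps)
  qed
  have PY: "prod_list (map (\<lambda>x. 1 + x) ?Y) = inverse (of_real N) ^ 4 * (\<Prod>y\<leftarrow>ys. y + of_nat n)"
    unfolding map_map o_def shift prod_list_map_const_mult len ..
  have "prod_list (map (\<lambda>x. 1 + x) ?X) = (1 + of_real (1/N)) ^ 2 *
      (inverse (of_real N) ^ 4 * (\<Prod>x\<leftarrow>xs. x + of_nat n))"
    unfolding list.map map_map o_def shift prod_list_map_const_mult len prod_list.Cons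
    by (simp add: power2_eq_square mult_ac)
  moreover have "(1 + complex_of_real (1/N)) = of_real ((N + 1) / N)"
    using N by (simp add: field_simps)
  ultimately have PX: "prod_list (map (\<lambda>x. 1 + x) ?X) = of_real ((N + 1) / N) ^ 2 *
      (inverse (of_real N) ^ 4 * (\<Prod>x\<leftarrow>xs. x + of_nat n))" by simp
  have nPX: "norm (prod_list (map (\<lambda>x. 1 + x) ?X))
     = ((N + 1)\<^sup>2 / N\<^sup>2 * norm (\<Prod>x\<leftarrow>xs. x + of_nat n)) * (inverse N ^ 4)"
    unfolding PX using N
    by (simp only: norm_mult norm_power norm_inverse norm_of_real) (simp add: power_divide mult_ac)
  have nPY: "norm (prod_list (map (\<lambda>x. 1 + x) ?Y))
     = norm (\<Prod>x\<leftarrow>ys. x + of_nat n) * (inverse N ^ 4)"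
    unfolding PY using N by (simp only: norm_mult norm_power norm_inverse norm_of_real) simp
  have "((N + 1)\<^sup>2 / N\<^sup>2 * norm (\<Prod>x\<leftarrow>xs. x + of_nat n)) * (inverse N ^ 4)
     \<le> ((1 + 1280 * \<epsilon>\<^sup>2) * norm (\<Prod>x\<leftarrow>ys. x + of_nat n)) * (inverse N ^ 4)"
    using main unfolding nPX nPY by (simp only: mult.assoc)
  then have "(N + 1)\<^sup>2 / N\<^sup>2 * norm (\<Prod>x\<leftarrow>xs. x + of_nat n)
     \<le> (1 + 1280 * \<epsilon>\<^sup>2) * norm (\<Prod>x\<leftarrow>ys. x + of_nat n)"
    by (rule mult_right_le_imp_le) (use N in simp)
  then show "(real n + 2)\<^sup>2 / (real n + 1)\<^sup>2 * norm (\<Prod>x\<leftarrow>xs. x + of_nat n)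
           \<le> (1 + 1280 * (M + 1)\<^sup>2 / (real n + 1)\<^sup>2) * norm (\<Prod>y\<leftarrow>ys. y + of_nat n)"
    by (simp add: N_def \<epsilon>_def power_divide add.commute)
  show "(\<Prod>y\<leftarrow>ys. y + of_nat n) \<noteq> 0"
    using ge unfolding nPY by auto
qed

lemma sum_inverse_squares_le: "(\<Sum>k=m..<n. 1 / (real k + 1)\<^sup>2) \<le> 2"
proof -
  have "(\<Sum>k<Suc n. 1 / (real k + 1)\<^sup>2) \<le> 2 - 1 / (real n + 1)" for n
  proof (induction n)
    case (Suc n)
    have "1 / (real n + 2)\<^sup>2 \<le> 1 / ((real n + 1) * (real n + 2))"
      by (intro divide_left_mono) (auto simp: power2_eq_square)
    also have "\<dots> = 1 / (real n + 1) - 1 / (real n + 2)" by (simp add: field_simps)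
    finally show ?case using Suc by (simp add: add.commute)
  qed simp
  moreover have "(\<Sum>k=m..<n. 1 / (real k + 1)\<^sup>2) \<le> (\<Sum>k<Suc n. 1 / (real k + 1)\<^sup>2)"
    by (intro sum_mono2) auto
  ultimately show ?thesis by (smt (verit) divide_nonneg_nonneg of_nat_0_le_iff)
qed

text \<open>The term ratio is \<open>1 - 2/n + O(n\<^sup>-\<^sup>2)\<close>, so that the terms are \<open>O(n\<^sup>-\<^sup>2)\<close>.\<close>

definition balanced_rec :: "complex list \<Rightarrow> complex list \<Rightarrow> (nat \<Rightarrow> complex) \<Rightarrow> bool" where
  "balanced_rec xs ys u \<longleftrightarrow> length xs = 4 \<and> length ys = 4 \<and> sum_list ys - sum_list xs = 2 \<and>
     (\<forall>n. u (Suc n) * (\<Prod>y\<leftarrow>ys. y + of_nat n) = u n * (\<Prod>x\<leftarrow>xs. x + of_nat n))"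

text \<open>The constants depend on the bound \<open>M\<close> of the parameters and not on the
  sequence. This uniformity gives locally uniform convergence when the parameters vary.\<close>

definition balanced_dom :: "real \<Rightarrow> real \<Rightarrow> nat \<Rightarrow> bool" where
  "balanced_dom M Q n0 \<longleftrightarrow> (\<forall>xs ys u n. (\<forall>x\<in>set xs \<union> set ys. norm x \<le> M) \<longrightarrow> balanced_rec xs ys u \<longrightarrow>
     n \<ge> n0 \<longrightarrow> norm (u n) \<le> Q * norm (u n0) / (real n + 1)\<^sup>2)"

lemma balanced_bound:
  assumes "0 \<le> M"
  shows "\<exists>Q n0. Q \<ge> 0 \<and> balanced_dom M Q n0"
proof -
  define n0 where "n0 = nat \<lceil>2 * (M + 1)\<rceil>"
  define C where "C = 1280 * (M + 1)\<^sup>2"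
  define Q where "Q = exp (2 * C) * (real n0 + 1)\<^sup>2"
  have C: "C \<ge> 0" unfolding C_def by simp
  have "norm (u n) \<le> Q * norm (u n0) / (real n + 1)\<^sup>2"
    if M: "\<And>x. x \<in> set xs \<union> set ys \<Longrightarrow> norm x \<le> M" and len: "length xs = 4" "length ys = 4"
      and sum: "sum_list ys - sum_list xs = (2::complex)"
      and rec: "\<And>n. u (Suc n) * (\<Prod>y\<leftarrow>ys. y + of_nat n) = u n * (\<Prod>x\<leftarrow>xs. x + of_nat n)"
      and n: "n \<ge> n0" for xs ys and u :: "nat \<Rightarrow> complex" and n
  proof -
    \<comment> \<open>With the expected decay removed, the growth factors 1 + C/(n + 1)^2 have
      products bounded by exp(2 C), since the inverse squares sum to at most 2.\<close>
    define v where "v n = norm (u n) * (real n + 1)\<^sup>2" for n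
    have step: "v (Suc n) \<le> (1 + C / (real n + 1)\<^sup>2) * v n" if "n \<ge> n0" for n
    proof -
      have n': "2 * (M + 1) \<le> real n + 1"
        using that unfolding n0_def by linarith
      let ?X = "norm (\<Prod>x\<leftarrow>xs. x + of_nat n)" and ?Y = "norm (\<Prod>y\<leftarrow>ys. y + of_nat n)"
      have Y: "?Y > 0" using balanced_ratio(2)[OF M assms len sum n'] by simp
      have "norm (u (Suc n)) * ?Y = norm (u n) * ?X"
        using rec[of n] by (simp flip: norm_mult)
      then have "v (Suc n) * ?Y = norm (u n) * (real n + 1)\<^sup>2 * ((real n + 2)\<^sup>2 / (real n + 1)\<^sup>2 * ?X)"
        by (simp add: v_def field_simps)
      also have "\<dots> \<le> norm (u n) * (real n + 1)\<^sup>2 * ((1 + C / (real n + 1)\<^sup>2) * ?Y)"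
        using balanced_ratio(1)[OF M assms len sum n'] unfolding C_def
        by (intro mult_left_mono) auto
      also have "\<dots> = ((1 + C / (real n + 1)\<^sup>2) * v n) * ?Y"
        by (simp add: v_def mult_ac)
      finally show ?thesis using Y by (rule mult_right_le_imp_le)
    qed
    have "v n \<le> exp (C * (\<Sum>k=n0..<n. 1 / (real k + 1)\<^sup>2)) * v n0"
      using n
    proof (induction n rule: dec_induct)
      case (step n)
      have "v (Suc n) \<le> (1 + C / (real n + 1)\<^sup>2) * v n" by (rule \<open>n \<ge> n0 \<Longrightarrow> v (Suc n) \<le> _\<close>) fact
      also have "\<dots> \<le> exp (C / (real n + 1)\<^sup>2) * (exp (C * (\<Sum>k=n0..<n. 1 / (real k + 1)\<^sup>2)) * v n0)"
        using step.IH C by (intro mult_mono exp_ge_add_one_self) (auto simp: v_def)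
      also have "\<dots> = exp (C * (\<Sum>k=n0..<Suc n. 1 / (real k + 1)\<^sup>2)) * v n0"
        using step.hyps by (simp add: exp_add[symmetric] algebra_simps)
      finally show ?case .
    qed simp
    also have "\<dots> \<le> exp (2 * C) * v n0"
    proof -
      have "C * (\<Sum>k=n0..<n. 1 / (real k + 1)\<^sup>2) \<le> C * 2"
        by (intro mult_left_mono sum_inverse_squares_le C)
      then show ?thesis by (intro mult_right_mono) (auto simp: v_def mult.commute)
    qed
    finally have "norm (u n) * (real n + 1)\<^sup>2 \<le> Q * norm (u n0)"
      by (simp add: v_def Q_def mult_ac)
    then show ?thesis by (simp add: field_simps)
  qed
  moreover have "Q \<ge> 0" unfolding Q_def by simp
  ultimately have "Q \<ge> 0 \<and> balanced_dom M Q n0"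
    unfolding balanced_dom_def balanced_rec_def by blast
  then show ?thesis by blast
qed

lemma summable_inverse_squares_mult: "summable (\<lambda>n. c / (real n + 1)\<^sup>2)"
  using summable_mult[OF sums_summable[OF inverse_squares_sums], of c] by (simp add: add.commute)

lemma balanced_summable:
  assumes "balanced_rec xs ys u"
  shows "summable (\<lambda>n. norm (u n))"
proof -
  have "bounded (set xs \<union> set ys)" by (intro finite_imp_bounded) auto
  then obtain M where M: "\<And>x. x \<in> set xs \<union> set ys \<Longrightarrow> norm x \<le> M" "M > 0"
    unfolding bounded_pos by blast
  obtain Q n0 where Q: "balanced_dom M Q n0"
    using balanced_bound M(2) less_imp_le by blast
  have "norm (u n) \<le> Q * norm (u n0) / (real n + 1)\<^sup>2" if "n \<ge> n0" for n
    using Q[unfolded balanced_dom_def, rule_format, OF _ assms that] M(1) by simp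
  then show ?thesis
    by (intro summable_comparison_test'[OF summable_inverse_squares_mult[of "Q * norm (u n0)"], of n0]) auto
qed

text \<open>On a closed unit disc the parameters and the term of index \<open>n0\<close> are bounded
  by compactness, so one majorant serves the whole disc from \<open>n0\<close> on and the
  Weierstrass test applies.\<close>

lemma balanced_suminf_holomorphic:
  fixes xs ys :: "(complex \<Rightarrow> complex) list" and u :: "nat \<Rightarrow> complex \<Rightarrow> complex"
  assumes hol: "\<And>h. h \<in> set xs \<union> set ys \<Longrightarrow> h holomorphic_on UNIV"
    and u: "\<And>n. u n holomorphic_on UNIV"
    and rec: "\<And>s. balanced_rec (map (\<lambda>h. h s) xs) (map (\<lambda>h. h s) ys) (\<lambda>n. u n s)"
  shows "(\<lambda>s. \<Sum>n. u n s) holomorphic_on UNIV"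
proof (rule holomorphic_uniform_sequence)
  show "(\<lambda>s. \<Sum>n<N. u n s) holomorphic_on UNIV" for N
    by (intro holomorphic_intros u)
  fix s :: complex
  have "bounded (\<Union>h\<in>set xs \<union> set ys. h ` cball s 1)"
    by (intro bounded_UN ballI compact_imp_bounded compact_continuous_image)
       (auto intro: holomorphic_on_imp_continuous_on holomorphic_on_subset hol)
  then obtain M where M: "M > 0" "\<And>h z. h \<in> set xs \<union> set ys \<Longrightarrow> z \<in> cball s 1 \<Longrightarrow> norm (h z) \<le> M"
    unfolding bounded_pos by blast
  obtain Q n0 where Q0: "Q \<ge> 0" and Q: "balanced_dom M Q n0"
    using balanced_bound M(1) less_imp_le by blast
  have "bounded (u n0 ` cball s 1)"
    by (intro compact_imp_bounded compact_continuous_image)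
       (auto intro: holomorphic_on_imp_continuous_on holomorphic_on_subset u)
  then obtain B where B: "B > 0" "\<And>z. z \<in> cball s 1 \<Longrightarrow> norm (u n0 z) \<le> B"
    unfolding bounded_pos by blast
  have bnd: "norm (u n z) \<le> Q * B / (real n + 1)\<^sup>2" if "n \<ge> n0" "z \<in> cball s 1" for n z
  proof -
    have "norm (u n z) \<le> Q * norm (u n0 z) / (real n + 1)\<^sup>2"
      using Q[unfolded balanced_dom_def, rule_format, OF _ rec that(1)] M(2) that(2) by auto
    also have "\<dots> \<le> Q * B / (real n + 1)\<^sup>2"
      using B(2)[OF that(2)] Q0 by (intro divide_right_mono mult_left_mono) auto
    finally show ?thesis .
  qed
  have "uniform_limit (cball s 1) (\<lambda>N z. \<Sum>n<N. u n z) (\<lambda>z. \<Sum>n. u n z) sequentially"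
    by (rule Weierstrass_m_test_ev[OF _ summable_inverse_squares_mult[of "Q * B"]])
       (use bnd in \<open>auto simp: eventually_sequentially intro!: exI[of _ n0]\<close>)
  then show "\<exists>d>0. cball s d \<subseteq> UNIV \<and>
      uniform_limit (cball s d) (\<lambda>N z. \<Sum>n<N. u n z) (\<lambda>z. \<Sum>n. u n z) sequentially"
    by (intro exI[of _ 1]) auto
qed auto

section \<open>Quotients of gamma functions\<close>

lemma norm_pochhammer_quotient_le:
  fixes u :: complex
  assumes "0 < c" "0 \<le> \<delta>" and ge: "\<And>k. c \<le> norm (u + of_nat k)"
  shows "norm (pochhammer (u + of_real \<delta>) n / pochhammer u n) \<le> (1 + \<delta> / c) ^ n"
proof (induction n)
  case (Suc n)
  have "u + of_nat n \<noteq> 0" using ge[of n] assms(1) by auto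
  then have "norm ((u + of_real \<delta> + of_nat n) / (u + of_nat n)) = norm (1 + of_real \<delta> / (u + of_nat n))"
    by (simp add: field_simps)
  also have "\<dots> \<le> 1 + norm (of_real \<delta> / (u + of_nat n))"
    using norm_triangle_ineq[of 1 "of_real \<delta> / (u + of_nat n)"] by simp
  also have "\<dots> \<le> 1 + \<delta> / c"
    using assms(1,2) ge[of n] by (auto simp: norm_divide intro!: divide_left_mono mult_pos_pos)
  finally have "norm (pochhammer (u + of_real \<delta>) n / pochhammer u n) * norm ((u + of_real \<delta> + of_nat n) / (u + of_nat n))
      \<le> (1 + \<delta> / c) ^ n * (1 + \<delta> / c)"
    using Suc assms by (intro mult_mono) auto
  then show ?case by (simp add: pochhammer_rec' norm_mult norm_divide mult_ac)
qed simp

text \<open>Trades a quotient at \<open>u\<close> for one further to the right, where monotone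
  estimates hold, at the cost of a ratio of Pochhammer symbols.\<close>

lemma Gamma_quotient_shift:
  fixes u :: complex
  assumes "u \<notin> \<int>\<^sub>\<le>\<^sub>0"
  shows "Gamma u * rGamma (u + \<delta>) =
    pochhammer (u + \<delta>) n / pochhammer u n * (Gamma (u + of_nat n) * rGamma (u + of_nat n + \<delta>))"
proof -
  have "pochhammer u n \<noteq> 0" using assms pochhammer_eq_0_imp_nonpos_Int by blast
  moreover have "Gamma u * pochhammer u n = Gamma (u + of_nat n)"
    using pochhammer_Gamma[OF assms, of n] assms Gamma_eq_zero_iff[of u] by simp
  ultimately have "Gamma u = Gamma (u + of_nat n) / pochhammer u n"
    by (simp only: eq_divide_eq simp_thms if_False if_True)
  then show ?thesis
    using pochhammer_rGamma[of "u + \<delta>" n] by (simp add: add_ac)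
qed

text \<open>In Gauss's limit formula the quotient is a limit of Pochhammer ratios, and these compare
  factor by factor: |1 + \<delta>/(u + k)| is at most 1 + \<delta>/(x + k). The remaining powers of
  n have the same modulus on both sides.\<close>

lemma norm_Gamma_quotient_le:
  fixes u :: complex and x \<delta> :: real
  assumes x: "0 < x" "x \<le> Re u" and "0 \<le> \<delta>"
  shows "norm (Gamma u * rGamma (u + of_real \<delta>)) \<le> Gamma x * rGamma (x + \<delta>)"
proof (rule LIMSEQ_le)
  have x0: "x \<notin> \<int>\<^sub>\<le>\<^sub>0" using x by (auto elim!: nonpos_Ints_cases)
  have u0: "u \<notin> \<int>\<^sub>\<le>\<^sub>0" using x by (auto elim!: nonpos_Ints_cases)
  show "(\<lambda>n. norm (Gamma_series u n * rGamma_series (u + of_real \<delta>) n))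
           \<longlonglongrightarrow> norm (Gamma u * rGamma (u + of_real \<delta>))"
    by (intro tendsto_intros)
  show "(\<lambda>n. Gamma_series x n * rGamma_series (x + \<delta>) n) \<longlonglongrightarrow> Gamma x * rGamma (x + \<delta>)"
    by (intro tendsto_intros)
  have poch: "norm (pochhammer (u + of_real \<delta>) n / pochhammer u n) \<le> pochhammer (x + \<delta>) n / pochhammer x n" for n
  proof (induction n)
    case (Suc n)
    have pos: "x + real n > 0" using x by linarith
    have "x + real n \<le> Re (u + of_nat n)" using x by simp
    also have "\<dots> \<le> norm (u + of_nat n)" by (rule complex_Re_le_cmod)
    finally have le: "x + real n \<le> norm (u + of_nat n)" .
    then have ne: "u + of_nat n \<noteq> 0" using pos by auto
    have "norm ((u + of_real \<delta> + of_nat n) / (u + of_nat n)) = norm (1 + of_real \<delta> / (u + of_nat n))"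
      using ne by (simp add: field_simps)
    also have "\<dots> \<le> 1 + norm (of_real \<delta> / (u + of_nat n))"
      using norm_triangle_ineq[of 1 "of_real \<delta> / (u + of_nat n)"] by simp
    also have "\<dots> \<le> 1 + \<delta> / (x + real n)"
      using assms(3) le pos by (auto simp: norm_divide intro!: divide_left_mono mult_pos_pos)
    also have "\<dots> = (x + \<delta> + real n) / (x + real n)" using pos by (simp add: field_simps)
    finally have "norm (pochhammer (u + of_real \<delta>) n / pochhammer u n) * norm ((u + of_real \<delta> + of_nat n) / (u + of_nat n))
        \<le> (pochhammer (x + \<delta>) n / pochhammer x n) * ((x + \<delta> + real n) / (x + real n))"
      using Suc by (intro mult_mono) (auto intro: order.trans[OF norm_ge_zero Suc])
    then show ?case by (simp add: pochhammer_rec' norm_mult norm_divide mult_ac)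
  qed simp
  have "norm (Gamma_series u n * rGamma_series (u + of_real \<delta>) n)
      \<le> Gamma_series x n * rGamma_series (x + \<delta>) n" if n: "n \<ge> 1" for n
  proof -
    have e: "norm (exp (u * of_real (ln (real n))) / exp ((u + of_real \<delta>) * of_real (ln (real n)))) = exp (- \<delta> * ln n)"
      by (simp add: norm_exp_eq_Re flip: exp_diff) (simp add: algebra_simps)
    have e': "exp (x * ln (real n)) / exp ((x + \<delta>) * ln (real n)) = exp (- \<delta> * ln n)"
      by (simp add: algebra_simps flip: exp_diff)
    have "norm (Gamma_series u n * rGamma_series (u + of_real \<delta>) n)
       = norm (pochhammer (u + of_real \<delta>) (n+1) / pochhammer u (n+1)) * norm (exp (u * of_real (ln (real n))) / exp ((u + of_real \<delta>) * of_real (ln (real n))))"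
      unfolding Gamma_series_def rGamma_series_def
      by (simp add: norm_mult norm_divide field_simps del: pochhammer_Suc)
    also have "\<dots> \<le> pochhammer (x + \<delta>) (n+1) / pochhammer x (n+1) * exp (- \<delta> * ln n)"
      unfolding e by (intro mult_right_mono poch) simp
    also have "\<dots> = Gamma_series x n * rGamma_series (x + \<delta>) n"
      unfolding e'[symmetric] Gamma_series_def rGamma_series_def
      by (simp add: field_simps)
    finally show ?thesis .
  qed
  then show "\<exists>N. \<forall>n\<ge>N. norm (Gamma_series u n * rGamma_series (u + of_real \<delta>) n)
      \<le> Gamma_series x n * rGamma_series (x + \<delta>) n" by blast
qed

text \<open>By Gauss's formula the quotient is \<open>1 / real n powr \<delta>\<close> up to
  convergent factors. The index is moved by one because the formula at n involves n + 1
  factors.\<close>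

lemma Gamma_quotient_tendsto_0:
  fixes x \<delta> :: real
  assumes "0 < x" "0 < \<delta>"
  shows "(\<lambda>n. Gamma (x + real n) * rGamma (x + \<delta> + real n)) \<longlonglongrightarrow> 0"
proof -
  have x0: "x \<notin> \<int>\<^sub>\<le>\<^sub>0" and xd: "x + \<delta> \<notin> \<int>\<^sub>\<le>\<^sub>0" using assms by (auto elim!: nonpos_Ints_cases)
  have eq: "Gamma (x + real (Suc n)) * rGamma (x + \<delta> + real (Suc n))
      = Gamma x * rGamma (x + \<delta>) * (rGamma_series x n * Gamma_series (x + \<delta>) n * (1 / real n powr \<delta>))"
    if "n > 0" for n
  proof -
    have p: "pochhammer x (Suc n) > 0" "pochhammer (x + \<delta>) (Suc n) > 0"
      using assms by (auto intro!: pochhammer_pos)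
    have "Gamma (x + real (Suc n)) = Gamma x * pochhammer x (Suc n)"
      using pochhammer_Gamma[OF x0, of "Suc n"] assms by (simp add: field_simps Gamma_eq_zero_iff x0)
    moreover have "rGamma (x + \<delta> + real (Suc n)) = rGamma (x + \<delta>) / pochhammer (x + \<delta>) (Suc n)"
      using pochhammer_rGamma[of "x + \<delta>" "Suc n"] p by (simp add: field_simps)
    moreover have "exp ((x + \<delta>) * ln (real n)) = exp (x * ln (real n)) * (real n powr \<delta>)"
      using that by (simp add: powr_def algebra_simps exp_add)
    ultimately show ?thesis
      using p that unfolding rGamma_series_def Gamma_series_def
      by (simp add: field_simps)
  qed
  have "(\<lambda>n. 1 / real n powr \<delta>) \<longlonglongrightarrow> 0" using assms by real_asymp
  then have "(\<lambda>n. Gamma x * rGamma (x + \<delta>) * (rGamma_series x n * Gamma_series (x + \<delta>) n * (1 / real n powr \<delta>)))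
     \<longlonglongrightarrow> Gamma x * rGamma (x + \<delta>) * (rGamma x * Gamma (x + \<delta>) * 0)"
    by (intro tendsto_intros)
  then have "(\<lambda>n. Gamma (x + real (Suc n)) * rGamma (x + \<delta> + real (Suc n))) \<longlonglongrightarrow>
      Gamma x * rGamma (x + \<delta>) * (rGamma x * Gamma (x + \<delta>) * 0)"
    by (rule Lim_transform_eventually) (use eq in \<open>auto intro!: eventually_mono[OF eventually_gt_at_top[of 0]]\<close>)
  then have "(\<lambda>n. Gamma (x + real (Suc n)) * rGamma (x + \<delta> + real (Suc n))) \<longlonglongrightarrow> 0" by simp
  then show ?thesis by (rule LIMSEQ_imp_Suc)
qed

text \<open>A fixed shift by N to the right makes the quotient smaller than e/2 at every height. The
  Pochhammer ratio that pays for the shift tends to 1 far from the real axis, so it is eventually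
  below 2.\<close>

lemma Gamma_quotient_tendsto_0_Im:
  fixes x \<delta> :: real
  assumes "0 < x" "0 < \<delta>" and F: "filterlim (\<lambda>y. \<bar>f y\<bar>) at_top F"
  shows "((\<lambda>y. Gamma (Complex x (f y)) * rGamma (Complex x (f y) + of_real \<delta>)) \<longlongrightarrow> 0) F"
proof (rule tendstoI)
  fix e :: real assume e: "e > 0"
  obtain N where N: "Gamma (x + real N) * rGamma (x + \<delta> + real N) < e / 2"
    using order_tendstoD(2)[OF Gamma_quotient_tendsto_0[OF assms(1,2)], of "e/2"] e
    by (auto simp: eventually_sequentially)
  have "((\<lambda>y. (1 + \<delta> / \<bar>f y\<bar>) ^ N) \<longlongrightarrow> (1 + 0) ^ N) F"
    by (intro tendsto_intros real_tendsto_divide_at_top[OF tendsto_const] F)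
  then have "\<forall>\<^sub>F y in F. (1 + \<delta> / \<bar>f y\<bar>) ^ N < 2"
    by (rule order_tendstoD(2)) simp
  moreover have "\<forall>\<^sub>F y in F. \<bar>f y\<bar> > 0" using F unfolding filterlim_at_top_dense by blast
  ultimately show "\<forall>\<^sub>F y in F. dist (Gamma (Complex x (f y)) * rGamma (Complex x (f y) + of_real \<delta>)) 0 < e"
  proof eventually_elim
    case (elim y)
    define u where "u = Complex x (f y)"
    have u0: "u + of_nat k \<noteq> 0" "u \<notin> \<int>\<^sub>\<le>\<^sub>0" for k
      using \<open>0 < x\<close> by (auto simp: u_def complex_eq_iff elim!: nonpos_Ints_cases)
    have ge: "\<bar>f y\<bar> \<le> norm (u + of_nat k)" for k
      using abs_Im_le_cmod[of "u + of_nat k"] by (simp add: u_def)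
    have poch: "norm (pochhammer (u + of_real \<delta>) N / pochhammer u N) \<le> (1 + \<delta> / \<bar>f y\<bar>) ^ N"
      using assms elim ge by (intro norm_pochhammer_quotient_le) auto
    have "norm (Gamma u * rGamma (u + of_real \<delta>)) = norm (pochhammer (u + of_real \<delta>) N / pochhammer u N)
        * norm (Gamma (u + of_nat N) * rGamma (u + of_nat N + of_real \<delta>))"
      using Gamma_quotient_shift[OF u0(2), of "of_real \<delta>" N] by (simp only: norm_mult)
    also have "\<dots> \<le> 2 * norm (Gamma (u + of_nat N) * rGamma (u + of_nat N + of_real \<delta>))"
      using order.trans[OF poch less_imp_le[OF elim(1)]] by (intro mult_right_mono) auto
    also have "norm (Gamma (u + of_nat N) * rGamma (u + of_nat N + of_real \<delta>)) \<le> Gamma (x + real N) * rGamma (x + real N + \<delta>)"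
      using assms by (intro norm_Gamma_quotient_le) (auto simp: u_def)
    also have "\<dots> < e / 2" using N by (simp add: add_ac)
    finally show ?case by (simp add: u_def)
  qed
qed

section \<open>Growth of the sine, and gamma quotients away from their poles\<close>

abbreviation sinpi :: "complex \<Rightarrow> complex" where
  "sinpi z \<equiv> sin (of_real pi * z)"

lemma sinpi_add_1: "sinpi (z + 1) = - sinpi z"
  by (simp add: distrib_left sin_add sin_of_real cos_of_real)

lemma sinpi_add_nat: "sinpi (z + of_nat k) = (-1) ^ k * sinpi z"
proof (induction k)
  case (Suc k)
  then show ?case using sinpi_add_1[of "z + of_nat k"] by (simp add: add_ac)
qed simp

lemma norm_sin_eq: "norm (sin z) ^ 2 = sin (Re z) ^ 2 + sinh (Im z) ^ 2" for z :: complex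
proof -
  have 1: "Re (sin z) = sin (Re z) * cosh (Im z)" "Im (sin z) = cos (Re z) * sinh (Im z)"
    by (simp_all add: Re_sin Im_sin cosh_field_def sinh_field_def)
  show ?thesis
    unfolding cmod_power2 1 power_mult_distrib cosh_square_eq cos_squared_eq
    by (simp add: algebra_simps)
qed

lemma norm_sin_le_cosh: "norm (sin z) \<le> cosh (Im z)" for z :: complex
proof -
  have "norm (sin z) ^ 2 \<le> cosh (Im z) ^ 2"
    unfolding norm_sin_eq cosh_square_eq by (simp add: abs_square_le_1)
  then show ?thesis by (rule power2_le_imp_le) simp
qed

lemma norm_sin_le_mult_cosh: "norm (sin z) \<le> norm z * cosh (Im z)" for z :: complex
proof -
  have "sinh y \<le> y * cosh y" if "y \<ge> 0" for y :: real
  proof -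
    have "((\<lambda>y. y * cosh y - sinh y) has_real_derivative (x * sinh x)) (at x)" for x
      by (auto intro!: derivative_eq_intros)
    then have "0 * cosh 0 - sinh 0 \<le> y * cosh y - sinh y"
      using that by (intro DERIV_nonneg_imp_nondecreasing[of 0 y "\<lambda>y. y * cosh y - sinh y"]) (auto intro!: mult_nonneg_nonneg exI)
    then show ?thesis by simp
  qed
  then have "sinh \<bar>Im z\<bar> ^ 2 \<le> (\<bar>Im z\<bar> * cosh \<bar>Im z\<bar>) ^ 2"
    by (intro power_mono) (simp_all del: sinh_real_abs cosh_real_abs)
  then have 1: "sinh (Im z) ^ 2 \<le> (Im z)\<^sup>2 * (cosh (Im z))\<^sup>2"
    by (simp add: power_mult_distrib)
  have "sin (Re z) ^ 2 \<le> (Re z)\<^sup>2" using abs_sin_x_le_abs_x[of "Re z"] by (simp add: abs_le_square_iff)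
  also have "\<dots> \<le> (Re z)\<^sup>2 * (cosh (Im z))\<^sup>2"
    using cosh_real_ge_1[of "Im z"] by (simp add: mult_le_cancel_left1 one_le_power)
  finally have "norm (sin z) ^ 2 \<le> (norm z * cosh (Im z)) ^ 2"
    using 1 unfolding norm_sin_eq power_mult_distrib cmod_power2[of z] by (simp add: distrib_right)
  then show ?thesis by (rule power2_le_imp_le) simp
qed

text \<open>To the right of Re u = 1 - N a shift by N reaches the monotone estimate. To the left,
  reflection gives the same kind of quotient at v = 1 - u - \<delta>, times a quotient of sines that
  the hypothesis bounds by 1/m.\<close>

lemma norm_Gamma_quotient_bounded:
  fixes \<delta> m :: real
  assumes "\<delta> > 0" "m > 0"
  obtains B where "B > 0" "\<And>u. m * cosh (pi * Im u) \<le> norm (sin (of_real pi * u)) \<Longrightarrow>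
     norm (Gamma u * rGamma (u + of_real \<delta>)) \<le> B"
proof -
  \<comment> \<open>Large enough that Re u < 1 - N forces Re v to be at least 1 after the
    reflection.\<close>
  define N where "N = nat \<lceil>\<delta>\<rceil> + 1"
  have N: "real N \<ge> \<delta> + 1" unfolding N_def using assms by linarith
  define B0 where "B0 = Gamma 1 * rGamma (1 + \<delta>)"
  have B0: "norm (Gamma u * rGamma (u + of_real \<delta>)) \<le> B0" if "Re u \<ge> 1" for u :: complex
    unfolding B0_def using that assms by (intro norm_Gamma_quotient_le) auto
  have B0_nonneg: "B0 \<ge> 0" using order.trans[OF norm_ge_zero B0[of 1]] by simp
  have main: "norm (Gamma u * rGamma (u + of_real \<delta>)) \<le> (1 + \<delta> / (m / pi)) ^ N * B0 + 1 / m * B0"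
    if u: "m * cosh (pi * Im u) \<le> norm (sin (of_real pi * u))" for u :: complex
  proof -
    have sin0: "sin (of_real pi * u) \<noteq> 0" using u assms(2) cosh_real_pos[of "pi * Im u"]
      by (metis norm_zero not_less zero_less_mult_iff)
    show ?thesis
    proof (cases "Re u \<ge> 1 - real N")
      case True
      \<comment> \<open>The bound |sin z| \<le> |z| cosh(Im z) turns the lower bound on the sine
        into a distance from every pole -k.\<close>
      have ge: "m / pi \<le> norm (u + of_nat k)" for k
      proof -
        have "m * cosh (pi * Im u) \<le> norm (sinpi (u + of_nat k))"
          using u by (simp add: sinpi_add_nat norm_mult norm_power)
        also have "\<dots> \<le> norm (of_real pi * (u + of_nat k)) * cosh (pi * Im u)"
          using norm_sin_le_mult_cosh[of "of_real pi * (u + of_nat k)"] by simp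
        finally have "m \<le> pi * norm (u + of_nat k)" by (simp add: norm_mult)
        then show ?thesis by (simp add: field_simps)
      qed
      have "u \<notin> \<int>\<^sub>\<le>\<^sub>0"
      proof
        assume "u \<in> \<int>\<^sub>\<le>\<^sub>0"
        then obtain k where "u = - of_nat k" by (elim nonpos_Ints_cases')
        then show False using ge[of k] assms(2) pi_gt_zero by (simp add: divide_le_0_iff)
      qed
      then have "norm (Gamma u * rGamma (u + of_real \<delta>)) = norm (pochhammer (u + of_real \<delta>) N / pochhammer u N)
          * norm (Gamma (u + of_nat N) * rGamma (u + of_nat N + of_real \<delta>))"
        using Gamma_quotient_shift[of u "of_real \<delta>" N] by (simp only: norm_mult not_False_eq_True simp_thms)
      also have "\<dots> \<le> (1 + \<delta> / (m / pi)) ^ N * B0"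
        using True assms ge by (intro mult_mono norm_pochhammer_quotient_le B0) auto
      also have "\<dots> \<le> (1 + \<delta> / (m / pi)) ^ N * B0 + 1 / m * B0"
        using B0_nonneg assms by simp
      finally show ?thesis .
    next
      case False
      define v where "v = 1 - u - of_real \<delta>"
      have v: "Re v \<ge> 1" using False N unfolding v_def by simp
      have r1: "rGamma (u + of_real \<delta>) = sin (of_real pi * (u + of_real \<delta>)) / of_real pi * Gamma v"
      proof -
        have "v \<notin> \<int>\<^sub>\<le>\<^sub>0" using v by (auto elim!: nonpos_Ints_cases)
        then have nz: "rGamma v \<noteq> 0" by (simp add: rGamma_eq_zero_iff)
        have "1 - (u + of_real \<delta>) = v" by (simp add: v_def)
        then have "rGamma (u + of_real \<delta>) * rGamma v = sin (of_real pi * (u + of_real \<delta>)) / of_real pi"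
          using rGamma_reflection_complex[of "u + of_real \<delta>"] by simp
        then show ?thesis using nz unfolding Gamma_def by (metis divide_inverse nonzero_eq_divide_eq)
      qed
      have r2: "Gamma u = of_real pi * rGamma (1 - u) / sin (of_real pi * u)"
      proof -
        have "rGamma u \<noteq> 0" using rGamma_reflection_complex[of u] sin0 by auto
        then show ?thesis
          using rGamma_reflection_complex[of u] sin0 by (simp add: Gamma_def field_simps)
      qed
      have "norm (Gamma u * rGamma (u + of_real \<delta>))
          = norm (sin (of_real pi * (u + of_real \<delta>))) / norm (sin (of_real pi * u)) * norm (Gamma v * rGamma (v + of_real \<delta>))"
        unfolding r1 r2 by (simp add: v_def norm_mult norm_divide)
      also have "\<dots> \<le> (1 / m) * B0"
      proof (intro mult_mono B0 v)
        have "norm (sin (of_real pi * (u + of_real \<delta>))) \<le> cosh (pi * Im u)"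
          using norm_sin_le_cosh[of "of_real pi * (u + of_real \<delta>)"] by simp
        also have "\<dots> \<le> norm (sin (of_real pi * u)) / m" using u assms by (simp add: field_simps)
        finally show "norm (sin (of_real pi * (u + of_real \<delta>))) / norm (sin (of_real pi * u)) \<le> 1 / m"
          using sin0 assms by (simp add: field_simps)
      qed (use assms in auto)
      also have "\<dots> \<le> (1 + \<delta> / (m / pi)) ^ N * B0 + 1 / m * B0"
        using B0_nonneg assms by simp
      finally show ?thesis .
    qed
  qed
  show ?thesis
  proof (rule that)
    show "(1 + \<delta> / (m / pi)) ^ N * B0 + 1 / m * B0 + 1 > 0"
      using B0_nonneg assms by (intro add_nonneg_pos add_nonneg_nonneg mult_nonneg_nonneg) auto
    show "norm (Gamma u * rGamma (u + of_real \<delta>)) \<le> (1 + \<delta> / (m / pi)) ^ N * B0 + 1 / m * B0 + 1"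
      if "m * cosh (pi * Im u) \<le> norm (sin (of_real pi * u))" for u
      using main[OF that] by simp
  qed
qed

section \<open>Regularised series\<close>

text \<open>The gamma functions of the lower parameters are absorbed into the terms, which therefore
  stay finite when a lower parameter is a nonpositive integer. The sum is entire along holomorphic
  families of balanced parameters.\<close>

definition F43_reg_term ::
  "complex \<Rightarrow> complex \<Rightarrow> complex \<Rightarrow> complex \<Rightarrow> complex \<Rightarrow> complex \<Rightarrow> complex \<Rightarrow> nat \<Rightarrow> complex" where
  "F43_reg_term a b c d e f g n = pochhammer a n * pochhammer b n * pochhammer c n * pochhammer d n / fact n *
     (rGamma (e + of_nat n) * rGamma (f + of_nat n) * rGamma (g + of_nat n))"

definition F43_reg ::
  "complex \<Rightarrow> complex \<Rightarrow> complex \<Rightarrow> complex \<Rightarrow> complex \<Rightarrow> complex \<Rightarrow> complex \<Rightarrow> complex" where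
  "F43_reg a b c d e f g = (\<Sum>n. F43_reg_term a b c d e f g n)"

lemma rGamma_rec: "rGamma (z + of_nat (Suc n)) * (z + of_nat n) = rGamma (z + of_nat n)"
  using rGamma_plus1[of "z + of_nat n"] by (simp add: mult.commute add_ac)

lemma F43_reg_term_rec:
  assumes "e + f + g - a - b - c - d = 1"
  shows "balanced_rec [a, b, c, d] [1, e, f, g] (F43_reg_term a b c d e f g)"
  unfolding balanced_rec_def
proof (intro conjI allI)
  show "sum_list [1, e, f, g] - sum_list [a, b, c, d] = 2" using assms by (simp add: algebra_simps)
  fix n
  have "F43_reg_term a b c d e f g (Suc n) * (\<Prod>y\<leftarrow>[1, e, f, g]. y + of_nat n) =
     pochhammer a (Suc n) * pochhammer b (Suc n) * pochhammer c (Suc n) * pochhammer d (Suc n) / fact n *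
     ((rGamma (e + of_nat (Suc n)) * (e + of_nat n)) * (rGamma (f + of_nat (Suc n)) * (f + of_nat n)) *
      (rGamma (g + of_nat (Suc n)) * (g + of_nat n)))"
    by (simp add: F43_reg_term_def fact_Suc field_simps del: pochhammer_Suc of_nat_Suc) (simp add: algebra_simps)
  also have "\<dots> = F43_reg_term a b c d e f g n * (\<Prod>x\<leftarrow>[a, b, c, d]. x + of_nat n)"
    unfolding rGamma_rec F43_reg_term_def by (simp add: pochhammer_rec' field_simps)
  finally show "F43_reg_term a b c d e f g (Suc n) * (\<Prod>y\<leftarrow>[1, e, f, g]. y + of_nat n) =
     F43_reg_term a b c d e f g n * (\<Prod>x\<leftarrow>[a, b, c, d]. x + of_nat n)" .
qed auto

lemma F43_reg_summable:
  assumes "e + f + g - a - b - c - d = 1"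
  shows "summable (\<lambda>n. norm (F43_reg_term a b c d e f g n))"
  by (rule balanced_summable[OF F43_reg_term_rec[OF assms]])

lemma pochhammer_holomorphic [holomorphic_intros]:
  "f holomorphic_on X \<Longrightarrow> (\<lambda>z. pochhammer (f z) n) holomorphic_on X"
  by (induction n) (auto simp: pochhammer_rec' intro!: holomorphic_intros)

lemma F43_reg_holomorphic [holomorphic_intros]:
  assumes "\<And>s. e s + f s + g s - a s - b s - c s - d s = 1"
    and "a holomorphic_on UNIV" "b holomorphic_on UNIV" "c holomorphic_on UNIV" "d holomorphic_on UNIV"
      "e holomorphic_on UNIV" "f holomorphic_on UNIV" "g holomorphic_on UNIV"
  shows "(\<lambda>s. F43_reg (a s) (b s) (c s) (d s) (e s) (f s) (g s)) holomorphic_on UNIV"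
  unfolding F43_reg_def
proof (rule balanced_suminf_holomorphic[of "[a, b, c, d]" "[\<lambda>_. 1, e, f, g]"])
  show "(\<lambda>s. F43_reg_term (a s) (b s) (c s) (d s) (e s) (f s) (g s) n) holomorphic_on UNIV" for n
    unfolding F43_reg_term_def by (intro holomorphic_intros assms) auto
  show "balanced_rec (map (\<lambda>h. h s) [a, b, c, d]) (map (\<lambda>h. h s) [\<lambda>_. 1, e, f, g])
      (\<lambda>n. F43_reg_term (a s) (b s) (c s) (d s) (e s) (f s) (g s) n)" for s
    using F43_reg_term_rec[OF assms(1)] by simp
qed (use assms in \<open>auto intro: holomorphic_intros\<close>)

lemma F43_eq_F43_reg:
  assumes "e + f + g - a - b - c - d = 1" and "F43_defined e f g"
  shows "F43 a b c d e f g * (rGamma e * rGamma f * rGamma g) = F43_reg a b c d e f g"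
proof -
  have eq: "rGamma z = pochhammer z n * rGamma (z + of_nat n)" "pochhammer z n \<noteq> 0"
    if "z \<notin> \<int>\<^sub>\<le>\<^sub>0" for z :: complex and n
    using that pochhammer_rGamma[of z n] pochhammer_eq_0_imp_nonpos_Int by blast+
  define r where "r = rGamma e * rGamma f * rGamma g"
  have r: "r \<noteq> 0" using assms(2) unfolding r_def F43_defined_def by (simp add: rGamma_eq_zero_iff)
  have "pochhammer a n * pochhammer b n * pochhammer c n * pochhammer d n /
          (fact n * pochhammer e n * pochhammer f n * pochhammer g n) = F43_reg_term a b c d e f g n / r" for n
    using assms(2) eq[of e n] eq[of f n] eq[of g n] r
    by (simp add: r_def F43_defined_def F43_reg_term_def field_simps)
  then have "F43 a b c d e f g = F43_reg a b c d e f g / r"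
    unfolding F43_def F43_reg_def
    by (simp add: suminf_divide[OF summable_norm_cancel[OF F43_reg_summable[OF assms(1)]]])
  then show ?thesis using r unfolding r_def by simp
qed

section \<open>The function \<open>L\<close> without its sine denominators, and its
  symmetries\<close>

definition L_reg ::
  "complex \<Rightarrow> complex \<Rightarrow> complex \<Rightarrow> complex \<Rightarrow> complex \<Rightarrow> complex \<Rightarrow> complex \<Rightarrow> complex" where
  "L_reg a b c d e f g =
     rGamma (1 + a - e) * rGamma (1 + b - e) * rGamma (1 + c - e) * rGamma (1 + d - e) * F43_reg a b c d e f g -
     rGamma a * rGamma b * rGamma c * rGamma d *
       F43_reg (1 + a - e) (1 + b - e) (1 + c - e) (1 + d - e) (2 - e) (1 + f - e) (1 + g - e)"

lemma L_reg_holomorphic [holomorphic_intros]: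
  assumes "\<And>s. e s + f s + g s - a s - b s - c s - d s = 1"
    and "a holomorphic_on UNIV" "b holomorphic_on UNIV" "c holomorphic_on UNIV" "d holomorphic_on UNIV"
      "e holomorphic_on UNIV" "f holomorphic_on UNIV" "g holomorphic_on UNIV"
  shows "(\<lambda>s. L_reg (a s) (b s) (c s) (d s) (e s) (f s) (g s)) holomorphic_on UNIV"
proof -
  have "(2 - e s) + (1 + f s - e s) + (1 + g s - e s) - (1 + a s - e s) - (1 + b s - e s) - (1 + c s - e s) - (1 + d s - e s) = 1" for s
    using assms(1)[of s] by (simp add: algebra_simps)
  then show ?thesis
    unfolding L_reg_def by (intro holomorphic_intros assms) (auto intro!: assms(1))
qed

lemma F43_reg_perm:
  "F43_reg b a c d e f g = F43_reg a b c d e f g" "F43_reg a b d c e f g = F43_reg a b c d e f g"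
  "F43_reg c d a b e f g = F43_reg a b c d e f g" "F43_reg a b c d e g f = F43_reg a b c d e f g"
  by (simp_all add: F43_reg_def F43_reg_term_def mult_ac)

lemma L_reg_perm:
  "L_reg b a c d e f g = L_reg a b c d e f g" "L_reg a b d c e f g = L_reg a b c d e f g"
  "L_reg a b c d e g f = L_reg a b c d e f g"
  by (simp_all add: L_reg_def F43_reg_perm mult_ac)

lemma L_reg_swap:
  "L_reg (1 + a - e) (1 + b - e) (1 + c - e) (1 + d - e) (2 - e) (1 + f - e) (1 + g - e) = - L_reg a b c d e f g"
  by (simp add: L_reg_def algebra_simps)

text \<open>The two-term relation for \<open>L\<close>, with the sines in its denominators cleared, says that this vanishes.\<close>

definition L_defect ::
  "complex \<Rightarrow> complex \<Rightarrow> complex \<Rightarrow> complex \<Rightarrow> complex \<Rightarrow> complex \<Rightarrow> complex \<Rightarrow> complex" where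
  "L_defect a b c d e f g = sinpi (1 + a - b) * L_reg a b c d e f g -
     sinpi e * L_reg (f - b) (g - b) a (1 + a - e) (1 + a - b) (1 + a + c - e) (1 + a + d - e)"

lemma sinpi_1_plus: "sinpi (1 + z) = - sinpi z"
  using sinpi_add_1[of z] by (simp add: add.commute)

lemma sinpi_minus: "sinpi (- z) = - sinpi z" by simp

text \<open>Both summands change sign: the first through its sine, the second because the two halves
  of its \<open>L_reg\<close> are exchanged. Together with \<open>L_defect_swap_e\<close> this
  reduces four families of terminating cases to the one in which the first parameter is a
  nonpositive integer.\<close>

lemma L_defect_swap12: "L_defect b a c d e f g = - L_defect a b c d e f g"
proof -
  have "L_reg (f - a) (g - a) b (1 + b - e) (1 + b - a) (1 + b + c - e) (1 + b + d - e)
     = - L_reg (f - b) (g - b) a (1 + a - e) (1 + a - b) (1 + a + c - e) (1 + a + d - e)"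
    using L_reg_swap[of "f - b" "1 + a - b" "g - b" a "1 + a - e" "1 + a + c - e" "1 + a + d - e"]
    by (simp add: algebra_simps)
  moreover have "sinpi (1 + b - a) = - sinpi (1 + a - b)"
    using sinpi_1_plus[of "b - a"] sinpi_1_plus[of "a - b"] sinpi_minus[of "a - b"] by (simp add: algebra_simps)
  ultimately show ?thesis by (simp add: L_defect_def L_reg_perm)
qed

lemma L_defect_swap_e:
  "L_defect (1 + a - e) (1 + b - e) (1 + c - e) (1 + d - e) (2 - e) (1 + f - e) (1 + g - e) = - L_defect a b c d e f g"
proof -
  have "sinpi (2 - e) = - sinpi e"
    using sinpi_add_nat[of "-e" 2] by (simp add: algebra_simps)
  moreover have "L_reg (f - b) (g - b) (1 + a - e) a (1 + a - b) (1 + a + c - e) (1 + a + d - e) =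
      L_reg (f - b) (g - b) a (1 + a - e) (1 + a - b) (1 + a + c - e) (1 + a + d - e)"
    by (rule L_reg_perm)
  ultimately show ?thesis using L_reg_swap[of a e b c d f g]
    by (simp add: L_defect_def algebra_simps)
qed

lemma field_differentiable_cong_ev:
  assumes "\<forall>\<^sub>F z in nhds z0. f z = g z" "g field_differentiable (at z0)"
  shows "f field_differentiable (at z0)"
  using assms DERIV_cong_ev[OF refl assms(1) refl] unfolding field_differentiable_def by blast

text \<open>All zeros of \<open>rGamma\<close> are simple, so mere vanishing of \<open>E\<close>
  there permits the division. Near such a zero the quotient equals that of the two difference
  quotients, whose denominator is nonzero because the derivative of \<open>rGamma\<close> at -n is
  (-1)^n n!.\<close>

lemma rGamma_factor:
  fixes E :: "complex \<Rightarrow> complex"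
  assumes E: "E holomorphic_on UNIV" and zero: "\<And>z. \<mu> + z \<in> \<int>\<^sub>\<le>\<^sub>0 \<Longrightarrow> E z = 0"
  obtains W where "W holomorphic_on UNIV" "\<And>z. E z = W z * rGamma (\<mu> + z)"
proof -
  define r where "r z = rGamma (\<mu> + z)" for z
  have r: "r holomorphic_on UNIV" unfolding r_def by (intro holomorphic_intros)
  define W where "W z = (if \<mu> + z \<in> \<int>\<^sub>\<le>\<^sub>0 then deriv E z / deriv r z else E z / r z)" for z
  have r0: "r z = 0 \<longleftrightarrow> \<mu> + z \<in> \<int>\<^sub>\<le>\<^sub>0" for z by (simp add: r_def rGamma_eq_zero_iff)
  have "W field_differentiable (at z0)" for z0
  proof (cases "\<mu> + z0 \<in> \<int>\<^sub>\<le>\<^sub>0")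
    case False
    have "(\<lambda>z. E z / r z) field_differentiable (at z0)"
      using False E r r0[of z0]
      by (intro field_differentiable_divide holomorphic_on_imp_differentiable_at[of _ UNIV]) auto
    moreover have "\<forall>\<^sub>F z in nhds z0. W z = E z / r z"
    proof -
      have "open {z. r z \<noteq> 0}"
        using r by (intro open_Collect_neq holomorphic_on_imp_continuous_on) auto
      then have "\<forall>\<^sub>F z in nhds z0. z \<in> {z. r z \<noteq> 0}"
        using False r0 by (intro eventually_nhds_in_open) auto
      then show ?thesis by eventually_elim (auto simp: W_def r0)
    qed
    ultimately show ?thesis by (rule field_differentiable_cong_ev[rotated])
  next
    case True
    define E1 where "E1 z = (if z = z0 then deriv E z0 else (E z - E z0) / (z - z0))" for z
    define r1 where "r1 z = (if z = z0 then deriv r z0 else (r z - r z0) / (z - z0))" for z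
    have E1: "E1 holomorphic_on UNIV" and r1: "r1 holomorphic_on UNIV"
      unfolding E1_def r1_def using E r by (auto intro!: pole_lemma_open)
    obtain n where n: "\<mu> + z0 = - of_nat n" using True by (elim nonpos_Ints_cases')
    have "(rGamma has_field_derivative (-1) ^ n * fact n) (at (\<mu> + z0))"
      unfolding n by (rule has_field_derivative_rGamma_nonpos_int)
    then have "(r has_field_derivative ((-1) ^ n * fact n) * (0 + 1)) (at z0)"
      unfolding r_def by (rule DERIV_chain2) (intro derivative_intros)
    then have "deriv r z0 = (-1) ^ n * fact n" by (simp add: DERIV_imp_deriv)
    then have r1z0: "r1 z0 \<noteq> 0" by (simp add: r1_def)
    have "(\<lambda>z. E1 z / r1 z) field_differentiable (at z0)"
      using E1 r1 r1z0
      by (intro field_differentiable_divide holomorphic_on_imp_differentiable_at[of _ UNIV]) auto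
    moreover have "\<forall>\<^sub>F z in nhds z0. W z = E1 z / r1 z"
    proof -
      have "open {z. r1 z \<noteq> 0}"
        using r1 by (intro open_Collect_neq holomorphic_on_imp_continuous_on) auto
      then have "\<forall>\<^sub>F z in nhds z0. z \<in> {z. r1 z \<noteq> 0}"
        using r1z0 by (intro eventually_nhds_in_open) auto
      then show ?thesis
      proof eventually_elim
        case (elim z)
        show ?case
        proof (cases "z = z0")
          case True
          then show ?thesis using \<open>\<mu> + z0 \<in> \<int>\<^sub>\<le>\<^sub>0\<close> by (simp add: W_def E1_def r1_def)
        next
          case False
          have "r z0 = 0" "E z0 = 0" using True r0 zero by auto
          then have "r z \<noteq> 0" "E1 z / r1 z = E z / r z" using elim False by (auto simp: r1_def E1_def)
          then show ?thesis using r0 by (simp add: W_def)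
        qed
      qed
    qed
    ultimately show ?thesis by (rule field_differentiable_cong_ev[rotated])
  qed
  then have "W holomorphic_on UNIV" by (simp add: holomorphic_on_def field_differentiable_at_within)
  moreover have "E z = W z * rGamma (\<mu> + z)" for z
    using zero[of z] r0[of z] by (auto simp: W_def r_def)
  ultimately show ?thesis using that by blast
qed

text \<open>A region away from the integers. The comparison with cosh instead of a constant keeps
  the sine quotients produced by reflection bounded far from the real axis too.\<close>

definition sinpi_bounded_below :: "real \<Rightarrow> complex \<Rightarrow> bool" where
  "sinpi_bounded_below m u \<longleftrightarrow> m * cosh (pi * Im u) \<le> norm (sinpi u)"

lemma sinpi_bounded_below_add_nat: "sinpi_bounded_below m (u + of_nat n) \<longleftrightarrow> sinpi_bounded_below m u"
  by (simp add: sinpi_bounded_below_def sinpi_add_nat norm_mult norm_power)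

lemma sinpi_bounded_below_not_nonpos_Int: "sinpi_bounded_below m u \<Longrightarrow> m > 0 \<Longrightarrow> u \<notin> \<int>\<^sub>\<le>\<^sub>0"
proof
  assume "sinpi_bounded_below m u" "m > 0" "u \<in> \<int>\<^sub>\<le>\<^sub>0"
  then obtain n where "u = - of_nat n" by (elim nonpos_Ints_cases')
  then have "sinpi_bounded_below m 0" using sinpi_bounded_below_add_nat[of m u n] \<open>sinpi_bounded_below m u\<close> by simp
  then show False using \<open>m > 0\<close> by (simp add: sinpi_bounded_below_def)
qed

text \<open>The weights Gamma(u) and Gamma(v) absorb the Pochhammer symbols of u and v, leaving
  gamma quotients at u + n and v + n that are bounded uniformly in n. The rest is a series in c, d,
  e that does not involve u or v.\<close>

lemma F43_reg_norm_le:
  fixes u v c d e :: complex and \<delta>1 \<delta>2 :: real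
  assumes uv: "u \<notin> \<int>\<^sub>\<le>\<^sub>0" "v \<notin> \<int>\<^sub>\<le>\<^sub>0" and bal: "e + of_real \<delta>1 + of_real \<delta>2 - c - d = 1"
    and sm: "summable (\<lambda>n. norm (pochhammer c n * pochhammer d n / fact n * rGamma (e + of_nat n)))"
    and B1: "\<And>n. norm (Gamma (u + of_nat n) * rGamma (u + of_nat n + of_real \<delta>1)) \<le> B1"
    and B2: "\<And>n. norm (Gamma (v + of_nat n) * rGamma (v + of_nat n + of_real \<delta>2)) \<le> B2"
  shows "norm (Gamma u * Gamma v * F43_reg u v c d e (u + of_real \<delta>1) (v + of_real \<delta>2))
     \<le> B1 * B2 * (\<Sum>n. norm (pochhammer c n * pochhammer d n / fact n * rGamma (e + of_nat n)))"
proof -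
  let ?c = "\<lambda>n. pochhammer c n * pochhammer d n / fact n * rGamma (e + of_nat n)"
  let ?t = "F43_reg_term u v c d e (u + of_real \<delta>1) (v + of_real \<delta>2)"
  have bal': "e + (u + of_real \<delta>1) + (v + of_real \<delta>2) - u - v - c - d = 1"
    using bal by (simp add: algebra_simps)
  have "norm (Gamma u * Gamma v * ?t n) \<le> B1 * B2 * norm (?c n)" for n
  proof -
    have g: "Gamma (w + of_nat n) = Gamma w * pochhammer w n" if "w \<notin> \<int>\<^sub>\<le>\<^sub>0" for w :: complex
      using pochhammer_Gamma[OF that, of n] that by (simp add: Gamma_eq_zero_iff)
    have "Gamma u * Gamma v * ?t n =
       (Gamma (u + of_nat n) * rGamma (u + of_nat n + of_real \<delta>1)) *
       (Gamma (v + of_nat n) * rGamma (v + of_nat n + of_real \<delta>2)) * ?c n"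
      unfolding g[OF uv(1)] g[OF uv(2)] F43_reg_term_def by (simp add: add_ac mult_ac)
    then have "norm (Gamma u * Gamma v * ?t n) =
       norm (Gamma (u + of_nat n) * rGamma (u + of_nat n + of_real \<delta>1)) *
       norm (Gamma (v + of_nat n) * rGamma (v + of_nat n + of_real \<delta>2)) * norm (?c n)"
      by (simp only: norm_mult)
    also have "\<dots> \<le> B1 * B2 * norm (?c n)"
      using order.trans[OF norm_ge_zero B1] by (intro mult_right_mono mult_mono B1 B2) auto
    finally show ?thesis .
  qed
  then have "norm (\<Sum>n. Gamma u * Gamma v * ?t n) \<le> (\<Sum>n. B1 * B2 * norm (?c n))"
    by (intro norm_suminf_le summable_mult sm)
  then show ?thesis
    unfolding F43_reg_def suminf_mult[OF sm]
      suminf_mult[OF summable_norm_cancel[OF F43_reg_summable[OF bal']], of "Gamma u * Gamma v"] .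
qed

lemma F43_reg_bounded:
  fixes c d e :: complex and \<delta>1 \<delta>2 m :: real
  assumes "\<delta>1 > 0" "\<delta>2 > 0" "m > 0" "e + of_real \<delta>1 + of_real \<delta>2 - c - d = 1"
    "summable (\<lambda>n. norm (pochhammer c n * pochhammer d n / fact n * rGamma (e + of_nat n)))"
  shows "\<exists>B. \<forall>u v. sinpi_bounded_below m u \<longrightarrow> sinpi_bounded_below m v \<longrightarrow>
     norm (Gamma u * Gamma v * F43_reg u v c d e (u + of_real \<delta>1) (v + of_real \<delta>2)) \<le> B"
proof -
  obtain B1 where B1: "\<And>u. sinpi_bounded_below m u \<Longrightarrow> norm (Gamma u * rGamma (u + of_real \<delta>1)) \<le> B1"
    using norm_Gamma_quotient_bounded[OF assms(1,3)] unfolding sinpi_bounded_below_def by metis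
  obtain B2 where B2: "\<And>u. sinpi_bounded_below m u \<Longrightarrow> norm (Gamma u * rGamma (u + of_real \<delta>2)) \<le> B2"
    using norm_Gamma_quotient_bounded[OF assms(2,3)] unfolding sinpi_bounded_below_def by metis
  have "norm (Gamma u * Gamma v * F43_reg u v c d e (u + of_real \<delta>1) (v + of_real \<delta>2))
     \<le> B1 * B2 * (\<Sum>n. norm (pochhammer c n * pochhammer d n / fact n * rGamma (e + of_nat n)))"
    if "sinpi_bounded_below m u" "sinpi_bounded_below m v" for u v
    using that assms sinpi_bounded_below_not_nonpos_Int B1 B2 sinpi_bounded_below_add_nat by (intro F43_reg_norm_le) auto
  then show ?thesis by blast
qed

text \<open>By monotonicity the gamma quotients are bounded, for all summation indices at once, by
  their values at the real point 1 + N, which tend to 0.\<close>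

lemma F43_reg_tendsto_0:
  fixes c d e u v :: complex and \<delta>1 \<delta>2 :: real
  assumes "\<delta>1 > 0" "\<delta>2 > 0" "e + of_real \<delta>1 + of_real \<delta>2 - c - d = 1"
    "summable (\<lambda>n. norm (pochhammer c n * pochhammer d n / fact n * rGamma (e + of_nat n)))"
    and uv: "Re u \<ge> 1" "Re v \<ge> 1"
  shows "(\<lambda>N. Gamma (u + of_nat N) * Gamma (v + of_nat N) *
     F43_reg (u + of_nat N) (v + of_nat N) c d e (u + of_nat N + of_real \<delta>1) (v + of_nat N + of_real \<delta>2)) \<longlonglongrightarrow> 0"
proof (rule Lim_null_comparison)
  let ?C = "\<Sum>n. norm (pochhammer c n * pochhammer d n / fact n * rGamma (e + of_nat n))"
  let ?q = "\<lambda>\<delta> N. Gamma (1 + real N) * rGamma (1 + \<delta> + real N)"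
  have le: "norm (Gamma (w + of_nat N + of_nat n) * rGamma (w + of_nat N + of_nat n + of_real \<delta>)) \<le> ?q \<delta> N"
    if "Re w \<ge> 1" "\<delta> > 0" for w \<delta> N n
    using norm_Gamma_quotient_le[of "1 + real N" "w + of_nat N + of_nat n" \<delta>] that by (simp add: add_ac)
  have nn: "w + of_nat N \<notin> \<int>\<^sub>\<le>\<^sub>0" if "Re w \<ge> 1" for w N
    using that by (auto elim!: nonpos_Ints_cases simp: complex_eq_iff)
  show "\<forall>\<^sub>F N in sequentially. norm (Gamma (u + of_nat N) * Gamma (v + of_nat N) *
     F43_reg (u + of_nat N) (v + of_nat N) c d e (u + of_nat N + of_real \<delta>1) (v + of_nat N + of_real \<delta>2))
     \<le> ?q \<delta>1 N * ?q \<delta>2 N * ?C"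
    by (intro always_eventually allI F43_reg_norm_le le nn uv assms)
  have "(\<lambda>N. ?q \<delta>1 N * ?q \<delta>2 N * ?C) \<longlonglongrightarrow> 0 * 0 * ?C"
    by (intro tendsto_intros Gamma_quotient_tendsto_0 assms) auto
  then show "(\<lambda>N. ?q \<delta>1 N * ?q \<delta>2 N * ?C) \<longlonglongrightarrow> 0" by simp
qed

lemma summable_hypergeometric_coeff:
  fixes c d e :: real
  assumes "c > 0" "d > 0" "c + d < e"
  shows "summable (\<lambda>n. norm (pochhammer (of_real c) n * pochhammer (of_real d) n / fact n *
    rGamma (of_real e + of_nat n) :: complex))"
proof -
  let ?f = "\<lambda>n. pochhammer c n * pochhammer d n / fact n * rGamma (e + real n)"
  have pos: "\<forall>\<^sub>F n in sequentially. ?f n > 0"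
    using eventually_gt_at_top[of "nat \<lceil>\<bar>e\<bar>\<rceil>"]
  proof eventually_elim
    case (elim n)
    then have "e + real n > 0" by linarith
    then show ?case using assms by (auto intro!: mult_pos_pos divide_pos_pos pochhammer_pos simp: rGamma_inverse_Gamma)
  qed
  have "\<forall>\<^sub>F n in sequentially. real n * (?f n / ?f (Suc n) - 1) = real n * ((real n + 1) * (e + real n) / ((c + real n) * (d + real n)) - 1)"
    using pos
  proof eventually_elim
    case (elim n)
    define P where "P = pochhammer c n * pochhammer d n / fact n"
    define R where "R = rGamma (e + real (Suc n))"
    have f1: "?f n = P * R * (e + real n)"
      using rGamma_plus1[of "e + real n"] by (simp add: P_def R_def add_ac mult_ac)
    have f2: "?f (Suc n) = P * R * ((c + real n) * (d + real n) / (real n + 1))"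
      by (simp add: P_def R_def pochhammer_rec' add_ac mult_ac)
    have "P * R \<noteq> 0" using elim unfolding f1 by auto
    moreover have "c + real n > 0" "d + real n > 0" using assms by auto
    ultimately show ?case unfolding f1 f2 by (simp add: divide_simps)
  qed
  \<comment> \<open>Raabe's test needs a limit above 1, and this is the condition c + d < e.\<close>
  moreover have "(\<lambda>n. real n * ((real n + 1) * (e + real n) / ((c + real n) * (d + real n)) - 1)) \<longlonglongrightarrow> 1 + e - c - d"
    by real_asymp
  ultimately have "(\<lambda>n. real n * (?f n / ?f (Suc n) - 1)) \<longlonglongrightarrow> 1 + e - c - d"
    by (subst tendsto_cong)
  then have "liminf (\<lambda>n. ereal (real n * (?f n / ?f (Suc n) - 1))) = ereal (1 + e - c - d)"
    by (intro lim_imp_Liminf tendsto_intros) auto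
  then have "summable ?f" using assms by (intro raabes_test_convergence[OF pos]) auto
  then have "summable (\<lambda>n. norm (?f n))"
  proof (subst summable_cong)
    show "\<forall>\<^sub>F n in sequentially. norm (?f n) = ?f n"
      using pos by eventually_elim (simp only: real_norm_def abs_of_pos)
  qed
  moreover have "norm (pochhammer (of_real c) n * pochhammer (of_real d) n / fact n * rGamma (of_real e + of_nat n) :: complex)
     = norm (?f n)" for n
  proof -
    have "pochhammer (of_real c) n * pochhammer (of_real d) n / fact n * rGamma (of_real e + of_nat n) = complex_of_real (?f n)"
      by (simp add: pochhammer_of_real flip: rGamma_complex_of_real)
    then show ?thesis by (simp only: norm_of_real real_norm_def)
  qed
  ultimately show ?thesis by simp
qed

section \<open>The terminating case\<close>

definition fps_2F1 :: "complex \<Rightarrow> complex \<Rightarrow> complex \<Rightarrow> complex fps" where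
  "fps_2F1 \<alpha> \<beta> \<gamma> = Abs_fps (\<lambda>n. pochhammer \<alpha> n * pochhammer \<beta> n / (pochhammer \<gamma> n * fact n))"

text \<open>The operator of Gauss's hypergeometric differential equation. It characterises
  \<open>fps_2F1\<close> among formal power series with constant term 1, so a product can be
  identified without evaluating convolution sums.\<close>

definition fps_2F1_ode :: "complex \<Rightarrow> complex \<Rightarrow> complex \<Rightarrow> complex fps \<Rightarrow> complex fps" where
  "fps_2F1_ode \<alpha> \<beta> \<gamma> p = fps_X * (1 - fps_X) * fps_deriv (fps_deriv p)
     + (fps_const \<gamma> - (fps_const \<alpha> + fps_const \<beta> + 1) * fps_X) * fps_deriv p - fps_const \<alpha> * fps_const \<beta> * p"

lemma fps_2F1_ode_nth:
  "fps_2F1_ode \<alpha> \<beta> \<gamma> p $ n =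
     (of_nat n + 1) * (\<gamma> + of_nat n) * p $ Suc n - (\<alpha> + of_nat n) * (\<beta> + of_nat n) * p $ n"
proof -
  have "fps_2F1_ode \<alpha> \<beta> \<gamma> p = fps_X * fps_deriv (fps_deriv p) - fps_X * (fps_X * fps_deriv (fps_deriv p))
     + fps_const \<gamma> * fps_deriv p - fps_const (\<alpha> + \<beta> + 1) * (fps_X * fps_deriv p) - fps_const (\<alpha> * \<beta>) * p"
    unfolding fps_2F1_ode_def by (simp add: algebra_simps flip: fps_const_mult fps_const_add)
  show ?thesis
    unfolding \<open>fps_2F1_ode \<alpha> \<beta> \<gamma> p = _\<close>
    by (cases n; cases "n - 1") (simp_all add: algebra_simps)
qed

lemma fps_2F1_unique:
  assumes "\<gamma> \<notin> \<int>\<^sub>\<le>\<^sub>0"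
  shows "fps_2F1_ode \<alpha> \<beta> \<gamma> p = 0 \<and> p $ 0 = 1 \<longleftrightarrow> p = fps_2F1 \<alpha> \<beta> \<gamma>"
proof -
  have nz: "(of_nat n + 1) * (\<gamma> + of_nat n) \<noteq> 0" for n
  proof -
    have "\<gamma> + of_nat n \<noteq> 0"
    proof
      assume "\<gamma> + of_nat n = 0"
      then have "\<gamma> = - of_nat n" by (simp add: eq_neg_iff_add_eq_0)
      then show False using assms by simp
    qed
    moreover have "of_nat (Suc n) \<noteq> (0 :: complex)" by (simp del: of_nat_Suc)
    ultimately show ?thesis by (simp add: add.commute)
  qed
  have ode: "fps_2F1_ode \<alpha> \<beta> \<gamma> p = 0 \<longleftrightarrow>
      (\<forall>n. p $ Suc n = (\<alpha> + of_nat n) * (\<beta> + of_nat n) * p $ n / ((of_nat n + 1) * (\<gamma> + of_nat n)))" for p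
    unfolding fps_eq_iff fps_2F1_ode_nth
    by (simp only: fps_zero_nth right_minus_eq nonzero_eq_divide_eq[OF nz]) (simp only: mult.commute)
  show ?thesis
  proof safe
    assume *: "fps_2F1_ode \<alpha> \<beta> \<gamma> p = 0" "p $ 0 = 1"
    have "p $ n = fps_2F1 \<alpha> \<beta> \<gamma> $ n" for n
    proof (induction n)
      case (Suc n)
      then show ?case using *(1)[unfolded ode] by (simp add: fps_2F1_def pochhammer_rec' mult_ac add_ac)
    qed (simp add: * fps_2F1_def)
    then show "p = fps_2F1 \<alpha> \<beta> \<gamma>" by (simp add: fps_eq_iff)
  qed (simp_all add: ode, simp_all add: fps_2F1_def pochhammer_rec' mult_ac add_ac)
qed

text \<open>\<open>E\<close>, \<open>E1\<close>, \<open>E2\<close> play the roles of (1 - X)^s and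
  its first two derivatives. They enter only through differential equations, since s need not be an
  integer; the outer factor 1 - X clears the denominators in those equations.\<close>

lemma euler_ode_identity:
  fixes X :: "'a :: comm_ring_1"
  assumes "(1 - X) * E1 = - (s * E)" "(1 - X) * E2 = (1 - s) * E1" "s = c - a - b"
  shows "(1 - X) * (X * (1 - X) * (E2 * P + 2 * (E1 * P1) + E * P2) + (c - (a + b + 1) * X) * (E1 * P + E * P1) - a * b * (E * P))
    = E * (1 - X) * (X * (1 - X) * P2 + (c - ((c - a) + (c - b) + 1) * X) * P1 - (c - a) * (c - b) * P)"
proof -
  have h: "(1 - X) * ((1 - X) * E2) = (1 - s) * - (s * E)"
    by (simp only: assms(2) mult.left_commute[of "1 - X" "1 - s"] assms(1))
  have "(1 - X) * (X * (1 - X) * (E2 * P + 2 * (E1 * P1) + E * P2) + (c - (a + b + 1) * X) * (E1 * P + E * P1) - a * b * (E * P))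
    = X * P * ((1 - X) * ((1 - X) * E2)) + 2 * X * (1 - X) * P1 * ((1 - X) * E1) + (1 - X) * (1 - X) * X * E * P2
      + (c - (a + b + 1) * X) * P * ((1 - X) * E1) + (1 - X) * (c - (a + b + 1) * X) * E * P1 - (1 - X) * a * b * E * P"
    by (simp add: algebra_simps)
  also have "\<dots> = E * (1 - X) * (X * (1 - X) * P2 + (c - ((c - a) + (c - b) + 1) * X) * P1 - (c - a) * (c - b) * P)"
    unfolding h assms(1) assms(3) by (simp add: algebra_simps)
  finally show ?thesis .
qed

text \<open>The first factor is the binomial series of (1 - X)^(\<gamma> - \<alpha> - \<beta>). The
  product solves the hypergeometric equation and has constant term 1, so uniqueness yields Euler's
  transformation.\<close>

lemma fps_2F1_euler:
  assumes "\<gamma> \<notin> \<int>\<^sub>\<le>\<^sub>0"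
  shows "fps_2F1 \<alpha> \<beta> \<gamma> = Abs_fps (\<lambda>n. pochhammer (\<alpha> + \<beta> - \<gamma>) n / fact n) * fps_2F1 (\<gamma> - \<alpha>) (\<gamma> - \<beta>) \<gamma>"
proof -
  define s where "s = \<gamma> - \<alpha> - \<beta>"
  define E :: "complex fps" where "E = Abs_fps (\<lambda>n. pochhammer (-s) n / fact n)"
  define p where "p = fps_2F1 (\<gamma> - \<alpha>) (\<gamma> - \<beta>) \<gamma>"
  have E1: "(1 - fps_X) * fps_deriv E = - (fps_const s * E)"
  proof (rule fps_ext)
    fix n
    have nz: "(of_nat n + 1 :: complex) \<noteq> 0" by (metis of_nat_Suc of_nat_neq_0 add.commute)
    have rec: "(of_nat n + 1) * E $ Suc n = (of_nat n - s) * E $ n"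
      using nz by (simp add: E_def pochhammer_rec' divide_simps add.commute)
    have "((1 - fps_X) * fps_deriv E) $ n = (of_nat n + 1) * E $ Suc n - of_nat n * E $ n"
      by (cases n) (simp_all add: left_diff_distrib add.commute)
    then show "((1 - fps_X) * fps_deriv E) $ n = (- (fps_const s * E)) $ n"
      unfolding rec by (simp add: algebra_simps)
  qed
  have E2: "(1 - fps_X) * fps_deriv (fps_deriv E) = (1 - fps_const s) * fps_deriv E"
  proof -
    have "fps_deriv ((1 - fps_X) * fps_deriv E) = fps_deriv (- (fps_const s * E))" by (simp only: E1)
    then show ?thesis by (simp add: algebra_simps)
  qed
  have s: "fps_const s = fps_const \<gamma> - fps_const \<alpha> - fps_const \<beta>" unfolding s_def by simp
  have "(1 - fps_X) * fps_2F1_ode \<alpha> \<beta> \<gamma> (E * p) = E * (1 - fps_X) * fps_2F1_ode (\<gamma> - \<alpha>) (\<gamma> - \<beta>) \<gamma> p"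
    using euler_ode_identity[OF E1 E2 s, of p "fps_deriv p" "fps_deriv (fps_deriv p)"]
    by (simp add: fps_2F1_ode_def algebra_simps flip: fps_const_sub)
  also have "fps_2F1_ode (\<gamma> - \<alpha>) (\<gamma> - \<beta>) \<gamma> p = 0"
    using fps_2F1_unique[OF assms] unfolding p_def by blast
  finally have "(1 - fps_X) * fps_2F1_ode \<alpha> \<beta> \<gamma> (E * p) = 0" by simp
  moreover have "(1 - fps_X :: complex fps) \<noteq> 0" 
    using fps_nonzero_nth by fastforce
  ultimately have "fps_2F1_ode \<alpha> \<beta> \<gamma> (E * p) = 0" by simp
  moreover have "(E * p) $ 0 = 1" by (simp add: E_def p_def fps_2F1_def)
  ultimately have "E * p = fps_2F1 \<alpha> \<beta> \<gamma>" using fps_2F1_unique[OF assms] by blast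
  moreover have "- s = \<alpha> + \<beta> - \<gamma>" by (simp add: s_def)
  ultimately show ?thesis by (simp add: E_def p_def)
qed

lemma pochhammer_reverse:
  fixes z :: complex
  shows "pochhammer (1 - of_nat n - z) k = (-1) ^ k * pochhammer (z + of_nat n - of_nat k) k"
  using pochhammer_minus[of "z + of_nat n - 1" k] by (simp add: algebra_simps)

lemma pochhammer_neg_nat:
  "k \<le> n \<Longrightarrow> pochhammer (- of_nat n :: complex) k = (-1) ^ k * fact n / fact (n - k)"
  using pochhammer_minus[of "of_nat n :: complex" k] pochhammer_product[of "n - k" n "1 :: complex"]
  by (simp add: pochhammer_fact[symmetric] algebra_simps of_nat_diff)

text \<open>In essence Whipple's transformation of terminating balanced series. Since
  \<open>rGamma a = 0\<close>, only the first half of each \<open>L_reg\<close> survives, and it is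
  a finite sum. Reversing Pochhammer symbols shows both sums to be multiples of one coefficient
  \<open>C\<close> of a product of two power series, factorised in two ways.\<close>

lemma L_defect_terminating:
  assumes bal: "e + f + g - a - b - c - d = 1" and a: "a = - of_nat N" and "e \<notin> \<int>" "b \<notin> \<int>"
  shows "L_defect a b c d e f g = 0"
proof -
  have e: "e \<notin> \<int>\<^sub>\<le>\<^sub>0" using assms nonpos_Ints_subset_Ints by auto
  have b0: "1 + a - b \<notin> \<int>\<^sub>\<le>\<^sub>0"
  proof
    assume "1 + a - b \<in> \<int>\<^sub>\<le>\<^sub>0"
    then have "1 + a - b \<in> \<int>" using nonpos_Ints_subset_Ints by auto
    then have "(1 + a) - (1 + a - b) \<in> \<int>" unfolding a by (intro Ints_diff) auto
    then show False using assms by simp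
  qed
  have pe: "pochhammer e n \<noteq> 0" for n using e pochhammer_eq_0_imp_nonpos_Int by blast
  have pb: "pochhammer (1 + a - b) n \<noteq> 0" for n using b0 pochhammer_eq_0_imp_nonpos_Int by blast
  define C where "C = (fps_2F1 c d e * fps_2F1 (1 + a - f) (1 + a - g) (1 + a - b)) $ N"
  have "fps_2F1 c d e * fps_2F1 (1 + a - f) (1 + a - g) (1 + a - b) =
        fps_2F1 (f - b) (g - b) (1 + a - b) * fps_2F1 (e - c) (e - d) e"
  proof -
    \<comment> \<open>By the balancing condition both Euler transformations carry the same power of
      1 - X, which may thus be attached to either factor.\<close>
    have "c + d - e = (f - b) + (g - b) - (1 + a - b)" using bal by (simp add: algebra_simps)
    moreover have "1 + a - b - (f - b) = 1 + a - f" "1 + a - b - (g - b) = 1 + a - g" by simp_all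
    ultimately show ?thesis
      using fps_2F1_euler[OF e, of c d] fps_2F1_euler[OF b0, of "f - b" "g - b"] by (simp only: mult_ac)
  qed
  then have eq: "C = (fps_2F1 (f - b) (g - b) (1 + a - b) * fps_2F1 (e - c) (e - d) e) $ N"
    unfolding C_def by (rule arg_cong)
  have C: "C = (\<Sum>k=0..N. fps_2F1 c d e $ k * fps_2F1 (1 + a - f) (1 + a - g) (1 + a - b) $ (N - k))"
    "C = (\<Sum>k=0..N. fps_2F1 (f - b) (g - b) (1 + a - b) $ k * fps_2F1 (e - c) (e - d) e $ (N - k))"
    by (simp only: C_def fps_mult_nth, simp only: eq fps_mult_nth)
  have fin: "F43_reg a b' c' d' e' f' g' = (\<Sum>k=0..N. F43_reg_term a b' c' d' e' f' g' k)" for b' c' d' e' f' g'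
    unfolding F43_reg_def
  proof (rule suminf_finite)
    fix n assume "n \<notin> {0..N}"
    then have "pochhammer a n = 0" unfolding a by (simp add: pochhammer_of_nat_eq_0_lemma)
    then show "F43_reg_term a b' c' d' e' f' g' n = 0" by (simp add: F43_reg_term_def)
  qed auto
  have X: "F43_reg a b c d e f g = C * ((-1) ^ N * pochhammer b N * fact N * rGamma e * rGamma (f + of_nat N) * rGamma (g + of_nat N))"
    unfolding fin C(1) sum_distrib_right
  proof (rule sum.cong)
    fix k assume "k \<in> {0..N}"
    then have k: "k \<le> N" by simp
    have r: "pochhammer (1 + a - z) (N - k) = (-1) ^ (N - k) * pochhammer (z + of_nat k) (N - k)" for z
      using pochhammer_reverse[of N z "N - k"] k by (simp add: a of_nat_diff algebra_simps)
    have rg: "rGamma (z + of_nat k) = pochhammer (z + of_nat k) (N - k) * rGamma (z + of_nat N)" for z :: complex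
      using pochhammer_rGamma[of "z + of_nat k" "N - k"] k by (simp add: of_nat_diff)
    have nz: "pochhammer (b + of_nat k) (N - k) \<noteq> 0" using pb[of "N - k"] unfolding r by auto
    have sgn: "(-1 :: complex) ^ N = (-1) ^ (N - k) * (-1) ^ k" using k by (simp flip: power_add)
    have sq: "(-1 :: complex) ^ (N - k) * (-1) ^ (N - k) = 1" by (simp flip: power_mult_distrib)
    show "F43_reg_term a b c d e f g k = fps_2F1 c d e $ k * fps_2F1 (1 + a - f) (1 + a - g) (1 + a - b) $ (N - k) *
       ((-1) ^ N * pochhammer b N * fact N * rGamma e * rGamma (f + of_nat N) * rGamma (g + of_nat N))"
      unfolding F43_reg_term_def fps_2F1_def fps_nth_Abs_fps r rg[of f] rg[of g] pochhammer_product[OF k, of b] sgn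
        pochhammer_rGamma[of e k]
      using pe[of k] nz sq pochhammer_neg_nat[OF k]
      by (simp add: a field_simps)
  qed auto
  have Y: "F43_reg a (1 + a - e) (f - b) (g - b) (1 + a - b) (1 + a + c - e) (1 + a + d - e) =
      C * (rGamma (1 + c - e) * rGamma (1 + d - e) * rGamma (1 + a - b) * pochhammer e N * fact N)"
    unfolding fin C(2) sum_distrib_right
  proof (rule sum.cong)
    fix k assume "k \<in> {0..N}"
    then have k: "k \<le> N" by simp
    have rg: "pochhammer (e - z) (N - k) * rGamma (1 + z - e) = (-1) ^ (N - k) * rGamma (1 + a + z - e + of_nat k)" for z
      using pochhammer_rGamma[of "1 + a + z - e + of_nat k" "N - k"] pochhammer_minus[of "z - e" "N - k"] k
      by (simp add: a of_nat_diff algebra_simps)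
    have ek: "pochhammer (1 + a - e) k = (-1) ^ k * pochhammer (e + of_nat (N - k)) k"
      using pochhammer_reverse[of N e k] k by (simp add: a of_nat_diff algebra_simps)
    have eN: "pochhammer e N = pochhammer e (N - k) * pochhammer (e + of_nat (N - k)) k"
      using pochhammer_product[of "N - k" N e] k by simp
    have sq: "(-1 :: complex) ^ m * (-1) ^ m = 1" for m by (simp flip: power_mult_distrib)
    have "fps_2F1 (f - b) (g - b) (1 + a - b) $ k * fps_2F1 (e - c) (e - d) e $ (N - k) *
       (rGamma (1 + c - e) * rGamma (1 + d - e) * rGamma (1 + a - b) * pochhammer e N * fact N)
      = pochhammer (f - b) k * pochhammer (g - b) k / fact k * (rGamma (1 + a - b) / pochhammer (1 + a - b) k) *
        (pochhammer (e - c) (N - k) * rGamma (1 + c - e)) * (pochhammer (e - d) (N - k) * rGamma (1 + d - e)) *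
        (pochhammer e N / pochhammer e (N - k)) * (fact N / fact (N - k))"
      by (simp add: fps_2F1_def mult_ac)
    also have "rGamma (1 + a - b) / pochhammer (1 + a - b) k = rGamma (1 + a - b + of_nat k)"
      using pochhammer_rGamma[of "1 + a - b" k] pb[of k] by (simp add: field_simps)
    also have "pochhammer e N / pochhammer e (N - k) = (-1) ^ k * pochhammer (1 + a - e) k"
      unfolding eN ek using pe[of "N - k"] sq[of k] by (simp flip: mult.assoc)
    also have "fact N / fact (N - k) = (-1) ^ k * pochhammer a k"
      unfolding a pochhammer_neg_nat[OF k] using sq[of k] by (simp flip: mult.assoc)
    finally show "F43_reg_term a (1 + a - e) (f - b) (g - b) (1 + a - b) (1 + a + c - e) (1 + a + d - e) k =
      fps_2F1 (f - b) (g - b) (1 + a - b) $ k * fps_2F1 (e - c) (e - d) e $ (N - k) *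
       (rGamma (1 + c - e) * rGamma (1 + d - e) * rGamma (1 + a - b) * pochhammer e N * fact N)"
      unfolding rg F43_reg_term_def using sq[of k] sq[of "N - k"] by (simp add: field_simps)
  qed auto
  have Y': "F43_reg (f - b) (g - b) a (1 + a - e) (1 + a - b) (1 + a + c - e) (1 + a + d - e) =
     F43_reg a (1 + a - e) (f - b) (g - b) (1 + a - b) (1 + a + c - e) (1 + a + d - e)" by (rule F43_reg_perm)
  have ra: "rGamma a = 0" unfolding a by (simp add: rGamma_eq_zero_iff)
  have eqs: "1 + (f - b) - (1 + a - b) = f + of_nat N" "1 + (g - b) - (1 + a - b) = g + of_nat N"
     "1 + a - (1 + a - b) = b" "1 + (1 + a - e) - (1 + a - b) = 1 + b - e"
    by (simp_all add: a algebra_simps)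
  \<comment> \<open>Since 1 + a - z = 1 - (z + N), this is the reflection formula. At z = e and z =
    b it supplies the two sines of \<open>L_defect\<close>.\<close>
  have reb: "rGamma (z + of_nat N) * rGamma (1 + a - z) = (-1) ^ N * sinpi z / of_real pi" for z
    using rGamma_reflection_complex[of "z + of_nat N"] sinpi_add_nat[of z N] by (simp add: a algebra_simps)
  have sb: "sinpi (1 + a - b) = (-1) ^ N * sinpi b"
    using sinpi_add_nat[of b N] sinpi_1_plus[of "- (b + of_nat N)"] sinpi_minus[of "b + of_nat N"]
    by (simp add: a algebra_simps)
  have "sinpi (1 + a - b) * (rGamma (1 + a - e) * ((-1) ^ N * pochhammer b N * rGamma e)) =
     sinpi e * (rGamma b * (rGamma (1 + a - b) * pochhammer e N))"
  proof -
    have h1: "sinpi (1 + a - b) * (rGamma (1 + a - e) * ((-1) ^ N * pochhammer b N * rGamma e)) =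
       (-1) ^ N * sinpi b * (-1) ^ N * pochhammer b N * pochhammer e N * (rGamma (e + of_nat N) * rGamma (1 + a - e))"
      unfolding sb pochhammer_rGamma[of e N] by (simp add: mult_ac)
    have h2: "sinpi e * (rGamma b * (rGamma (1 + a - b) * pochhammer e N)) =
       sinpi e * pochhammer b N * pochhammer e N * (rGamma (b + of_nat N) * rGamma (1 + a - b))"
      unfolding pochhammer_rGamma[of b N] by (simp add: mult_ac)
    have sq: "(-1 :: complex) ^ N * (-1) ^ N = 1" by (simp flip: power_mult_distrib)
    have "q * x * q * p * r * (q * y / w) = (q * q) * (y * p * r * (q * x / w))" for q x y p r w :: complex
      by simp
    then show ?thesis unfolding h1 h2 reb sq by (simp only: sq mult_1)
  qed
  then have "sinpi (1 + a - b) * (rGamma (1 + a - e) * ((-1) ^ N * pochhammer b N * rGamma e)) *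
     (C * fact N * rGamma (f + of_nat N) * rGamma (g + of_nat N) * rGamma (1 + b - e) * rGamma (1 + c - e) * rGamma (1 + d - e)) =
     sinpi e * (rGamma b * (rGamma (1 + a - b) * pochhammer e N)) *
     (C * fact N * rGamma (f + of_nat N) * rGamma (g + of_nat N) * rGamma (1 + b - e) * rGamma (1 + c - e) * rGamma (1 + d - e))"
    by (simp only:)
  then show ?thesis
    unfolding L_defect_def L_reg_def eqs Y' X Y ra by (simp add: mult_ac)
qed

section \<open>The two-term relation\<close>

text \<open>With |sin(pi u)|^2 = sin^2(pi Re u) + sinh^2(pi Im u) and cosh^2 = 1 + sinh^2, the claim
  can be checked summand by summand.\<close>

lemma sinpi_bounded_below_vertical:
  assumes "m \<le> \<bar>sin (pi * Re u)\<bar>" "0 < m" "m \<le> 1"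
  shows "sinpi_bounded_below m u"
proof -
  have "(m * cosh (pi * Im u))\<^sup>2 = m\<^sup>2 + m\<^sup>2 * (sinh (pi * Im u))\<^sup>2"
    by (simp add: power_mult_distrib cosh_square_eq algebra_simps)
  also have "\<dots> \<le> (sin (pi * Re u))\<^sup>2 + 1 * (sinh (pi * Im u))\<^sup>2"
    using assms power_mono[of m "\<bar>sin (pi * Re u)\<bar>" 2] power_mono[of m 1 2]
    by (intro add_mono mult_right_mono) auto
  also have "\<dots> = norm (sinpi u) ^ 2" by (simp add: norm_sin_eq)
  finally show ?thesis unfolding sinpi_bounded_below_def by (rule power2_le_imp_le) simp
qed

lemma sinpi_bounded_below_horizontal:
  assumes "1 \<le> \<bar>Im u\<bar>" "m \<le> 1/2" "0 < m"
  shows "sinpi_bounded_below m u"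
proof -
  define y where "y = pi * \<bar>Im u\<bar>"
  define s where "s = sinh y"
  have y: "3 \<le> y" unfolding y_def using assms(1) pi_gt3 mult_mono[of 3 pi 1 "\<bar>Im u\<bar>"] by simp
  then have "exp (- y) \<le> 1" by simp
  moreover have "4 \<le> exp y" using y exp_ge_add_one_self[of y] by linarith
  ultimately have "2 \<le> exp y - exp (- y)" by linarith
  then have "1 \<le> s" unfolding s_def sinh_field_def by simp
  then have s: "1 \<le> s\<^sup>2" by (simp add: one_le_power)
  have s2: "(sinh (pi * Im u))\<^sup>2 = s\<^sup>2" unfolding s_def y_def by (simp add: abs_if)
  have "(m * cosh (pi * Im u))\<^sup>2 = m\<^sup>2 * (s\<^sup>2 + 1)"
    by (simp add: power_mult_distrib cosh_square_eq s2)
  also have "\<dots> \<le> (1/2)\<^sup>2 * (s\<^sup>2 + 1)"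
    using assms by (intro mult_right_mono power_mono) auto
  also have "\<dots> \<le> s\<^sup>2" using s by (simp add: power2_eq_square)
  also have "\<dots> \<le> norm (sinpi u) ^ 2" by (simp add: norm_sin_eq s2)
  finally show ?thesis unfolding sinpi_bounded_below_def by (rule power2_le_imp_le) simp
qed

text \<open>The estimates are available only away from the poles of the gamma factors. A large
  rectangle has its whole boundary in the controlled set when its vertical sides lie on integer
  translates of Re z = x0 and its horizontal sides at height at least 1; the maximum principle
  covers the interior.\<close>

lemma entire_bounded_on_grid:
  assumes W: "W holomorphic_on UNIV"
    and horizontal: "\<And>z. 1 \<le> \<bar>Im z\<bar> \<Longrightarrow> norm (W z) \<le> B"
    and vertical: "\<And>z k. Re z = x0 + of_int k \<Longrightarrow> norm (W z) \<le> B"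
  shows "norm (W z) \<le> B"
proof -
  define k where "k = \<lceil>norm z + \<bar>x0\<bar>\<rceil> + 1"
  have k: "real_of_int k \<ge> norm z + \<bar>x0\<bar> + 1" unfolding k_def by linarith
  let ?R = "cbox (Complex (x0 - of_int k) (- of_int k)) (Complex (x0 + of_int k) (of_int k))"
  show ?thesis
  proof (rule maximum_modulus_frontier[where S = ?R and f = W and \<xi> = z])
    show "W holomorphic_on interior ?R" "continuous_on (closure ?R) W"
      using W holomorphic_on_subset holomorphic_on_imp_continuous_on by blast+
    show "bounded ?R" by simp
    show "z \<in> ?R" using k abs_Re_le_cmod[of z] abs_Im_le_cmod[of z]
      by (auto simp: in_cbox_complex_iff)
    fix w assume "w \<in> frontier ?R"
    then have w: "w \<in> ?R" "w \<notin> box (Complex (x0 - of_int k) (- of_int k)) (Complex (x0 + of_int k) (of_int k))"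
      by (auto simp: frontier_def interior_cbox)
    then consider "Re w = x0 + of_int (-k)" | "Re w = x0 + of_int k" | "\<bar>Im w\<bar> = of_int k"
      by (fastforce simp: in_cbox_complex_iff in_box_complex_iff)
    then show "norm (W w) \<le> B"
    proof cases
      case 3
      then show ?thesis using k by (intro horizontal) (smt (verit) norm_ge_zero abs_ge_zero)
    qed (rule vertical, assumption)+
  qed
qed

text \<open>Only countably many offsets make one of the sines vanish. Integer translation does not
  change their absolute values, so a minimum over a finite set is a bound for all
  \<open>k\<close>.\<close>

lemma exists_nonint_shift:
  fixes ls :: "real set"
  assumes "finite ls"
  shows "\<exists>x0 m. 0 < m \<and> m \<le> 1/2 \<and> (\<forall>l\<in>ls. \<forall>k::int. m \<le> \<bar>sin (pi * (l + (x0 + of_int k)))\<bar>)"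
proof -
  have "countable (\<Union>l\<in>ls. (\<lambda>k::int. of_int k - l) ` UNIV)"
    using assms by (intro countable_UN countable_image) (auto simp: countable_finite)
  moreover have "uncountable (UNIV :: real set)" by (rule uncountable_UNIV_real)
  ultimately obtain x0 where x0: "x0 \<notin> (\<Union>l\<in>ls. (\<lambda>k::int. real_of_int k - l) ` UNIV)"
    by (metis UNIV_eq_I)
  define m where "m = Min (insert (1/2) ((\<lambda>l. \<bar>sin (pi * (l + x0))\<bar>) ` ls))"
  have pos: "\<bar>sin (pi * (l + x0))\<bar> > 0" if "l \<in> ls" for l
  proof -
    have "sin (pi * (l + x0)) \<noteq> 0"
    proof
      assume "sin (pi * (l + x0)) = 0"
      then obtain i :: int where "pi * (l + x0) = of_int i * pi" by (auto simp: sin_zero_iff_int2)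
      then have "x0 = of_int i - l" by simp
      then show False using x0 that by blast
    qed
    then show ?thesis by simp
  qed
  have "m \<le> \<bar>sin (pi * (l + (x0 + of_int k)))\<bar>" if "l \<in> ls" for l k
  proof -
    have "m \<le> \<bar>sin (pi * (l + x0))\<bar>" unfolding m_def using assms that by (intro Min_le) auto
    also have "\<dots> = \<bar>sin (pi * (l + (x0 + of_int k)))\<bar>"
      by (simp add: distrib_left sin_add add.assoc[symmetric] sin_times_pi_eq_0 abs_mult)
    finally show ?thesis .
  qed
  moreover have "m > 0" unfolding m_def using assms pos by (subst Min_gr_iff) auto
  moreover have "m \<le> 1/2" unfolding m_def using assms by (intro Min_le) auto
  ultimately show ?thesis by blast
qed

text \<open>The first four inequalities in \<open>pos\<close> are the positive increments f - a, g -
  b, 1 + c - e, d of the gamma quotients. All eight are the positive upper parameters of the four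
  coefficient series, for each of which balance turns the convergence condition into
  \<open>h\<close>. The conditions \<open>gen\<close> make the four families of poles
  disjoint.\<close>

lemma L_defect_real:
  fixes a b c d e f g :: real
  assumes bal: "e + f + g - a - b - c - d = 1"
    and pos: "f > a" "g > b" "1 + c > e" "d > 0" "c > 0" "1 + d > e" "f > b" "g > a"
    and h: "c + d < e"
    and gen: "e \<notin> \<int>" "a - b \<notin> \<int>" "a - b + e \<notin> \<int>" "a - b - e \<notin> \<int>"
  shows "L_defect (of_real a) (of_real b) (of_real c) (of_real d) (of_real e) (of_real f) (of_real g) = 0"
proof -
  define a' b' c' d' e' f' g' where defs: "a' = complex_of_real a" "b' = complex_of_real b"
    "c' = complex_of_real c" "d' = complex_of_real d" "e' = complex_of_real e"
    "f' = complex_of_real f" "g' = complex_of_real g"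
  have bal': "g' = 1 + a' + b' + c' + d' - e' - f'"
    using arg_cong[OF bal, of complex_of_real] unfolding defs by (simp add: algebra_simps)
  have nonint: "e' \<notin> \<int>" "a' - b' \<notin> \<int>" "a' - b' + e' \<notin> \<int>" "a' - b' - e' \<notin> \<int>"
    using gen unfolding defs by (auto simp flip: of_real_add of_real_diff)
  \<comment> \<open>The common shift preserves the balance and leaves c, d, e, f - b, g - b and a -
    b fixed.\<close>
  define E where "E z = L_defect (a' + z) (b' + z) c' d' e' (f' + z) (g' + z)" for z
  have E_eq: "E z = sinpi (1 + a' - b') * L_reg (a' + z) (b' + z) c' d' e' (f' + z) (g' + z) -
      sinpi e' * L_reg (f' - b') (g' - b') (a' + z) (1 + a' - e' + z) (1 + a' - b') (1 + a' + c' - e' + z) (1 + a' + d' - e' + z)" for z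
    by (simp add: E_def L_defect_def algebra_simps)
  have E_hol: "E holomorphic_on UNIV"
    unfolding E_eq by (intro holomorphic_intros) (simp_all add: bal' algebra_simps)
  define ls where "ls = {a, b, 1 + a - e, 1 + b - e}"
  have E0: "E z = 0" if l: "l \<in> {a', b', 1 + a' - e', 1 + b' - e'}" and z: "l + z \<in> \<int>\<^sub>\<le>\<^sub>0" for l z
  proof -
    obtain N where N: "l + z = - of_nat N" using z by (elim nonpos_Ints_cases')
    have zeq: "z = - of_nat N - l" using N by (simp add: eq_diff_eq add.commute)
    have e: "2 - e' \<notin> \<int>" using Ints_diff[of 2 "2 - e'"] nonint by auto
    have bal1: "e' + (f' + z) + (g' + z) - (a' + z) - (b' + z) - c' - d' = 1" by (simp add: bal')
    have bal2: "(2 - e') + (1 + (f' + z) - e') + (1 + (g' + z) - e') - (1 + (a' + z) - e')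
        - (1 + (b' + z) - e') - (1 + c' - e') - (1 + d' - e') = 1" by (simp add: bal')
    have int: "\<And>k. k \<in> \<int> \<Longrightarrow> k + of_nat N \<in> (\<int> :: complex set)" by simp
    have ab: "b' - a' \<notin> \<int>" using nonint(2) minus_in_Ints_iff[of "a' - b'"] by simp
    have key: "w \<notin> \<int>" if "w = - of_nat N + \<delta>" "\<delta> \<notin> \<int>" for w \<delta> :: complex
      using that int[of w] by auto
    have q: "L_defect (1 + (a' + z) - e') (1 + (b' + z) - e') (1 + c' - e') (1 + d' - e') (2 - e') (1 + (f' + z) - e') (1 + (g' + z) - e') = - E z"
      unfolding E_def by (rule L_defect_swap_e)
    consider "l = a'" | "l = b'" | "l = 1 + a' - e'" | "l = 1 + b' - e'" using l by auto
    then show ?thesis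
    proof cases
      case 1
      have "b' + z = - of_nat N + (b' - a')" unfolding zeq 1 by simp
      moreover have "a' + z = - of_nat N" using N 1 by simp
      ultimately show ?thesis unfolding E_def using L_defect_terminating[OF bal1 _ nonint(1) key[OF _ ab]] by blast
    next
      case 2
      have "a' + z = - of_nat N + (a' - b')" unfolding zeq 2 by simp
      moreover have "b' + z = - of_nat N" using N 2 by simp
      moreover have "e' + (f' + z) + (g' + z) - (b' + z) - (a' + z) - c' - d' = 1" using bal1 by (simp add: algebra_simps)
      ultimately have "L_defect (b' + z) (a' + z) c' d' e' (f' + z) (g' + z) = 0"
        using L_defect_terminating[OF _ _ nonint(1) key[OF _ nonint(2)]] by blast
      then show ?thesis using L_defect_swap12[of "b' + z" "a' + z"] unfolding E_def by simp
    next
      case 3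
      have "1 + (b' + z) - e' = - of_nat N + (b' - a')" unfolding zeq 3 by simp
      moreover have "1 + (a' + z) - e' = - of_nat N" unfolding zeq 3 by simp
      ultimately show ?thesis using q L_defect_terminating[OF bal2 _ e key[OF _ ab]] by simp
    next
      case 4
      have "1 + (a' + z) - e' = - of_nat N + (a' - b')" unfolding zeq 4 by simp
      moreover have "1 + (b' + z) - e' = - of_nat N" unfolding zeq 4 by simp
      moreover have "(2 - e') + (1 + (f' + z) - e') + (1 + (g' + z) - e') - (1 + (b' + z) - e')
        - (1 + (a' + z) - e') - (1 + c' - e') - (1 + d' - e') = 1" using bal2 by (simp add: algebra_simps)
      ultimately have "L_defect (1 + (b' + z) - e') (1 + (a' + z) - e') (1 + c' - e') (1 + d' - e') (2 - e') (1 + (f' + z) - e') (1 + (g' + z) - e') = 0"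
        using L_defect_terminating[OF _ _ e key[OF _ nonint(2)]] by blast
      then show ?thesis using q L_defect_swap12[of "1 + (b' + z) - e'" "1 + (a' + z) - e'"] by simp
    qed
  qed
  have distinct: "w \<notin> \<int>\<^sub>\<le>\<^sub>0" if "v \<in> \<int>\<^sub>\<le>\<^sub>0" "w - v \<notin> \<int>" for v w :: complex
    using that Ints_diff[of w v] nonpos_Ints_subset_Ints by blast
  have nonint': "1 - e' \<notin> \<int>" "e' - 1 \<notin> \<int>" "b' - a' \<notin> \<int>" "b' - a' + e' \<notin> \<int>" "b' - a' - e' \<notin> \<int>"
    "a' - b' + e' - 1 \<notin> \<int>" "b' - a' + e' - 1 \<notin> \<int>"
    using nonint minus_in_Ints_iff[of "e'"] Ints_diff[of 1 "1 - e'"] Ints_add[of "e' - 1" 1] minus_in_Ints_iff[of "a' - b'"]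
      minus_in_Ints_iff[of "a' - b' - e'"] minus_in_Ints_iff[of "a' - b' + e'"] Ints_add[of "a' - b' + e' - 1" 1]
      Ints_add[of "b' - a' + e' - 1" 1] by (auto simp: algebra_simps)
  \<comment> \<open>The reciprocal gamma functions are divided out one at a time. As their zero sets
    are disjoint, each quotient still vanishes at the zeros of the next one.\<close>
  obtain W1 where W1: "W1 holomorphic_on UNIV" "\<And>z. E z = W1 z * rGamma (a' + z)"
    using rGamma_factor[OF E_hol, of a'] E0 by auto
  have "W1 z = 0" if "b' + z \<in> \<int>\<^sub>\<le>\<^sub>0" for z
  proof -
    have "a' + z \<notin> \<int>\<^sub>\<le>\<^sub>0" using distinct[OF that, of "a' + z"] nonint by simp
    then show ?thesis using W1(2)[of z] E0[of b' z] that by (simp add: rGamma_eq_zero_iff)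
  qed
  then obtain W2 where W2: "W2 holomorphic_on UNIV" "\<And>z. W1 z = W2 z * rGamma (b' + z)"
    using rGamma_factor[OF W1(1), of b'] by auto
  have "W2 z = 0" if "1 + a' - e' + z \<in> \<int>\<^sub>\<le>\<^sub>0" for z
  proof -
    have "a' + z \<notin> \<int>\<^sub>\<le>\<^sub>0" "b' + z \<notin> \<int>\<^sub>\<le>\<^sub>0"
      using nonint' by (auto intro!: distinct[OF that] simp: algebra_simps)
    then show ?thesis using W1(2)[of z] W2(2)[of z] E0[of "1 + a' - e'" z] that by (simp add: rGamma_eq_zero_iff)
  qed
  then obtain W3 where W3: "W3 holomorphic_on UNIV" "\<And>z. W2 z = W3 z * rGamma (1 + a' - e' + z)"
    using rGamma_factor[OF W2(1), of "1 + a' - e'"] by auto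
  have "W3 z = 0" if "1 + b' - e' + z \<in> \<int>\<^sub>\<le>\<^sub>0" for z
  proof -
    have "a' + z \<notin> \<int>\<^sub>\<le>\<^sub>0" "b' + z \<notin> \<int>\<^sub>\<le>\<^sub>0" "1 + a' - e' + z \<notin> \<int>\<^sub>\<le>\<^sub>0"
      using nonint nonint' by (auto intro!: distinct[OF that] simp: algebra_simps)
    then show ?thesis using W1(2)[of z] W2(2)[of z] W3(2)[of z] E0[of "1 + b' - e'" z] that by (simp add: rGamma_eq_zero_iff)
  qed
  then obtain W where W: "W holomorphic_on UNIV" "\<And>z. W3 z = W z * rGamma (1 + b' - e' + z)"
    using rGamma_factor[OF W3(1), of "1 + b' - e'"] by auto
  \<comment> \<open>One weighted series for each half of the two \<open>L_reg\<close>. In each half,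
    two of the four gamma factors cancel against reciprocal gamma functions and the other two remain
    as weights.\<close>
  define F1 where "F1 u v = Gamma u * Gamma v * F43_reg u v c' d' e' (u + of_real (f - a)) (v + of_real (g - b))" for u v
  define F2 where "F2 u v = Gamma u * Gamma v * F43_reg u v (1 + c' - e') (1 + d' - e') (2 - e') (u + of_real (f - a)) (v + of_real (g - b))" for u v
  define F3 where "F3 u v = Gamma u * Gamma v * F43_reg u v (f' - b') (g' - b') (1 + a' - b') (u + of_real (1 + c - e)) (v + of_real d)" for u v
  define F4 where "F4 u v = Gamma u * Gamma v * F43_reg u v (f' - a') (g' - a') (1 + b' - a') (u + of_real (1 + c - e)) (v + of_real d)" for u v
  define k1 k2 k3 k4 where k: "k1 = sinpi (1 + a' - b') * rGamma (1 + c' - e') * rGamma (1 + d' - e')"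
    "k2 = sinpi (1 + a' - b') * rGamma c' * rGamma d'"
    "k3 = sinpi e' * rGamma (f' - a') * rGamma (g' - a')"
    "k4 = sinpi e' * rGamma (f' - b') * rGamma (g' - b')"
  have W_eq: "W z = k1 * F1 (a' + z) (b' + z) - k2 * F2 (1 + a' - e' + z) (1 + b' - e' + z)
      - k3 * F3 (a' + z) (1 + a' - e' + z) + k4 * F4 (b' + z) (1 + b' - e' + z)"
    if nn: "a' + z \<notin> \<int>\<^sub>\<le>\<^sub>0" "b' + z \<notin> \<int>\<^sub>\<le>\<^sub>0" "1 + a' - e' + z \<notin> \<int>\<^sub>\<le>\<^sub>0" "1 + b' - e' + z \<notin> \<int>\<^sub>\<le>\<^sub>0" for z
  proof -
    have args: "f' + z = a' + z + of_real (f - a)" "g' + z = b' + z + of_real (g - b)"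
      "1 + (f' + z) - e' = 1 + a' - e' + z + of_real (f - a)" "1 + (g' + z) - e' = 1 + b' - e' + z + of_real (g - b)"
      "1 + a' + c' - e' + z = a' + z + of_real (1 + c - e)" "1 + a' + d' - e' + z = 1 + a' - e' + z + of_real d"
      by (simp_all add: defs)
    have X: "L_reg (a' + z) (b' + z) c' d' e' (f' + z) (g' + z) =
      rGamma (1 + a' - e' + z) * rGamma (1 + b' - e' + z) * rGamma (1 + c' - e') * rGamma (1 + d' - e') *
        F43_reg (a' + z) (b' + z) c' d' e' (a' + z + of_real (f - a)) (b' + z + of_real (g - b)) -
      rGamma (a' + z) * rGamma (b' + z) * rGamma c' * rGamma d' *
        F43_reg (1 + a' - e' + z) (1 + b' - e' + z) (1 + c' - e') (1 + d' - e') (2 - e')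
          (1 + a' - e' + z + of_real (f - a)) (1 + b' - e' + z + of_real (g - b))"
    proof -
      have 1: "1 + (a' + z) - e' = 1 + a' - e' + z" "1 + (b' + z) - e' = 1 + b' - e' + z"
        "1 + (a' + z + of_real (f - a)) - e' = 1 + a' - e' + z + of_real (f - a)"
        "1 + (b' + z + of_real (g - b)) - e' = 1 + b' - e' + z + of_real (g - b)" by simp_all
      show ?thesis unfolding L_reg_def 1 args ..
    qed
    have Y: "L_reg (f' - b') (g' - b') (a' + z) (1 + a' - e' + z) (1 + a' - b') (1 + a' + c' - e' + z) (1 + a' + d' - e' + z) =
      rGamma (f' - a') * rGamma (g' - a') * rGamma (b' + z) * rGamma (1 + b' - e' + z) *
        F43_reg (a' + z) (1 + a' - e' + z) (f' - b') (g' - b') (1 + a' - b') (a' + z + of_real (1 + c - e)) (1 + a' - e' + z + of_real d) -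
      rGamma (f' - b') * rGamma (g' - b') * rGamma (a' + z) * rGamma (1 + a' - e' + z) *
        F43_reg (b' + z) (1 + b' - e' + z) (f' - a') (g' - a') (1 + b' - a') (b' + z + of_real (1 + c - e)) (1 + b' - e' + z + of_real d)"
    proof -
      have 1: "1 + (f' - b') - (1 + a' - b') = f' - a'" "1 + (g' - b') - (1 + a' - b') = g' - a'"
        "1 + (a' + z) - (1 + a' - b') = b' + z" "1 + (1 + a' - e' + z) - (1 + a' - b') = 1 + b' - e' + z"
        "2 - (1 + a' - b') = 1 + b' - a'"
        "1 + (a' + z + of_real (1 + c - e)) - (1 + a' - b') = b' + z + of_real (1 + c - e)"
        "1 + (1 + a' - e' + z + of_real d) - (1 + a' - b') = 1 + b' - e' + z + of_real d"
        by (simp_all add: algebra_simps)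
      show ?thesis unfolding L_reg_def args 1
        by (simp only: F43_reg_perm(3)[of "a' + z"] F43_reg_perm(3)[of "b' + z"])
    qed
    have g: "Gamma w * rGamma w = 1" if "w \<notin> \<int>\<^sub>\<le>\<^sub>0" for w :: complex
      using that by (simp add: rGamma_inverse_Gamma Gamma_eq_zero_iff)
    define G where "G = Gamma (a' + z) * Gamma (b' + z) * Gamma (1 + a' - e' + z) * Gamma (1 + b' - e' + z)"
    have "W z = E z * G"
    proof -
      have cancel: "w = w * inverse p4 * inverse p3 * inverse p2 * inverse p1 * (p1 * p2 * p3 * p4)"
        if "p1 \<noteq> 0" "p2 \<noteq> 0" "p3 \<noteq> 0" "p4 \<noteq> 0" for w p1 p2 p3 p4 :: complex
        using that by (simp add: field_simps)
      show ?thesis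
        unfolding W1(2) W2(2) W3(2) W(2) G_def rGamma_inverse_Gamma
        by (rule cancel) (use nn in \<open>simp_all add: Gamma_eq_zero_iff\<close>)
    qed
    also have "\<dots> = k1 * F1 (a' + z) (b' + z) - k2 * F2 (1 + a' - e' + z) (1 + b' - e' + z)
      - k3 * F3 (a' + z) (1 + a' - e' + z) + k4 * F4 (b' + z) (1 + b' - e' + z)"
      unfolding E_eq X Y G_def F1_def F2_def F3_def F4_def k using nn
      by (simp add: rGamma_inverse_Gamma[of "a' + z"] rGamma_inverse_Gamma[of "b' + z"]
          rGamma_inverse_Gamma[of "1 + a' - e' + z"] rGamma_inverse_Gamma[of "1 + b' - e' + z"] Gamma_eq_zero_iff)
         (simp add: field_simps Gamma_eq_zero_iff)
    finally show ?thesis .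
  qed
  have s1: "summable (\<lambda>n. norm (pochhammer c' n * pochhammer d' n / fact n * rGamma (e' + of_nat n)))"
    using summable_hypergeometric_coeff[of c d e] pos h unfolding defs by simp
  have s2: "summable (\<lambda>n. norm (pochhammer (1 + c' - e') n * pochhammer (1 + d' - e') n / fact n * rGamma (2 - e' + of_nat n)))"
    using summable_hypergeometric_coeff[of "1 + c - e" "1 + d - e" "2 - e"] pos h unfolding defs by simp
  have s3: "summable (\<lambda>n. norm (pochhammer (f' - b') n * pochhammer (g' - b') n / fact n * rGamma (1 + a' - b' + of_nat n)))"
    using summable_hypergeometric_coeff[of "f - b" "g - b" "1 + a - b"] pos h bal unfolding defs by simp
  have s4: "summable (\<lambda>n. norm (pochhammer (f' - a') n * pochhammer (g' - a') n / fact n * rGamma (1 + b' - a' + of_nat n)))"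
    using summable_hypergeometric_coeff[of "f - a" "g - a" "1 + b - a"] pos h bal unfolding defs by simp
  have b1: "e' + of_real (f - a) + of_real (g - b) - c' - d' = 1"
    and b2: "2 - e' + of_real (f - a) + of_real (g - b) - (1 + c' - e') - (1 + d' - e') = 1"
    and b3: "1 + a' - b' + of_real (1 + c - e) + of_real d - (f' - b') - (g' - b') = 1"
    and b4: "1 + b' - a' + of_real (1 + c - e) + of_real d - (f' - a') - (g' - a') = 1"
    using bal' by (simp_all add: defs algebra_simps)
  have ps: "f - a > 0" "g - b > 0" "1 + c - e > 0" "d > 0" using pos by auto
  obtain x0 m where m: "0 < m" "m \<le> 1/2" "\<And>l k. l \<in> ls \<Longrightarrow> m \<le> \<bar>sin (pi * (l + (x0 + of_int k)))\<bar>"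
  proof -
    have "finite ls" by (simp add: ls_def)
    then show ?thesis using exists_nonint_shift[of ls] that by blast
  qed
  define ok where "ok z \<longleftrightarrow> sinpi_bounded_below m (a' + z) \<and> sinpi_bounded_below m (b' + z) \<and> sinpi_bounded_below m (1 + a' - e' + z) \<and> sinpi_bounded_below m (1 + b' - e' + z)" for z
  obtain B1 B2 B3 B4 where Bs: "\<And>u v. sinpi_bounded_below m u \<Longrightarrow> sinpi_bounded_below m v \<Longrightarrow> norm (F1 u v) \<le> B1"
    "\<And>u v. sinpi_bounded_below m u \<Longrightarrow> sinpi_bounded_below m v \<Longrightarrow> norm (F2 u v) \<le> B2"
    "\<And>u v. sinpi_bounded_below m u \<Longrightarrow> sinpi_bounded_below m v \<Longrightarrow> norm (F3 u v) \<le> B3"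
    "\<And>u v. sinpi_bounded_below m u \<Longrightarrow> sinpi_bounded_below m v \<Longrightarrow> norm (F4 u v) \<le> B4"
    using F43_reg_bounded[OF ps(1,2) m(1) b1 s1] F43_reg_bounded[OF ps(1,2) m(1) b2 s2]
      F43_reg_bounded[OF ps(3,4) m(1) b3 s3] F43_reg_bounded[OF ps(3,4) m(1) b4 s4]
    unfolding F1_def[symmetric] F2_def[symmetric] F3_def[symmetric] F4_def[symmetric] by blast
  define B where "B = norm k1 * B1 + norm k2 * B2 + norm k3 * B3 + norm k4 * B4"
  have W_ok: "norm (W z) \<le> B" if "ok z" for z
  proof -
    have t: "sinpi_bounded_below m (a' + z)" "sinpi_bounded_below m (b' + z)" "sinpi_bounded_below m (1 + a' - e' + z)" "sinpi_bounded_below m (1 + b' - e' + z)"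
      using that unfolding ok_def by auto
    have "W z = k1 * F1 (a' + z) (b' + z) - k2 * F2 (1 + a' - e' + z) (1 + b' - e' + z)
      - k3 * F3 (a' + z) (1 + a' - e' + z) + k4 * F4 (b' + z) (1 + b' - e' + z)"
      using t m(1) by (intro W_eq sinpi_bounded_below_not_nonpos_Int) auto
    also have "norm \<dots> \<le> B"
      unfolding B_def
      by (intro order.trans[OF norm_triangle_ineq] order.trans[OF norm_triangle_ineq4] add_mono)
         (auto simp: norm_mult intro!: mult_left_mono Bs t)
    finally show ?thesis .
  qed
  have "norm (W z) \<le> B" for z
  proof (rule entire_bounded_on_grid[OF W(1)])
    show "norm (W z) \<le> B" if "1 \<le> \<bar>Im z\<bar>" for z
      using that m by (intro W_ok) (auto simp: ok_def defs intro!: sinpi_bounded_below_horizontal)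
    show "norm (W z) \<le> B" if "Re z = x0 + of_int k" for z k
      using that m(1,2) m(3)[of _ k]
      by (intro W_ok) (auto simp: ok_def defs ls_def intro!: sinpi_bounded_below_vertical)
  qed
  then have "bounded (range W)" by (auto simp: bounded_iff)
  then obtain C where C: "\<And>z. W z = C" using Liouville_theorem[OF W(1)] unfolding constant_on_def by blast
  \<comment> \<open>Moves all four arguments to real part at least 1, as the decay estimate
    requires.\<close>
  obtain N0 :: nat where N0: "real N0 \<ge> 1 + \<bar>a\<bar> + \<bar>b\<bar> + \<bar>e\<bar>" using real_arch_simple by blast
  have lim: "(\<lambda>N. k1 * F1 (a' + of_nat N0 + of_nat N) (b' + of_nat N0 + of_nat N)
      - k2 * F2 (1 + a' - e' + of_nat N0 + of_nat N) (1 + b' - e' + of_nat N0 + of_nat N)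
      - k3 * F3 (a' + of_nat N0 + of_nat N) (1 + a' - e' + of_nat N0 + of_nat N)
      + k4 * F4 (b' + of_nat N0 + of_nat N) (1 + b' - e' + of_nat N0 + of_nat N)) \<longlonglongrightarrow> k1 * 0 - k2 * 0 - k3 * 0 + k4 * 0"
    unfolding F1_def F2_def F3_def F4_def
    by (intro tendsto_intros F43_reg_tendsto_0 ps b1 b2 b3 b4 s1 s2 s3 s4) (use N0 in \<open>auto simp: defs\<close>)
  have "(\<lambda>N. W (of_nat N0 + of_nat N)) \<longlonglongrightarrow> k1 * 0 - k2 * 0 - k3 * 0 + k4 * 0"
  proof (rule Lim_transform_eventually[OF lim], rule always_eventually, rule allI)
    fix N
    have nn: "of_real r + (of_nat N0 + of_nat N) \<notin> (\<int>\<^sub>\<le>\<^sub>0 :: complex set)" if "r \<ge> - \<bar>a\<bar> - \<bar>b\<bar> - \<bar>e\<bar>" for r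
    proof
      assume "of_real r + (of_nat N0 + of_nat N) \<in> (\<int>\<^sub>\<le>\<^sub>0 :: complex set)"
      then obtain k where "of_real r + (of_nat N0 + of_nat N) = - complex_of_nat k" by (elim nonpos_Ints_cases')
      then have "Re (of_real r + (of_nat N0 + of_nat N)) = Re (- of_nat k)" by (rule arg_cong)
      then show False using that N0 by simp
    qed
    show "k1 * F1 (a' + of_nat N0 + of_nat N) (b' + of_nat N0 + of_nat N)
      - k2 * F2 (1 + a' - e' + of_nat N0 + of_nat N) (1 + b' - e' + of_nat N0 + of_nat N)
      - k3 * F3 (a' + of_nat N0 + of_nat N) (1 + a' - e' + of_nat N0 + of_nat N)
      + k4 * F4 (b' + of_nat N0 + of_nat N) (1 + b' - e' + of_nat N0 + of_nat N) = W (of_nat N0 + of_nat N)"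
      using nn[of a] nn[of b] nn[of "1 + a - e"] nn[of "1 + b - e"]
      by (subst W_eq) (auto simp: defs add.assoc)
  qed
  then have "C = 0" unfolding C by (simp add: LIMSEQ_const_iff)
  then have "E 0 = 0" using W1(2) W2(2) W3(2) W(2) C by simp
  then show ?thesis by (simp add: E_def defs)
qed

section \<open>The periodic bilateral sum\<close>

lemma periodic_of_int:
  fixes G :: "complex \<Rightarrow> complex"
  assumes "\<And>t. G (t + 1) = G t"
  shows "G (t + of_int n) = G t"
proof -
  have nat: "G (t + of_nat n) = G t" for t n
  proof (induction n)
    case (Suc n)
    then show ?case using assms[of "t + of_nat n"] by (simp add: add_ac)
  qed simp
  show ?thesis
  proof (cases "n \<ge> 0")
    case True
    then show ?thesis using nat[of t "nat n"] by simp
  next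
    case False
    then show ?thesis using nat[of "t + of_int n" "nat (- n)"] by simp
  qed
qed

text \<open>In the variable w = exp(2 pi i t), the function G w^2 is bounded near 0 and of order
  |w|^4 at infinity, hence a polynomial of degree at most 4. The two limits along the imaginary axis
  remove its constant and its leading coefficient.\<close>

lemma periodic_trig_polynomial:
  fixes G :: "complex \<Rightarrow> complex"
  assumes hol: "G holomorphic_on UNIV" and per: "\<And>t. G (t + 1) = G t"
    and bnd: "\<And>t. norm (G t) \<le> C * cosh (pi * Im t) ^ 4"
    and lim_top: "((\<lambda>y. norm (G (Complex 0 y)) / cosh (pi * y) ^ 4) \<longlongrightarrow> 0) at_top"
    and lim_bot: "((\<lambda>y. norm (G (Complex 0 y)) / cosh (pi * y) ^ 4) \<longlongrightarrow> 0) at_bot"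
  obtains p q r where "\<And>t. G t = p * exp (2 * pi * \<i> * t) + q + r * exp (- (2 * pi * \<i> * t))"
proof -
  \<comment> \<open>The jump of \<open>Ln\<close> across its cut is invisible here, because it
    changes the argument of \<open>G\<close> by an integer.\<close>
  define k where "k w = G (Ln w / (2 * pi * \<i>)) * w ^ 2" for w
  have k_exp: "k (exp (2 * pi * \<i> * t)) = G t * exp (2 * pi * \<i> * t) ^ 2" for t
  proof -
    obtain n :: int where "Ln (exp (2 * pi * \<i> * t)) = 2 * pi * \<i> * t + (of_int (2 * n) * pi) * \<i>"
      using exp_eq[of "Ln (exp (2 * pi * \<i> * t))" "2 * pi * \<i> * t"] by auto
    then have "Ln (exp (2 * pi * \<i> * t)) / (2 * pi * \<i>) = t + of_int n" by (simp add: field_simps)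
    then show ?thesis by (simp add: k_def periodic_of_int[of G, OF per])
  qed
  have ex: "\<exists>t. w = exp (2 * pi * \<i> * t)" if "w \<noteq> 0" for w :: complex
    using that by (intro exI[of _ "Ln w / (2 * pi * \<i>)"]) simp
  have norm_k: "norm (k w) \<le> C * ((norm w + 1) / 2) ^ 4" if w: "w \<noteq> 0" for w
  proof -
    obtain t where t: "w = exp (2 * pi * \<i> * t)" using ex[OF w] by blast
    define y where "y = pi * Im t"
    have nw: "norm w = exp (- 2 * y)" unfolding t y_def by (simp add: norm_exp_eq_Re)
    have "norm (k w) = norm (G t) * norm w ^ 2" unfolding t k_exp by (simp add: norm_mult norm_power)
    also have "\<dots> \<le> C * cosh y ^ 4 * norm w ^ 2" unfolding y_def by (intro mult_right_mono bnd) simp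
    \<comment> \<open>As |w| = exp(-2 y), the fourth power of cosh times |w|^2 becomes exactly a
      quartic polynomial in |w|.\<close>
    also have "cosh y = exp y * ((norm w + 1) / 2)"
      unfolding nw cosh_field_def by (simp add: algebra_simps flip: exp_add)
    also have "C * (exp y * ((norm w + 1) / 2)) ^ 4 * norm w ^ 2
        = C * ((norm w + 1) / 2) ^ 4 * (exp y ^ 4 * norm w ^ 2)"
      by (simp only: power_mult_distrib mult_ac)
    also have "exp y ^ 4 * norm w ^ 2 = 1"
      unfolding nw by (simp flip: exp_of_nat_mult exp_add)
    finally show ?thesis by simp
  qed
  have "C \<ge> 0" using order.trans[OF norm_ge_zero bnd[of 0]] by simp
  have k_hol: "k holomorphic_on UNIV - {0}"
  proof -
    have "k field_differentiable at w0" if w0: "w0 \<noteq> 0" for w0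
    proof (rule field_differentiable_cong_ev)
      \<comment> \<open>A local branch of the logarithm obtained by dividing by \<open>w0\<close>,
        holomorphic even when \<open>w0\<close> lies on the cut of \<open>Ln\<close>.\<close>
      define h where "h w = (Ln (w / w0) + Ln w0) / (2 * pi * \<i>)" for w
      show "\<forall>\<^sub>F w in nhds w0. k w = G (h w) * w ^ 2"
      proof -
        have "\<forall>\<^sub>F w in nhds w0. w \<in> - {0}" using w0 by (intro eventually_nhds_in_open) auto
        then show ?thesis
        proof eventually_elim
          case (elim w)
          then have "exp (2 * pi * \<i> * h w) = w" using w0 by (simp add: h_def exp_add)
          then show ?case using k_exp[of "h w"] by simp
        qed
      qed
      have "(\<lambda>w. G (h w) * w ^ 2) holomorphic_on ball w0 (norm w0)"
      proof -
        have "w / w0 \<notin> \<real>\<^sub>\<le>\<^sub>0" if "w \<in> ball w0 (norm w0)" for w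
        proof
          assume "w / w0 \<in> \<real>\<^sub>\<le>\<^sub>0"
          then obtain x where x: "w / w0 = of_real x" "x \<le> 0" by (auto elim: nonpos_Reals_cases)
          then have "w0 - w = of_real (1 - x) * w0" using w0 by (simp add: field_simps)
          then have "norm (w0 - w) = (1 - x) * norm w0" using x by (simp add: norm_mult del: of_real_diff)
          then have "norm (w0 - w) \<ge> 1 * norm w0" using x mult_right_mono[of 1 "1 - x" "norm w0"] by simp
          then show False using that by (simp add: dist_norm)
        qed
        then have "h holomorphic_on ball w0 (norm w0)"
          unfolding h_def using w0 by (intro holomorphic_intros) auto
        moreover have "(G \<circ> h) holomorphic_on ball w0 (norm w0)"
          by (rule holomorphic_on_compose_gen[OF calculation hol]) auto
        ultimately show ?thesis by (intro holomorphic_intros) (simp add: o_def)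
      qed
      then show "(\<lambda>w. G (h w) * w ^ 2) field_differentiable at w0"
        using w0 by (intro holomorphic_on_imp_differentiable_at[of _ "ball w0 (norm w0)"]) auto
    qed
    then show ?thesis by (simp add: holomorphic_on_def field_differentiable_at_within)
  qed
  have "\<exists>B. \<forall>\<^sub>F w in at 0. norm (k w) \<le> B"
  proof (intro exI)
    have "\<forall>\<^sub>F w in at (0::complex). w \<in> ball 0 1 - {0}"
      by (intro eventually_at_in_open) auto
    then show "\<forall>\<^sub>F w in at 0. norm (k w) \<le> C * ((1 + 1) / 2) ^ 4"
    proof eventually_elim
      case (elim w)
      then have "norm (k w) \<le> C * ((norm w + 1) / 2) ^ 4" by (intro norm_k) auto
      also have "\<dots> \<le> C * ((1 + 1) / 2) ^ 4"
        using elim \<open>C \<ge> 0\<close> by (intro mult_left_mono power_mono) auto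
      finally show ?case .
    qed
  qed
  then obtain h where h: "h holomorphic_on UNIV" "\<And>w. w \<noteq> 0 \<Longrightarrow> h w = k w"
    using holomorphic_on_extend_bounded[of k UNIV 0] k_hol by auto
  define c where "c j = (deriv ^^ j) h 0 / fact j" for j
  have h_poly: "h w = (\<Sum>j\<le>4. (deriv ^^ j) h 0 / fact j * w ^ j)" for w
  proof (rule Liouville_polynomial[OF h(1)])
    fix w :: complex assume w: "1 \<le> norm w"
    then have "w \<noteq> 0" by auto
    then have "norm (h w) \<le> C * ((norm w + 1) / 2) ^ 4" using h(2)[of w] norm_k[of w] by simp
    also have "\<dots> \<le> C * norm w ^ 4" using w \<open>C \<ge> 0\<close> by (intro mult_left_mono power_mono) auto
    finally show "norm (h w) \<le> C * norm w ^ 4" .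
  qed
  have poly: "h w = c 0 + c 1 * w + c 2 * w ^ 2 + c 3 * w ^ 3 + c 4 * w ^ 4" for w
  proof -
    have "{..4} = {0, 1, 2, 3, 4 :: nat}" by auto
    moreover have "h w = (\<Sum>j\<le>4. c j * w ^ j)" using h_poly unfolding c_def .
    ultimately show ?thesis by (simp add: add.assoc)
  qed
  have G_w: "G t * w ^ 2 = c 0 + c 1 * w + c 2 * w ^ 2 + c 3 * w ^ 3 + c 4 * w ^ 4"
    if "w = exp (2 * pi * \<i> * t)" for t w
    using that k_exp[of t] h(2)[of w] poly[of w] by simp
  have small: "norm (G (Complex 0 y) * exp (of_real (- 4 * pi * \<bar>y\<bar>))) \<le> norm (G (Complex 0 y)) / cosh (pi * y) ^ 4" for y
  proof -
    have "exp (- (pi * \<bar>y\<bar>)) * cosh (pi * \<bar>y\<bar>) \<le> 1"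
      by (simp add: cosh_field_def algebra_simps flip: exp_add del: cosh_real_abs)
    then have "cosh (pi * y) \<le> exp (pi * \<bar>y\<bar>)"
      by (simp add: exp_minus field_simps abs_if split: if_splits)
    then have "cosh (pi * y) ^ 4 \<le> exp (pi * \<bar>y\<bar>) ^ 4" by (intro power_mono) auto
    also have "\<dots> = exp (4 * pi * \<bar>y\<bar>)" by (simp flip: exp_of_nat_mult)
    finally have "norm (G (Complex 0 y)) / exp (4 * pi * \<bar>y\<bar>) \<le> norm (G (Complex 0 y)) / cosh (pi * y) ^ 4"
      by (intro divide_left_mono) auto
    moreover have "norm (G (Complex 0 y) * exp (of_real (- 4 * pi * \<bar>y\<bar>))) = norm (G (Complex 0 y)) / exp (4 * pi * \<bar>y\<bar>)"
      by (simp only: norm_mult exp_of_real norm_of_real abs_exp_cancel divide_inverse mult_minus_left exp_minus) simp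
    ultimately show ?thesis by simp
  qed
  have c0: "c 0 = 0"
  proof -
    let ?w = "\<lambda>y. complex_of_real (exp (- 2 * pi * y))"
    have "((\<lambda>y. exp (- 2 * pi * y)) \<longlongrightarrow> 0) at_top" by real_asymp
    then have w0: "(?w \<longlongrightarrow> of_real 0) at_top" by (intro tendsto_of_real)
    have "((\<lambda>y. c 0 + c 1 * ?w y + c 2 * ?w y ^ 2 + c 3 * ?w y ^ 3 + c 4 * ?w y ^ 4) \<longlongrightarrow>
        c 0 + c 1 * of_real 0 + c 2 * of_real 0 ^ 2 + c 3 * of_real 0 ^ 3 + c 4 * of_real 0 ^ 4) at_top"
      by (intro tendsto_intros w0)
    moreover have "((\<lambda>y. c 0 + c 1 * ?w y + c 2 * ?w y ^ 2 + c 3 * ?w y ^ 3 + c 4 * ?w y ^ 4) \<longlongrightarrow> 0) at_top"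
    proof (rule Lim_null_comparison[OF _ lim_top])
      show "\<forall>\<^sub>F y in at_top. norm (c 0 + c 1 * ?w y + c 2 * ?w y ^ 2 + c 3 * ?w y ^ 3 + c 4 * ?w y ^ 4)
          \<le> norm (G (Complex 0 y)) / cosh (pi * y) ^ 4"
        using eventually_ge_at_top[of 0]
      proof eventually_elim
        case (elim y)
        have "2 * pi * \<i> * Complex 0 y = of_real (- 2 * pi * y)" by (simp add: complex_eq_iff)
        then have "?w y = exp (2 * pi * \<i> * Complex 0 y)" by (simp only: exp_of_real)
        then have fin: "c 0 + c 1 * ?w y + c 2 * ?w y ^ 2 + c 3 * ?w y ^ 3 + c 4 * ?w y ^ 4 = G (Complex 0 y) * ?w y ^ 2"
          using G_w by metis
        have w2: "?w y ^ 2 = exp (of_real (- 4 * pi * \<bar>y\<bar>))"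
        proof -
          have "exp (- 2 * pi * y) ^ 2 = exp (- 4 * pi * \<bar>y\<bar>)" using elim by (simp flip: exp_of_nat_mult)
          then show ?thesis by (simp only: exp_of_real flip: of_real_power)
        qed
        show ?case unfolding fin unfolding w2 by (rule small)
      qed
    qed
    ultimately show ?thesis using tendsto_unique[of at_top] by force
  qed
  have c4: "c 4 = 0"
  proof -
    let ?w = "\<lambda>y. complex_of_real (exp (2 * pi * y))"
    let ?f = "\<lambda>y. c 0 * ?w y ^ 4 + c 1 * ?w y ^ 3 + c 2 * ?w y ^ 2 + c 3 * ?w y + c 4"
    have "((\<lambda>y. exp (2 * pi * y)) \<longlongrightarrow> 0) at_bot" by real_asymp
    then have w0: "(?w \<longlongrightarrow> of_real 0) at_bot" by (intro tendsto_of_real)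
    have "(?f \<longlongrightarrow> c 0 * of_real 0 ^ 4 + c 1 * of_real 0 ^ 3 + c 2 * of_real 0 ^ 2 + c 3 * of_real 0 + c 4) at_bot"
      by (intro tendsto_intros w0)
    moreover have "(?f \<longlongrightarrow> 0) at_bot"
    proof (rule Lim_null_comparison[OF _ lim_bot])
      show "\<forall>\<^sub>F y in at_bot. norm (?f y) \<le> norm (G (Complex 0 y)) / cosh (pi * y) ^ 4"
        using eventually_le_at_bot[of 0]
      proof eventually_elim
        case (elim y)
        define v where "v = exp (2 * pi * \<i> * Complex 0 y)"
        have "2 * pi * \<i> * Complex 0 y = of_real (- (2 * pi * y))" by (simp add: complex_eq_iff)
        then have "v = exp (of_real (- (2 * pi * y)))" unfolding v_def by (rule arg_cong)
        also have "\<dots> = inverse (?w y)" by (simp only: exp_of_real exp_minus of_real_inverse)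
        finally have v: "v = inverse (?w y)" .
        have "?w y \<noteq> 0" by simp
        have "?f y = (c 0 + c 1 * v + c 2 * v ^ 2 + c 3 * v ^ 3 + c 4 * v ^ 4) * ?w y ^ 4"
          unfolding v using \<open>?w y \<noteq> 0\<close> by (simp add: field_simps power_numeral_reduce)
        also have "\<dots> = G (Complex 0 y) * v ^ 2 * ?w y ^ 4" using G_w[OF v_def] by simp
        also have "\<dots> = G (Complex 0 y) * ?w y ^ 2"
          unfolding v using \<open>?w y \<noteq> 0\<close> by (simp add: field_simps power_numeral_reduce)
        finally have fin: "?f y = G (Complex 0 y) * ?w y ^ 2" .
        have w2: "?w y ^ 2 = exp (of_real (- 4 * pi * \<bar>y\<bar>))"
        proof -
          have "exp (2 * pi * y) ^ 2 = exp (- 4 * pi * \<bar>y\<bar>)" using elim by (simp flip: exp_of_nat_mult)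
          then show ?thesis by (simp only: exp_of_real flip: of_real_power)
        qed
        show ?case unfolding fin unfolding w2 by (rule small)
      qed
    qed
    ultimately show ?thesis using tendsto_unique[of at_bot] by force
  qed
  show ?thesis
  proof (rule that)
    fix t
    define w where "w = exp (2 * pi * \<i> * t)"
    have "w \<noteq> 0" by (simp add: w_def)
    have "G t * w ^ 2 = c 1 * w + c 2 * w ^ 2 + c 3 * w ^ 3" using G_w[OF w_def] c0 c4 by simp
    also have "\<dots> = (c 3 * w + c 2 + c 1 * inverse w) * w ^ 2"
      using \<open>w \<noteq> 0\<close> by (simp add: field_simps power2_eq_square power3_eq_cube)
    finally have "G t = c 3 * w + c 2 + c 1 * inverse w" using \<open>w \<noteq> 0\<close> by simp
    then show "G t = c 3 * exp (2 * pi * \<i> * t) + c 2 + c 1 * exp (- (2 * pi * \<i> * t))"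
      by (simp only: w_def exp_minus)
  qed
qed

section \<open>The bilateral sum: convergence, holomorphy and period\<close>

definition bilateral_term ::
  "complex \<Rightarrow> complex \<Rightarrow> complex \<Rightarrow> complex \<Rightarrow> complex \<Rightarrow> complex \<Rightarrow> complex \<Rightarrow> complex \<Rightarrow> complex" where
  "bilateral_term a b c d e f g w = rGamma (1 - a - w) * rGamma (1 - b - w) * rGamma (1 - c - w) * rGamma (1 - d - w) *
     (rGamma (1 + w) * rGamma (e + w) * rGamma (f + w) * rGamma (g + w))"

definition bilateral ::
  "complex \<Rightarrow> complex \<Rightarrow> complex \<Rightarrow> complex \<Rightarrow> complex \<Rightarrow> complex \<Rightarrow> complex \<Rightarrow> complex \<Rightarrow> complex" where
  "bilateral a b c d e f g t =
     (\<Sum>n. bilateral_term a b c d e f g (t + of_nat n)) + (\<Sum>n. bilateral_term a b c d e f g (t - 1 - of_nat n))"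

text \<open>The four signs coming from the upper parameters cancel, so the step is hypergeometric
  with 1 as a fourth lower parameter. Read backwards it is again of this kind, with upper and lower
  parameters exchanged, so both halves of the sum satisfy \<open>balanced_rec\<close>.\<close>

lemma bilateral_term_step:
  "bilateral_term a b c d e f g (w + 1) * ((1 + w) * (e + w) * (f + w) * (g + w)) =
   bilateral_term a b c d e f g w * ((a + w) * (b + w) * (c + w) * (d + w))"
proof -
  have 1: "rGamma (1 - z - (w + 1)) = - (z + w) * rGamma (1 - z - w)" for z
    using rGamma_plus1[of "- (z + w)"] by (simp add: algebra_simps)
  have 2: "rGamma (z + w) = (z + w) * rGamma (z + (w + 1))" for z
    using rGamma_plus1[of "z + w"] by (simp add: add_ac)
  show ?thesis unfolding bilateral_term_def 1 2 by (simp only: mult_minus_left mult_minus_right minus_minus mult_ac)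
qed

lemma bilateral_term_rec_forward:
  assumes "e + f + g - a - b - c - d = 1"
  shows "balanced_rec [a + t, b + t, c + t, d + t] [1 + t, e + t, f + t, g + t] (\<lambda>n. bilateral_term a b c d e f g (t + of_nat n))"
  unfolding balanced_rec_def
proof (intro conjI allI)
  show "sum_list [1 + t, e + t, f + t, g + t] - sum_list [a + t, b + t, c + t, d + t] = 2"
    using assms by (simp add: algebra_simps)
  show "bilateral_term a b c d e f g (t + of_nat (Suc n)) * (\<Prod>y\<leftarrow>[1 + t, e + t, f + t, g + t]. y + of_nat n) =
    bilateral_term a b c d e f g (t + of_nat n) * (\<Prod>x\<leftarrow>[a + t, b + t, c + t, d + t]. x + of_nat n)" for n
    using bilateral_term_step[of a b c d e f g "t + of_nat n"] by (simp add: add_ac mult_ac)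
qed auto

lemma bilateral_term_rec_backward:
  assumes "e + f + g - a - b - c - d = 1"
  shows "balanced_rec [1 - t, 2 - e - t, 2 - f - t, 2 - g - t] [2 - a - t, 2 - b - t, 2 - c - t, 2 - d - t]
    (\<lambda>n. bilateral_term a b c d e f g (t - 1 - of_nat n))"
  unfolding balanced_rec_def
proof (intro conjI allI)
  show "sum_list [2 - a - t, 2 - b - t, 2 - c - t, 2 - d - t] - sum_list [1 - t, 2 - e - t, 2 - f - t, 2 - g - t] = 2"
    using assms by (simp add: algebra_simps)
  fix n
  define w where "w = t - 1 - of_nat (Suc n)"
  have eqs: "2 - z - t + of_nat n = - (z + w)" "1 - t + of_nat n = - (1 + w)" "t - 1 - of_nat n = w + 1" for z
    by (simp_all add: w_def algebra_simps)
  show "bilateral_term a b c d e f g (t - 1 - of_nat (Suc n)) * (\<Prod>y\<leftarrow>[2 - a - t, 2 - b - t, 2 - c - t, 2 - d - t]. y + of_nat n) =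
    bilateral_term a b c d e f g (t - 1 - of_nat n) * (\<Prod>x\<leftarrow>[1 - t, 2 - e - t, 2 - f - t, 2 - g - t]. x + of_nat n)"
    unfolding w_def[symmetric] list.map prod_list.Cons prod_list.Nil eqs
    using bilateral_term_step[of a b c d e f g w]
    by (simp only: mult_minus_left mult_minus_right minus_minus mult_1_right mult_ac)
qed auto

lemma bilateral_holomorphic:
  assumes "e + f + g - a - b - c - d = 1"
  shows "bilateral a b c d e f g holomorphic_on UNIV"
proof -
  have th: "(\<lambda>s. bilateral_term a b c d e f g (h s)) holomorphic_on UNIV" if "h holomorphic_on UNIV" for h
    unfolding bilateral_term_def by (intro holomorphic_intros that)
  have "(\<lambda>t. \<Sum>n. bilateral_term a b c d e f g (t + of_nat n)) holomorphic_on UNIV"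
    by (rule balanced_suminf_holomorphic[of "[\<lambda>t. a + t, \<lambda>t. b + t, \<lambda>t. c + t, \<lambda>t. d + t]"
        "[\<lambda>t. 1 + t, \<lambda>t. e + t, \<lambda>t. f + t, \<lambda>t. g + t]"])
       (use bilateral_term_rec_forward[OF assms] in \<open>auto intro!: holomorphic_intros th\<close>)
  moreover have "(\<lambda>t. \<Sum>n. bilateral_term a b c d e f g (t - 1 - of_nat n)) holomorphic_on UNIV"
    by (rule balanced_suminf_holomorphic[of "[\<lambda>t. 1 - t, \<lambda>t. 2 - e - t, \<lambda>t. 2 - f - t, \<lambda>t. 2 - g - t]"
        "[\<lambda>t. 2 - a - t, \<lambda>t. 2 - b - t, \<lambda>t. 2 - c - t, \<lambda>t. 2 - d - t]"])
       (use bilateral_term_rec_backward[OF assms] in \<open>auto intro!: holomorphic_intros th\<close>)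
  ultimately show ?thesis unfolding bilateral_def by (intro holomorphic_intros)
qed

lemma bilateral_periodic:
  assumes "e + f + g - a - b - c - d = 1"
  shows "bilateral a b c d e f g (t + 1) = bilateral a b c d e f g t"
proof -
  let ?th = "bilateral_term a b c d e f g"
  have s1: "summable (\<lambda>n. ?th (t + of_nat n))" for t
    by (rule summable_norm_cancel[OF balanced_summable[OF bilateral_term_rec_forward[OF assms]]])
  have s2: "summable (\<lambda>n. ?th (t - 1 - of_nat n))" for t
    by (rule summable_norm_cancel[OF balanced_summable[OF bilateral_term_rec_backward[OF assms]]])
  have "(\<Sum>n. ?th (t + 1 + of_nat n)) = (\<Sum>n. ?th (t + of_nat n)) - ?th t"
    using suminf_split_head[OF s1[of t]] by (simp add: add_ac)
  moreover have "(\<Sum>n. ?th (t - 1 - of_nat n)) = (\<Sum>n. ?th (t + 1 - 1 - of_nat n)) - ?th t"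
    using suminf_split_head[OF s2[of "t + 1"]] by (simp add: algebra_simps)
  ultimately show ?thesis unfolding bilateral_def by simp
qed

section \<open>Growth of the bilateral sum on strips and vertical lines\<close>

lemma rGamma_pair_eq:
  fixes a f :: real and w :: complex
  assumes "0 < Re w + a"
  shows "rGamma (1 - of_real a - w) * rGamma (of_real f + w) =
     sinpi (of_real a + w) / of_real pi * (Gamma (of_real a + w) * rGamma (of_real a + w + of_real (f - a)))"
proof -
  let ?u = "of_real a + w"
  have "?u \<notin> \<int>\<^sub>\<le>\<^sub>0"
  proof
    assume "?u \<in> \<int>\<^sub>\<le>\<^sub>0"
    then obtain k where "?u = - of_nat k" by (elim nonpos_Ints_cases')
    then have "Re ?u = Re (- of_nat k)" by (rule arg_cong)
    then show False using assms by simp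
  qed
  then have "Gamma ?u * rGamma ?u = 1" by (simp add: rGamma_inverse_Gamma Gamma_eq_zero_iff)
  then have "rGamma (1 - ?u) = Gamma ?u * (rGamma ?u * rGamma (1 - ?u))" by simp
  then have "rGamma (1 - ?u) = sinpi ?u / of_real pi * Gamma ?u"
    unfolding rGamma_reflection_complex by simp
  moreover have "1 - of_real a - w = 1 - ?u" "of_real f + w = ?u + of_real (f - a)" by simp_all
  ultimately show ?thesis by (simp only: mult.assoc)
qed

text \<open>Matching an upper with a lower parameter, reflection splits the product into a sine,
  which carries all growth in the imaginary direction, and a gamma quotient, to which the monotone
  estimate applies.\<close>

lemma norm_rGamma_pair_le:
  fixes a f x :: real and w :: complex
  assumes "0 < x" "x \<le> Re w + a" "a \<le> f"
  shows "norm (rGamma (1 - of_real a - w) * rGamma (of_real f + w)) \<le>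
     cosh (pi * Im w) * (Gamma x * rGamma (x + (f - a)))"
proof -
  let ?u = "of_real a + w"
  have "norm (sinpi ?u / of_real pi) \<le> cosh (pi * Im w) / 1"
    using norm_sin_le_cosh[of "of_real pi * ?u"] pi_gt3 unfolding norm_divide by (intro frac_le) auto
  moreover have "norm (Gamma ?u * rGamma (?u + of_real (f - a))) \<le> Gamma x * rGamma (x + (f - a))"
    using assms by (intro norm_Gamma_quotient_le) auto
  moreover have eq: "rGamma (1 - of_real a - w) * rGamma (of_real f + w) =
     sinpi ?u / of_real pi * (Gamma ?u * rGamma (?u + of_real (f - a)))"
    using assms by (intro rGamma_pair_eq) auto
  ultimately show ?thesis unfolding eq norm_mult[of "sinpi ?u / of_real pi"] by (intro mult_mono) auto
qed

lemma rGamma_pair_tendsto: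
  fixes a f r :: real
  assumes "0 < r + a" "a < f" and F: "filterlim (\<lambda>y. \<bar>h y\<bar>) at_top F"
  shows "((\<lambda>y. rGamma (1 - of_real a - Complex r (h y)) * rGamma (of_real f + Complex r (h y)) / of_real (cosh (pi * h y))) \<longlongrightarrow> 0) F"
proof (rule Lim_null_comparison)
  have "((\<lambda>y. Gamma (Complex (r + a) (h y)) * rGamma (Complex (r + a) (h y) + of_real (f - a))) \<longlongrightarrow> 0) F"
    using assms by (intro Gamma_quotient_tendsto_0_Im) auto
  then show "((\<lambda>y. norm (Gamma (Complex (r + a) (h y)) * rGamma (Complex (r + a) (h y) + of_real (f - a)))) \<longlongrightarrow> 0) F"
    by (rule tendsto_norm_zero)
  show "\<forall>\<^sub>F y in F. norm (rGamma (1 - of_real a - Complex r (h y)) * rGamma (of_real f + Complex r (h y)) / of_real (cosh (pi * h y)))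
      \<le> norm (Gamma (Complex (r + a) (h y)) * rGamma (Complex (r + a) (h y) + of_real (f - a)))"
  proof (rule always_eventually, rule allI)
    fix y
    define w where "w = Complex r (h y)"
    let ?u = "of_real a + w"
    have u: "?u = Complex (r + a) (h y)" by (simp add: w_def complex_eq_iff)
    have eq: "rGamma (1 - of_real a - w) * rGamma (of_real f + w) =
       sinpi ?u / of_real pi * (Gamma ?u * rGamma (?u + of_real (f - a)))"
      using assms by (intro rGamma_pair_eq) (auto simp: w_def)
    have "norm (sinpi ?u) \<le> cosh (pi * h y)"
      using norm_sin_le_cosh[of "of_real pi * ?u"] by (simp add: w_def)
    then have "norm (sinpi ?u) / pi \<le> cosh (pi * h y) / 1" using pi_gt3 by (intro frac_le) auto
    then have "norm (sinpi ?u) / pi / cosh (pi * h y) \<le> 1" by (simp add: divide_le_eq mult.commute)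
    then have "norm (sinpi ?u) / pi / cosh (pi * h y) * norm (Gamma ?u * rGamma (?u + of_real (f - a)))
      \<le> 1 * norm (Gamma ?u * rGamma (?u + of_real (f - a)))" by (intro mult_right_mono) auto
    then show "norm (rGamma (1 - of_real a - Complex r (h y)) * rGamma (of_real f + Complex r (h y)) / of_real (cosh (pi * h y)))
      \<le> norm (Gamma (Complex (r + a) (h y)) * rGamma (Complex (r + a) (h y) + of_real (f - a)))"
      unfolding w_def[symmetric] eq u[symmetric] by (simp add: norm_mult norm_divide mult_ac)
  qed
qed

lemma summable_Gamma_quotients:
  fixes x1 x2 x3 x4 y1 y2 y3 y4 :: real
  assumes "x1 > 0" "x2 > 0" "x3 > 0" "x4 > 0" and sum: "y1 + y2 + y3 + y4 - x1 - x2 - x3 - x4 = 2"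
  shows "summable (\<lambda>n. Gamma (x1 + real n) * rGamma (y1 + real n) * (Gamma (x2 + real n) * rGamma (y2 + real n)) *
     (Gamma (x3 + real n) * rGamma (y3 + real n)) * (Gamma (x4 + real n) * rGamma (y4 + real n)))"
    (is "summable ?u")
proof -
  have "balanced_rec [of_real x1, of_real x2, of_real x3, of_real x4] [of_real y1, of_real y2, of_real y3, of_real y4]
      (\<lambda>n. complex_of_real (?u n))"
    unfolding balanced_rec_def
  proof (intro conjI allI)
    have "sum_list [complex_of_real y1, of_real y2, of_real y3, of_real y4] - sum_list [of_real x1, of_real x2, of_real x3, of_real x4]
       = of_real (y1 + y2 + y3 + y4 - x1 - x2 - x3 - x4)" by simp
    then show "sum_list [complex_of_real y1, of_real y2, of_real y3, of_real y4] - sum_list [of_real x1, of_real x2, of_real x3, of_real x4] = 2"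
      unfolding sum by simp
    fix n
    have G: "Gamma (x + real (Suc n)) = (x + real n) * Gamma (x + real n)" if "x > 0" for x
    proof -
      have "x + real n \<notin> \<int>\<^sub>\<le>\<^sub>0" using that by (auto elim!: nonpos_Ints_cases)
      from Gamma_plus1[OF this] show ?thesis by (simp add: add_ac)
    qed
    have R: "rGamma (y + real n) = (y + real n) * rGamma (y + real (Suc n))" for y
      using rGamma_plus1[of "y + real n"] by (simp add: add_ac)
    have "?u (Suc n) * ((y1 + real n) * ((y2 + real n) * ((y3 + real n) * (y4 + real n)))) =
       ?u n * ((x1 + real n) * ((x2 + real n) * ((x3 + real n) * (x4 + real n))))"
      unfolding G[OF assms(1)] G[OF assms(2)] G[OF assms(3)] G[OF assms(4)] R by (simp only: mult_ac)
    then have "complex_of_real (?u (Suc n) * ((y1 + real n) * ((y2 + real n) * ((y3 + real n) * (y4 + real n))))) =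
       of_real (?u n * ((x1 + real n) * ((x2 + real n) * ((x3 + real n) * (x4 + real n)))))" by (rule arg_cong)
    then show "complex_of_real (?u (Suc n)) * (\<Prod>y\<leftarrow>[of_real y1, of_real y2, of_real y3, of_real y4]. y + of_nat n) =
       of_real (?u n) * (\<Prod>x\<leftarrow>[of_real x1, of_real x2, of_real x3, of_real x4]. x + of_nat n)"
      by (simp del: of_nat_Suc)
  qed auto
  from balanced_summable[OF this] show ?thesis
    unfolding norm_of_real by (rule summable_rabs_cancel)
qed

definition rGamma_pair :: "real \<Rightarrow> real \<Rightarrow> complex \<Rightarrow> complex" where
  "rGamma_pair a f w = rGamma (1 - of_real a - w) * rGamma (of_real f + w)"

text \<open>Allows the backward half of the sum to be treated as a forward half in the variable
  -w.\<close>

lemma rGamma_pair_reflect: "rGamma_pair a f w = rGamma_pair (1 - f) (1 - a) (- w)"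
  by (simp add: rGamma_pair_def mult.commute)

text \<open>The four sines give the fourth power of cosh, and the gamma quotients at real points
  form a summable majorant independent of t. On a vertical line each normalised pair tends to 0
  because the increments are strictly positive; Tannery's theorem carries this over to the
  sum.\<close>

lemma half_bilateral_bound:
  fixes a1 a2 a3 a4 f1 f2 f3 f4 r :: real
  assumes sum: "f1 + f2 + f3 + f4 - a1 - a2 - a3 - a4 = 2"
    and pos: "r + a1 > 0" "r + a2 > 0" "r + a3 > 0" "r + a4 > 0"
    and lt: "a1 < f1" "a2 < f2" "a3 < f3" "a4 < f4"
  defines "p \<equiv> \<lambda>w. rGamma_pair a1 f1 w * rGamma_pair a2 f2 w * rGamma_pair a3 f3 w * rGamma_pair a4 f4 w"
  shows "\<exists>C. \<forall>t. r \<le> Re t \<longrightarrow> norm (\<Sum>n. p (t + of_nat n)) \<le> C * cosh (pi * Im t) ^ 4"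
    and "filterlim (\<lambda>y. \<bar>h y\<bar>) at_top F \<Longrightarrow> F \<noteq> bot \<Longrightarrow>
      ((\<lambda>y. norm (\<Sum>n. p (Complex r (h y) + of_nat n)) / cosh (pi * h y) ^ 4) \<longlongrightarrow> 0) F"
proof -
  define q where "q n = Gamma (r + a1 + real n) * rGamma (r + f1 + real n) * (Gamma (r + a2 + real n) * rGamma (r + f2 + real n)) *
     (Gamma (r + a3 + real n) * rGamma (r + f3 + real n)) * (Gamma (r + a4 + real n) * rGamma (r + f4 + real n))" for n
  have q: "summable q" unfolding q_def using pos sum by (intro summable_Gamma_quotients) auto
  have pair: "norm (rGamma_pair a f (t + of_nat n)) \<le> cosh (pi * Im t) * (Gamma (r + a + real n) * rGamma (r + f + real n))"
    if "r + a > 0" "a < f" "r \<le> Re t" for a f t n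
    using norm_rGamma_pair_le[of "r + a + real n" "t + of_nat n" a f] that by (simp add: rGamma_pair_def algebra_simps)
  have le: "norm (p (t + of_nat n)) \<le> cosh (pi * Im t) ^ 4 * q n" if t: "r \<le> Re t" for t n
  proof -
    have "norm (p (t + of_nat n)) \<le>
      (cosh (pi * Im t) * (Gamma (r + a1 + real n) * rGamma (r + f1 + real n))) *
      (cosh (pi * Im t) * (Gamma (r + a2 + real n) * rGamma (r + f2 + real n))) *
      (cosh (pi * Im t) * (Gamma (r + a3 + real n) * rGamma (r + f3 + real n))) *
      (cosh (pi * Im t) * (Gamma (r + a4 + real n) * rGamma (r + f4 + real n)))"
      unfolding p_def norm_mult
      by (intro mult_mono pair pos lt t mult_nonneg_nonneg norm_ge_zero order.trans[OF norm_ge_zero pair[OF _ _ t]])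
    then show ?thesis by (simp add: q_def power4_eq_xxxx mult_ac)
  qed
  show "\<exists>C. \<forall>t. r \<le> Re t \<longrightarrow> norm (\<Sum>n. p (t + of_nat n)) \<le> C * cosh (pi * Im t) ^ 4"
  proof (intro exI allI impI)
    fix t assume t: "r \<le> Re t"
    have "norm (\<Sum>n. p (t + of_nat n)) \<le> (\<Sum>n. cosh (pi * Im t) ^ 4 * q n)"
      by (intro norm_suminf_le le t summable_mult q)
    then show "norm (\<Sum>n. p (t + of_nat n)) \<le> suminf q * cosh (pi * Im t) ^ 4"
      unfolding suminf_mult[OF q] by (simp only: mult.commute)
  qed
  assume F: "filterlim (\<lambda>y. \<bar>h y\<bar>) at_top F" "F \<noteq> bot"
  let ?a = "\<lambda>n y. p (Complex r (h y) + of_nat n) / of_real (cosh (pi * h y) ^ 4)"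
  have "(\<forall>\<^sub>F y in F. summable (\<lambda>n. norm (?a n y))) \<and> summable (\<lambda>n::nat. norm (0 :: complex)) \<and>
      ((\<lambda>y. \<Sum>n. ?a n y) \<longlongrightarrow> (\<Sum>n. 0)) F"
  proof (rule tannerys_theorem[where M = q])
    show "((\<lambda>y. ?a n y) \<longlongrightarrow> 0) F" for n
    proof -
      have tend: "((\<lambda>y. rGamma_pair a f (Complex (r + real n) (h y)) / of_real (cosh (pi * h y))) \<longlongrightarrow> 0) F"
        if "r + a > 0" "a < f" for a f
        unfolding rGamma_pair_def using that F(1) by (intro rGamma_pair_tendsto) auto
      have "((\<lambda>y. (rGamma_pair a1 f1 (Complex (r + real n) (h y)) / of_real (cosh (pi * h y))) *
          (rGamma_pair a2 f2 (Complex (r + real n) (h y)) / of_real (cosh (pi * h y))) *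
          (rGamma_pair a3 f3 (Complex (r + real n) (h y)) / of_real (cosh (pi * h y))) *
          (rGamma_pair a4 f4 (Complex (r + real n) (h y)) / of_real (cosh (pi * h y)))) \<longlongrightarrow> 0 * 0 * 0 * 0) F"
        by (intro tendsto_mult tend pos lt)
      moreover have "Complex r (h y) + of_nat n = Complex (r + real n) (h y)" for y by (simp add: complex_eq_iff)
      ultimately show ?thesis by (simp add: p_def power4_eq_xxxx)
    qed
    have "norm (?a n y) \<le> q n" for n y
      using le[of "Complex r (h y)" n] by (simp add: norm_divide norm_power divide_le_eq mult.commute)
    then show "\<forall>\<^sub>F (n, y) in at_top \<times>\<^sub>F F. norm (?a n y) \<le> q n"
      by (intro always_eventually) auto
  qed (use q F in auto)
  then have "((\<lambda>y. norm (\<Sum>n. ?a n y)) \<longlongrightarrow> norm (0 :: complex)) F" by (intro tendsto_norm) simp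
  moreover have "norm (\<Sum>n. ?a n y) = norm (\<Sum>n. p (Complex r (h y) + of_nat n)) / cosh (pi * h y) ^ 4" for y
  proof -
    have sm: "summable (\<lambda>n. norm (p (Complex r (h y) + of_nat n)))"
      using le[of "Complex r (h y)"] by (intro summable_comparison_test'[OF summable_mult[OF q]]) auto
    have eq: "(\<Sum>n. ?a n y) = (\<Sum>n. p (Complex r (h y) + of_nat n)) / of_real (cosh (pi * h y) ^ 4)"
      by (rule suminf_divide[OF summable_norm_cancel[OF sm]])
    show ?thesis unfolding eq unfolding norm_divide norm_of_real by simp
  qed
  ultimately show "((\<lambda>y. norm (\<Sum>n. p (Complex r (h y) + of_nat n)) / cosh (pi * h y) ^ 4) \<longlongrightarrow> 0) F"
    by simp
qed

text \<open>By periodicity it suffices to bound the sum for |Re t| \<le> 1/2. The conditions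
  \<open>half\<close> keep the gamma arguments positive there: for the forward half from Re t = -1/2
  on, for the reflected half in 1 - t from 1/2 on. The conditions \<open>pair\<close> match upper
  with lower parameters, 1 being the fourth lower one.\<close>

lemma bilateral_trig:
  fixes a b c d e f g :: real
  assumes bal: "e + f + g - a - b - c - d = 1"
    and half: "1/2 < a" "1/2 < b" "1/2 < c" "1/2 < d" "e < 3/2" "f < 3/2" "g < 3/2"
    and pair: "a < f" "b < g" "c < 1" "d < e"
  obtains p q r where "\<And>t. bilateral (of_real a) (of_real b) (of_real c) (of_real d) (of_real e) (of_real f) (of_real g) t
     = p * exp (2 * pi * \<i> * t) + q + r * exp (- (2 * pi * \<i> * t))"
proof -
  let ?G = "bilateral (of_real a) (of_real b) (of_real c) (of_real d) (of_real e) (of_real f) (of_real g)"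
  let ?th = "bilateral_term (of_real a) (of_real b) (of_real c) (of_real d) (of_real e) (of_real f) (of_real g)"
  define p where "p w = rGamma_pair a f w * rGamma_pair b g w * rGamma_pair c 1 w * rGamma_pair d e w" for w
  define p' where "p' w = rGamma_pair (1 - f) (1 - a) w * rGamma_pair (1 - g) (1 - b) w * rGamma_pair (1 - 1) (1 - c) w * rGamma_pair (1 - e) (1 - d) w" for w
  have th: "?th w = p w" for w by (simp add: bilateral_term_def p_def rGamma_pair_def mult_ac)
  have th': "?th w = p' (- w)" for w
    unfolding th p_def p'_def by (simp only: rGamma_pair_reflect[of a f w] rGamma_pair_reflect[of b g w] rGamma_pair_reflect[of c 1 w] rGamma_pair_reflect[of d e w])
  have G: "?G t = (\<Sum>n. p (t + of_nat n)) + (\<Sum>n. p' (1 - t + of_nat n))" for t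
  proof -
    have "- (t - 1 - of_nat n) = 1 - t + of_nat n" for n by simp
    then have "?th (t - 1 - of_nat n) = p' (1 - t + of_nat n)" for n
      using th'[of "t - 1 - of_nat n"] by (simp only:)
    then show ?thesis unfolding bilateral_def by (simp only: th)
  qed
  have bal': "complex_of_real e + of_real f + of_real g - of_real a - of_real b - of_real c - of_real d = 1"
    using arg_cong[OF bal, of complex_of_real] by simp
  obtain C where C: "\<And>t. - 1/2 \<le> Re t \<Longrightarrow> norm (\<Sum>n. p (t + of_nat n)) \<le> C * cosh (pi * Im t) ^ 4"
    using half_bilateral_bound(1)[of f g 1 e a b c d "-1/2"] assms unfolding p_def by auto
  obtain C' where C': "\<And>t. 1/2 \<le> Re t \<Longrightarrow> norm (\<Sum>n. p' (t + of_nat n)) \<le> C' * cosh (pi * Im t) ^ 4"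
    using half_bilateral_bound(1)[of "1 - a" "1 - b" "1 - c" "1 - d" "1 - f" "1 - g" "1 - 1" "1 - e" "1/2"] assms unfolding p'_def by auto
  note per = bilateral_periodic[OF bal']
  have bnd: "norm (?G t) \<le> (C + C') * cosh (pi * Im t) ^ 4" for t
  proof -
    define s where "s = t - of_int (round (Re t))"
    have s: "\<bar>Re s\<bar> \<le> 1/2" "Im s = Im t" using of_int_round_abs_le[of "Re t"] unfolding s_def by (simp_all add: abs_minus_commute)
    have "?G t = ?G (s + of_int (round (Re t)))" by (simp add: s_def)
    also have "\<dots> = ?G s" by (rule periodic_of_int[of ?G, OF per])
    finally have "norm (?G t) = norm (?G s)" by simp
    also have "\<dots> \<le> C * cosh (pi * Im s) ^ 4 + C' * cosh (pi * Im (1 - s)) ^ 4"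
      unfolding G using s by (intro order.trans[OF norm_triangle_ineq] add_mono C C') auto
    finally show ?thesis by (simp add: s distrib_right)
  qed
  have lim: "((\<lambda>y. norm (?G (Complex 0 y)) / cosh (pi * y) ^ 4) \<longlongrightarrow> 0) F"
    if F: "filterlim (\<lambda>y::real. \<bar>y\<bar>) at_top F" "F \<noteq> bot" for F
  proof (rule Lim_null_comparison)
    have 1: "((\<lambda>y. norm (\<Sum>n. p (Complex 0 y + of_nat n)) / cosh (pi * y) ^ 4) \<longlongrightarrow> 0) F"
      using half_bilateral_bound(2)[of f g 1 e a b c d 0 "\<lambda>y. y" F] assms F unfolding p_def by simp
    have 2: "((\<lambda>y. norm (\<Sum>n. p' (Complex 1 (- y) + of_nat n)) / cosh (pi * (- y)) ^ 4) \<longlongrightarrow> 0) F"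
      using half_bilateral_bound(2)[of "1 - a" "1 - b" "1 - c" "1 - d" "1 - f" "1 - g" "1 - 1" "1 - e" 1 "\<lambda>y. - y" F] assms F
      unfolding p'_def by simp
    show "((\<lambda>y. norm (\<Sum>n. p (Complex 0 y + of_nat n)) / cosh (pi * y) ^ 4 +
       norm (\<Sum>n. p' (Complex 1 (- y) + of_nat n)) / cosh (pi * (- y)) ^ 4) \<longlongrightarrow> 0) F"
      using tendsto_add[OF 1 2] by simp
    show "\<forall>\<^sub>F y in F. norm (norm (?G (Complex 0 y)) / cosh (pi * y) ^ 4) \<le>
       norm (\<Sum>n. p (Complex 0 y + of_nat n)) / cosh (pi * y) ^ 4 +
       norm (\<Sum>n. p' (Complex 1 (- y) + of_nat n)) / cosh (pi * (- y)) ^ 4"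
    proof (rule always_eventually, rule allI)
      fix y
      have "1 - Complex 0 y = Complex 1 (- y)" by (simp add: complex_eq_iff)
      then have "norm (?G (Complex 0 y)) \<le> norm (\<Sum>n. p (Complex 0 y + of_nat n)) + norm (\<Sum>n. p' (Complex 1 (- y) + of_nat n))"
        unfolding G by (simp add: norm_triangle_ineq)
      then show "norm (norm (?G (Complex 0 y)) / cosh (pi * y) ^ 4) \<le>
       norm (\<Sum>n. p (Complex 0 y + of_nat n)) / cosh (pi * y) ^ 4 +
       norm (\<Sum>n. p' (Complex 1 (- y) + of_nat n)) / cosh (pi * (- y)) ^ 4"
        by (simp add: divide_right_mono flip: add_divide_distrib)
    qed
  qed
  have "filterlim (\<lambda>y::real. \<bar>y\<bar>) at_top at_top" "filterlim (\<lambda>y::real. \<bar>y\<bar>) at_top at_bot"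
    by real_asymp+
  then show ?thesis
    using periodic_trig_polynomial[OF bilateral_holomorphic[OF bal'] per bnd lim lim] that by (metis trivial_limit_at_top_linorder trivial_limit_at_bot_linorder)
qed

section \<open>Special values of the bilateral sum\<close>

lemma bilateral_0:
  "bilateral a b c d e f g 0 = rGamma (1 - a) * rGamma (1 - b) * rGamma (1 - c) * rGamma (1 - d) * F43_reg a b c d e f g"
  if bal: "e + f + g - a - b - c - d = 1"
proof -
  \<comment> \<open>Here 1 + w = -n, so the factor \<open>rGamma (1 + w)\<close> removes the whole
    backward half.\<close>
  have "bilateral_term a b c d e f g (0 - 1 - of_nat n) = 0" for n
    by (simp add: bilateral_term_def rGamma_eq_zero_iff)
  moreover have "bilateral_term a b c d e f g (0 + of_nat n) =
    rGamma (1 - a) * rGamma (1 - b) * rGamma (1 - c) * rGamma (1 - d) * F43_reg_term a b c d e f g n" for n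
  proof -
    have 1: "rGamma (1 - z - of_nat n) = (-1) ^ n * pochhammer z n * rGamma (1 - z)" for z :: complex
      using pochhammer_rGamma[of "1 - z - of_nat n" n] pochhammer_minus[of "z + of_nat n - 1" n] by (simp add: algebra_simps)
    have 2: "rGamma (1 + of_nat n) = inverse (fact n :: complex)"
      using Gamma_fact[of n, where 'a = complex] by (simp add: rGamma_inverse_Gamma)
    have sq: "(-1 :: complex) ^ n * (-1) ^ n = 1" by (simp flip: power_mult_distrib)
    have "bilateral_term a b c d e f g (0 + of_nat n) = ((-1) ^ n * (-1) ^ n) * ((-1) ^ n * (-1) ^ n) *
       (rGamma (1 - a) * rGamma (1 - b) * rGamma (1 - c) * rGamma (1 - d) * F43_reg_term a b c d e f g n)"
      unfolding bilateral_term_def add_0_left 1 2 F43_reg_term_def by (simp only: divide_inverse mult_ac)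
    then show ?thesis by (simp only: sq mult_1)
  qed
  ultimately show ?thesis
    unfolding bilateral_def F43_reg_def
    by (simp only: suminf_zero add_0_right suminf_mult[OF summable_norm_cancel[OF F43_reg_summable[OF bal]]])
qed

text \<open>The translation lets e take over the role of the fourth lower parameter 1. Values at 1 -
  e, and by permutation at 1 - f and 1 - g, thus reduce to values at 0.\<close>

lemma bilateral_shift_e:
  "bilateral a b c d e f g (1 - e + t) =
   bilateral (1 + a - e) (1 + b - e) (1 + c - e) (1 + d - e) (2 - e) (1 + f - e) (1 + g - e) t"
proof -
  have "bilateral_term a b c d e f g (1 - e + t) =
     bilateral_term (1 + a - e) (1 + b - e) (1 + c - e) (1 + d - e) (2 - e) (1 + f - e) (1 + g - e) t" for t
    by (simp add: bilateral_term_def algebra_simps)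
  from this[of "t + of_nat _"] this[of "t - 1 - of_nat _"] show ?thesis
    unfolding bilateral_def by (simp add: algebra_simps)
qed

lemma bilateral_perm:
  "bilateral a b c d f e g t = bilateral a b c d e f g t" "bilateral a b c d g f e t = bilateral a b c d e f g t"
  by (simp_all add: bilateral_def bilateral_term_def mult_ac)

text \<open>Replacing w by -a - w interchanges the factors with decreasing and with increasing
  arguments. It also reverses the summation, so the cut between the halves lands one place off;
  periodicity repairs this.\<close>

lemma bilateral_reflect:
  assumes "e + f + g - a - b - c - d = 1"
  shows "bilateral a b c d e f g (- a) =
     bilateral a (1 + a - e) (1 + a - f) (1 + a - g) (1 + a - b) (1 + a - c) (1 + a - d) 0"
proof -
  let ?B = "bilateral a (1 + a - e) (1 + a - f) (1 + a - g) (1 + a - b) (1 + a - c) (1 + a - d)"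
  let ?th = "bilateral_term a (1 + a - e) (1 + a - f) (1 + a - g) (1 + a - b) (1 + a - c) (1 + a - d)"
  have th: "bilateral_term a b c d e f g w = ?th (- a - w)" for w
    by (simp add: bilateral_term_def algebra_simps)
  have "- a - (- a + of_nat n) = 0 + 1 - 1 - of_nat n" "- a - (- a - 1 - of_nat n) = 0 + 1 + of_nat n" for n
    by simp_all
  then have "bilateral a b c d e f g (- a) = ?B (0 + 1)"
    unfolding bilateral_def th by (simp only: add.commute)
  also have "\<dots> = ?B 0"
    using assms by (intro bilateral_periodic) (simp add: algebra_simps)
  finally show ?thesis .
qed

section \<open>Trigonometric identities\<close>

text \<open>Four values in a three-dimensional space of functions are dependent. The coefficients
  are Vandermonde determinants of the other three points, which in the variables exp(2 pi i t)
  factor into sines of differences.\<close>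

lemma four_point_relation:
  fixes p q r :: complex
  defines "G \<equiv> \<lambda>t. p * exp (2 * pi * \<i> * t) + q + r * exp (- (2 * pi * \<i> * t))"
  shows "G t1 * (sinpi (t2 - t3) * sinpi (t2 - t4) * sinpi (t3 - t4)) - G t2 * (sinpi (t1 - t3) * sinpi (t1 - t4) * sinpi (t3 - t4))
       + G t3 * (sinpi (t1 - t2) * sinpi (t1 - t4) * sinpi (t2 - t4)) - G t4 * (sinpi (t1 - t2) * sinpi (t1 - t3) * sinpi (t2 - t3)) = 0"
proof -
  define u where "u t = exp (\<i> * (of_real pi * t))" for t :: complex
  define v where "v t = exp (- (\<i> * (of_real pi * t)))" for t :: complex
  have uv: "u t * v t = 1" for t by (simp add: u_def v_def flip: exp_add)
  have s: "sinpi (x - y) = (u x * v y - u y * v x) / (2 * \<i>)" for x y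
    unfolding sin_exp_eq u_def v_def by (simp add: algebra_simps flip: exp_add)
  have G: "G t = p * (u t)\<^sup>2 + q + r * (v t)\<^sup>2" for t
    unfolding G_def u_def v_def by (simp add: power2_eq_square mult_ac flip: exp_add)
  define d where "d x y = u x * v y - u y * v x" for x y
  have key: "(G t1 * (d t2 t3 * d t2 t4 * d t3 t4) - G t2 * (d t1 t3 * d t1 t4 * d t3 t4)
       + G t3 * (d t1 t2 * d t1 t4 * d t2 t4) - G t4 * (d t1 t2 * d t1 t3 * d t2 t3)) = 0"
    unfolding d_def G using uv[of t1] uv[of t2] uv[of t3] uv[of t4] by algebra
  have sd: "sinpi (x - y) = d x y * (1 / (2 * \<i>))" for x y unfolding s d_def by simp
  have "(G t1 * (d t2 t3 * d t2 t4 * d t3 t4) - G t2 * (d t1 t3 * d t1 t4 * d t3 t4)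
       + G t3 * (d t1 t2 * d t1 t4 * d t2 t4) - G t4 * (d t1 t2 * d t1 t3 * d t2 t3)) * (1 / (2 * \<i>)) ^ 3 = 0"
    unfolding key by simp
  then show ?thesis unfolding sd by (simp add: algebra_simps power3_eq_cube)
qed

lemma sin_three_term:
  fixes x y z w :: complex
  shows "sin (x - y) * sin (z - w) - sin (x - z) * sin (y - w) + sin (x - w) * sin (y - z) = 0"
  unfolding sin_diff by (simp add: algebra_simps)

text \<open>The left-hand side is linear in the symmetric combinations \<open>c1\<close>,
  \<open>c2\<close>, \<open>c3\<close>, \<open>c4\<close> of the sines and cosines of b, c, d. Each
  coefficient is an expression in f and g alone and vanishes separately.\<close>

lemma sin_four_product:
  fixes b c d f g :: complex
  shows "sin f * sin (g - b) * sin (g - c) * sin (g - d) - sin g * sin (f - b) * sin (f - c) * sin (f - d)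
     + sin (f - g) * (sin b * sin c * sin d + sin (f + g - b - c - d) * sin f * sin g) = 0"
proof -
  define F F' G G' where t: "F = sin f" "F' = cos f" "G = sin g" "G' = cos g"
  have h: "F\<^sup>2 + F'\<^sup>2 = 1" "G\<^sup>2 + G'\<^sup>2 = 1" by (simp_all add: t)
  define c1 c2 c3 c4 where c: "c1 = cos b * cos c * cos d"
    "c2 = sin b * cos c * cos d + cos b * sin c * cos d + cos b * cos c * sin d"
    "c3 = sin b * sin c * cos d + sin b * cos c * sin d + cos b * sin c * sin d" "c4 = sin b * sin c * sin d"
  have prod: "sin (x - b) * sin (x - c) * sin (x - d) =
     sin x ^ 3 * c1 - sin x ^ 2 * cos x * c2 + sin x * cos x ^ 2 * c3 - cos x ^ 3 * c4" for x
    unfolding c sin_diff by (simp add: algebra_simps power2_eq_square power3_eq_cube)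
  have "sin (f + g - b - c - d) = sin (f + g) * cos (b + c + d) - cos (f + g) * sin (b + c + d)"
    by (simp add: sin_diff[symmetric] algebra_simps)
  also have "cos (b + c + d) = c1 - c3" unfolding c by (simp add: cos_add sin_add algebra_simps)
  also have "sin (b + c + d) = c2 - c4" unfolding c by (simp add: cos_add sin_add algebra_simps)
  finally have last: "sin (f + g - b - c - d) = (F * G' + F' * G) * (c1 - c3) - (F' * G' - F * G) * (c2 - c4)"
    by (simp add: sin_add cos_add t)
  have e1: "F * G ^ 3 - G * F ^ 3 + (F * G' - F' * G) * (F * G' + F' * G) * F * G = 0" using h by algebra
  have e2: "- (F * G\<^sup>2 * G') + G * F\<^sup>2 * F' - (F * G' - F' * G) * (F' * G' - F * G) * F * G = 0" using h by algebra
  have e3: "F * G * G'\<^sup>2 - G * F * F'\<^sup>2 - (F * G' - F' * G) * (F * G' + F' * G) * F * G = 0" using h by algebra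
  have e4: "- (F * G' ^ 3) + G * F' ^ 3 + (F * G' - F' * G) * (1 + (F' * G' - F * G) * F * G) = 0" using h by algebra
  have "F * (sin (g - b) * sin (g - c) * sin (g - d)) - G * (sin (f - b) * sin (f - c) * sin (f - d))
     + (F * G' - F' * G) * (c4 + sin (f + g - b - c - d) * F * G) =
    (F * G ^ 3 - G * F ^ 3 + (F * G' - F' * G) * (F * G' + F' * G) * F * G) * c1 +
    (- (F * G\<^sup>2 * G') + G * F\<^sup>2 * F' - (F * G' - F' * G) * (F' * G' - F * G) * F * G) * c2 +
    (F * G * G'\<^sup>2 - G * F * F'\<^sup>2 - (F * G' - F' * G) * (F * G' + F' * G) * F * G) * c3 +
    (- (F * G' ^ 3) + G * F' ^ 3 + (F * G' - F' * G) * (1 + (F' * G' - F * G) * F * G)) * c4"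
    unfolding prod last t[symmetric] by (simp add: algebra_simps)
  also have "\<dots> = 0" unfolding e1 e2 e3 e4 by simp
  finally show ?thesis by (simp add: t c sin_diff mult.assoc)
qed

text \<open>The relation combines two four-point relations, \<open>RE\<close> at 0, -a, 1 - f, 1 - g
  and \<open>RA\<close> at 0, 1 - e, 1 - f, 1 - g. As -a occurs only in the first and 1 - e only in
  the second, the multipliers are forced. Comparing coefficients at 1 - f, 1 - g and 0 leaves
  \<open>I1\<close>, \<open>I1'\<close> and \<open>I3\<close>.\<close>

lemma trig_identity:
  fixes a b c d e f g p q r :: complex
  assumes bal: "e + f + g - a - b - c - d = 1"
    and nz: "sinpi f \<noteq> 0" "sinpi g \<noteq> 0" "sinpi (f - g) \<noteq> 0"
  defines "G \<equiv> \<lambda>t. p * exp (2 * pi * \<i> * t) + q + r * exp (- (2 * pi * \<i> * t))"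
  defines "B3 \<equiv> S [f, f - e, g - a, g - b, g - c, g - d] - S [g, g - e, f - a, f - b, f - c, f - d]"
    and "B4 \<equiv> S [f - a, g - a] * (S [b, c, d] + S [e - a, f, g])"
  shows "B3 * sinpi e * (S [e - a, f - a, g - a] * G 0 + S [b, c, d] * G (- a))
     + S [e - a, e, a, b, c, d] * (S [g - a, g - b, g - c, g - d] * G (1 - f) - S [f - a, f - b, f - c, f - d] * G (1 - g))
     - B4 * sinpi (f - g) * (S [e - a, e - b, e - c, e - d] * G 0 - S [a, b, c, d] * G (1 - e)) = 0"
proof -
  have one: "sinpi (1 - z) = sinpi z" for z
    using sinpi_add_1[of "- z"] by (simp add: add.commute)
  have neg1: "sinpi (z - 1) = - sinpi z" for z
    using one[of z] by (metis minus_diff_eq mult_minus_right sin_minus)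
  have sub: "sinpi (x - y) = sin (of_real pi * x - of_real pi * y)" for x y
    by (simp add: right_diff_distrib)
  have three: "sinpi (x - y) * sinpi (z - w) - sinpi (x - z) * sinpi (y - w) + sinpi (x - w) * sinpi (y - z) = 0" for x y z w
    unfolding sub by (rule sin_three_term)
  have four: "sinpi u * sinpi (v - b) * sinpi (v - c) * sinpi (v - d) - sinpi v * sinpi (u - b) * sinpi (u - c) * sinpi (u - d)
     + sinpi (u - v) * (sinpi b * sinpi c * sinpi d + sinpi (1 + b + c + d - u - v) * sinpi u * sinpi v) = 0" for u v
  proof -
    have "sinpi (1 + b + c + d - u - v) = sinpi (u + v - b - c - d)"
      using one[of "u + v - b - c - d"] by (simp add: algebra_simps)
    also have "\<dots> = sin (of_real pi * u + of_real pi * v - of_real pi * b - of_real pi * c - of_real pi * d)"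
      by (simp add: algebra_simps)
    finally show ?thesis unfolding sub by (simp only: sin_four_product)
  qed
  \<comment> \<open>In this form the balancing condition turns the composite angle of
    \<open>four\<close> into e - a or f - a.\<close>
  have ea: "1 + b + c + d - f - g = e - a" "1 + b + c + d - e - g = f - a"
    using bal by (simp_all add: algebra_simps)
  define sa sb sc sd se sf sg where s1: "sa = sinpi a" "sb = sinpi b" "sc = sinpi c" "sd = sinpi d" "se = sinpi e" "sf = sinpi f" "sg = sinpi g"
  define ea eb ec ed where s2: "ea = sinpi (e - a)" "eb = sinpi (e - b)" "ec = sinpi (e - c)" "ed = sinpi (e - d)"
  define fa fb fc fd where s3: "fa = sinpi (f - a)" "fb = sinpi (f - b)" "fc = sinpi (f - c)" "fd = sinpi (f - d)"
  define ga gb gc gd where s4: "ga = sinpi (g - a)" "gb = sinpi (g - b)" "gc = sinpi (g - c)" "gd = sinpi (g - d)"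
  define fe ge fg where s5: "fe = sinpi (f - e)" "ge = sinpi (g - e)" "fg = sinpi (f - g)"
  have neg: "sinpi (y - x) = - sinpi (x - y)" for x y
    using sinpi_minus[of "x - y"] by simp
  have B3: "B3 = sf * fe * ga * gb * gc * gd - sg * ge * fa * fb * fc * fd"
    by (simp add: B3_def S_def s1 s2 s3 s4 s5)
  define Q where "Q = sb * sc * sd + ea * sf * sg"
  have B4: "B4 = fa * ga * Q"
    by (simp add: B4_def S_def Q_def s1 s2 s3 s4)
  have I2: "sf * gb * gc * gd - sg * fb * fc * fd + fg * Q = 0"
    using four[of f g] unfolding \<open>1 + b + c + d - f - g = e - a\<close> by (simp only: s1 s2 s3 s4 s5 Q_def)
  have I2': "se * gb * gc * gd - sg * eb * ec * ed - ge * (sb * sc * sd + fa * se * sg) = 0"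
    using four[of e g] unfolding \<open>1 + b + c + d - e - g = f - a\<close> neg[of e g] by (simp add: s1 s2 s3 s4 s5)
  have T1: "fe * ga - ea * fg - fa * ge = 0"
    using three[of f e g a] neg[of e g] by (simp add: s1 s2 s3 s4 s5 mult_ac)
  have T1': "ge * fa + ea * fg - ga * fe = 0" using T1 by (simp add: algebra_simps)
  have T2: "ea * sf - se * fa + sa * fe = 0"
    using three[of e a f 0]
    unfolding neg[of e f] neg[of a f] diff_zero s1[symmetric] s2[symmetric] s3[symmetric] s5[symmetric] by algebra
  have I1: "B3 * ga + B4 * fg * ge = ea * sf * fg * (ga * gb * gc * gd)"
    using I2 T1 unfolding B3 B4 by algebra
  have I1': "B3 * fa + B4 * fg * fe = ea * sg * fg * (fa * fb * fc * fd)"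
    using I2 T1 unfolding B3 B4 by algebra
  have I1'': "B3 = ea * sf * fg * (gb * gc * gd) - fa * fg * ge * Q"
    using I2 T1 unfolding B3 by algebra
  have I3': "se * B3 = fg * (sf * sg * (ea * eb * ec * ed) - sa * sb * sc * sd * fe * ge)"
    using I2' T2 unfolding I1'' Q_def by algebra
  have I3: "(B3 * se * (ea * fa * ga) - B4 * fg * (ea * eb * ec * ed)) * (sf * sg)
     = - (B3 * se * (sb * sc * sd)) * (fa * ga) - B4 * fg * (sa * sb * sc * sd) * (fe * ge)"
    using I3' unfolding B4 Q_def by algebra
  have RE: "- (fg * fa * ga) * G 0 + sf * sg * fg * G (- a) + sa * sg * ga * G (1 - f) - sa * sf * fa * G (1 - g) = 0"
  proof -
    have *: "sinpi (0 - - a) = sa" "sinpi (0 - (1 - f)) = - sf" "sinpi (0 - (1 - g)) = - sg"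
      "sinpi (- a - (1 - f)) = - fa" "sinpi (- a - (1 - g)) = - ga" "sinpi (1 - f - (1 - g)) = - fg"
      using neg1[of f] neg1[of g] neg1[of "f - a"] neg1[of "g - a"] neg[of g f]
      by (simp_all add: s1 s3 s4 s5 algebra_simps)
    show ?thesis using four_point_relation[of p 0 q r "- a" "1 - f" "1 - g"]
      unfolding * G_def by (simp only: mult_minus_left mult_minus_right minus_minus) (simp add: algebra_simps)
  qed
  have RA: "- (fe * ge * fg) * G 0 + sf * sg * fg * G (1 - e) + se * sg * ge * G (1 - f) - se * sf * fe * G (1 - g) = 0"
  proof -
    have *: "sinpi (0 - (1 - e)) = - se" "sinpi (0 - (1 - f)) = - sf" "sinpi (0 - (1 - g)) = - sg"
      "sinpi (1 - e - (1 - f)) = fe" "sinpi (1 - e - (1 - g)) = ge" "sinpi (1 - f - (1 - g)) = - fg"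
      using neg1[of e] neg1[of f] neg1[of g] neg[of g f]
      by (simp_all add: s1 s5 algebra_simps)
    show ?thesis using four_point_relation[of p 0 q r "1 - e" "1 - f" "1 - g"]
      unfolding * G_def by (simp only: mult_minus_left mult_minus_right minus_minus) (simp add: algebra_simps)
  qed
  define D where "D = B3 * se * (ea * fa * ga * G 0 + sb * sc * sd * G (- a))
     + ea * se * sa * sb * sc * sd * (ga * gb * gc * gd * G (1 - f) - fa * fb * fc * fd * G (1 - g))
     - B4 * fg * (ea * eb * ec * ed * G 0 - sa * sb * sc * sd * G (1 - e))"
  \<comment> \<open>The factor is the coefficient of G(-a) in \<open>RE\<close> and of G(1 - e) in
    \<open>RA\<close>, so multiplying by it avoids division.\<close>
  have "D * (sf * sg * fg) = 0"
  proof -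
    have "D * (sf * sg * fg) =
        (B3 * se * (ea * fa * ga) - B4 * fg * (ea * eb * ec * ed)) * (sf * sg) * fg * G 0
      + B3 * se * (sb * sc * sd) * (sf * sg * fg) * G (- a)
      + B4 * fg * (sa * sb * sc * sd) * (sf * sg * fg) * G (1 - e)
      + se * sa * sb * sc * sd * sg * (ea * sf * fg * (ga * gb * gc * gd)) * G (1 - f)
      - se * sa * sb * sc * sd * sf * (ea * sg * fg * (fa * fb * fc * fd)) * G (1 - g)"
      by (simp add: D_def algebra_simps)
    also have "\<dots> = B3 * se * (sb * sc * sd) *
        (- (fg * fa * ga) * G 0 + sf * sg * fg * G (- a) + sa * sg * ga * G (1 - f) - sa * sf * fa * G (1 - g))
      + B4 * fg * (sa * sb * sc * sd) *
        (- (fe * ge * fg) * G 0 + sf * sg * fg * G (1 - e) + se * sg * ge * G (1 - f) - se * sf * fe * G (1 - g))"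
      unfolding I3 I1[symmetric] I1'[symmetric] by (simp add: algebra_simps)
    also have "\<dots> = 0" unfolding RE RA by simp
    finally show ?thesis .
  qed
  then have "D = 0" using nz by (simp add: s1 s5)
  then show ?thesis
    by (simp add: D_def S_def s1 s2 s3 s4 s5 mult.assoc)
qed

section \<open>The relation with denominators cleared\<close>

definition K_reg ::
  "complex \<Rightarrow> complex \<Rightarrow> complex \<Rightarrow> complex \<Rightarrow> complex \<Rightarrow> complex \<Rightarrow> complex \<Rightarrow> complex" where
  "K_reg a b c d e f g =
     F43_reg a b c d e f g * (rGamma a * rGamma (1 + a - e) * rGamma (1 + a - f) * rGamma (1 + a - g)) +
     F43_reg a (1 + a - e) (1 + a - f) (1 + a - g) (1 + a - b) (1 + a - c) (1 + a - d) *
       (rGamma a * rGamma b * rGamma c * rGamma d)"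

text \<open>The left-hand side of the theorem multiplied by \<open>\<pi>\<^sup>4 sin(\<pi>(f - g)) sin(\<pi>a) sin(\<pi>e)\<close>; the sign of the second
  summand comes from \<open>sin(\<pi>(2 - e)) = - sin(\<pi>e)\<close>.\<close>

definition cleared_relation ::
  "complex \<Rightarrow> complex \<Rightarrow> complex \<Rightarrow> complex \<Rightarrow> complex \<Rightarrow> complex \<Rightarrow> complex \<Rightarrow> complex" where
  "cleared_relation a b c d e f g =
     A (1 - a) (e - a) (f - a) (g - a) *
       (S [f, f - e, g - a, g - b, g - c, g - d] - S [g, g - e, f - a, f - b, f - c, f - d]) *
       sinpi e * K_reg a b c d e f g
     - sinpi (e - a) * A (f - a) (f - b) (f - c) (f - d) * A (g - a) (g - b) (g - c) (g - d) * A a b c d *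
       (of_real pi ^ 4 * sinpi (f - g) * sinpi a) * L_reg (1 - a) (1 - b) (1 - c) (1 - d) (2 - e) (2 - f) (2 - g)
     - A (e - a) (e - b) (e - c) (e - d) * (S [f - a, g - a] * (S [b, c, d] + S [e - a, f, g])) *
       (sinpi (f - g) * sinpi a) * L_reg a b c d e f g"

lemma cleared_relation_holomorphic:
  assumes bal: "\<And>s. e s + f s + g s - a s - b s - c s - d s = 1"
    and "a holomorphic_on UNIV" "b holomorphic_on UNIV" "c holomorphic_on UNIV" "d holomorphic_on UNIV"
      "e holomorphic_on UNIV" "f holomorphic_on UNIV" "g holomorphic_on UNIV"
  shows "(\<lambda>s. cleared_relation (a s) (b s) (c s) (d s) (e s) (f s) (g s)) holomorphic_on UNIV"
proof -
  have g: "g s = 1 + a s + b s + c s + d s - e s - f s" for s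
    using bal[of s] by (simp add: algebra_simps)
  show ?thesis
    unfolding cleared_relation_def K_reg_def A_def S_def list.map prod_list.Cons prod_list.Nil
    by (intro holomorphic_intros assms) (simp_all add: g)
qed

section \<open>From \<open>K\<close> and \<open>L\<close> to their regularised forms\<close>

lemma L_eq_L_reg:
  assumes "e + f + g - a - b - c - d = 1" "L_defined a b c d e f g"
  shows "L a b c d e f g = L_reg a b c d e f g / sinpi e"
proof -
  have 1: "F43 a b c d e f g * (rGamma e * rGamma f * rGamma g) = F43_reg a b c d e f g"
    using assms by (intro F43_eq_F43_reg) (simp_all add: L_defined_def)
  have 2: "F43 (1 + a - e) (1 + b - e) (1 + c - e) (1 + d - e) (2 - e) (1 + f - e) (1 + g - e) *
      (rGamma (2 - e) * rGamma (1 + f - e) * rGamma (1 + g - e)) =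
      F43_reg (1 + a - e) (1 + b - e) (1 + c - e) (1 + d - e) (2 - e) (1 + f - e) (1 + g - e)"
    using assms by (intro F43_eq_F43_reg) (simp_all add: L_defined_def algebra_simps)
  show ?thesis
    unfolding L_def L_reg_def 1[symmetric] 2[symmetric] diff_divide_distrib by (simp only: mult_ac)
qed

lemma K_eq_K_reg:
  assumes "e + f + g - a - b - c - d = 1" "K_defined a b c d e f g"
  shows "K a b c d e f g = K_reg a b c d e f g / sinpi a"
proof -
  have 1: "F43 a b c d e f g * (rGamma e * rGamma f * rGamma g) = F43_reg a b c d e f g"
    using assms by (intro F43_eq_F43_reg) (simp_all add: K_defined_def)
  have 2: "F43 a (1 + a - e) (1 + a - f) (1 + a - g) (1 + a - b) (1 + a - c) (1 + a - d) *
      (rGamma (1 + a - b) * rGamma (1 + a - c) * rGamma (1 + a - d)) =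
      F43_reg a (1 + a - e) (1 + a - f) (1 + a - g) (1 + a - b) (1 + a - c) (1 + a - d)"
    using assms by (intro F43_eq_F43_reg) (simp_all add: K_defined_def algebra_simps)
  show ?thesis
    unfolding K_def K_reg_def 1[symmetric] 2[symmetric] add_divide_distrib by (simp only: mult_ac)
qed

text \<open>Between the two applications the leading parameters f - b and g - b are exchanged by
  symmetry, so that the second one leads to 1 + g - f as distinguished lower parameter. The
  intermediate sine cancels.\<close>

lemma L_reg_two_term:
  assumes bal: "e + f + g - a - b - c - d = 1"
    and T1: "L_defect a b c d e f g = 0"
    and T2: "L_defect (g - b) (f - b) a (1 + a - e) (1 + a - b) (1 + a + c - e) (1 + a + d - e) = 0"
    and nz: "sinpi (1 + a - b) \<noteq> 0"
  shows "sinpi (1 + g - f) * L_reg a b c d e f g = sinpi e * L_reg (g - a) (g - b) (g - c) (g - d) (1 + g - f) g (1 + g - e)"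
proof -
  define X where "X = L_reg (g - b) (f - b) a (1 + a - e) (1 + a - b) (1 + a + c - e) (1 + a + d - e)"
  define Y where "Y = L_reg (g - a) (g - b) (g - c) (g - d) (1 + g - f) g (1 + g - e)"
  have args: "1 + a + c - e - (f - b) = g - d" "1 + a + d - e - (f - b) = g - c" "1 + (g - b) - (1 + a - b) = g - a"
    "1 + (g - b) - (f - b) = 1 + g - f" "1 + (g - b) + a - (1 + a - b) = g"
    "1 + (g - b) + (1 + a - e) - (1 + a - b) = 1 + g - e"
    using bal by (simp_all add: algebra_simps)
  have perm: "L_reg (g - d) (g - c) (g - b) (g - a) (1 + g - f) g (1 + g - e) = Y"
    by (simp add: Y_def L_reg_def F43_reg_def F43_reg_term_def mult_ac)
  have 1: "sinpi (1 + a - b) * L_reg a b c d e f g = sinpi e * X"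
    using T1 unfolding L_defect_def X_def L_reg_perm(1)[of "f - b" "g - b"] right_minus_eq .
  have 2: "sinpi (1 + g - f) * X = sinpi (1 + a - b) * Y"
    using T2 unfolding L_defect_def args X_def[symmetric] perm right_minus_eq .
  have "sinpi (1 + a - b) * (sinpi (1 + g - f) * L_reg a b c d e f g) = sinpi (1 + g - f) * (sinpi e * X)"
    unfolding 1[symmetric] by (rule mult.left_commute)
  also have "\<dots> = sinpi e * (sinpi (1 + a - b) * Y)"
    unfolding 2[symmetric] by (rule mult.left_commute)
  also have "\<dots> = sinpi (1 + a - b) * (sinpi e * Y)" by (rule mult.left_commute)
  finally show ?thesis using nz unfolding Y_def by (simp only: mult_cancel_left simp_thms)
qed

lemma rGamma_reflect: "rGamma (z - w) * rGamma (1 + w - z) = sinpi (z - w) / of_real pi" for z w :: complex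
  using rGamma_reflection_complex[of "z - w"] by (simp add: algebra_simps)

text \<open>The factor \<open>R\<close> completes the gamma products to reflection pairs, and each
  half of \<open>K_reg\<close> and \<open>L_reg\<close> becomes a product of sines times a value of
  \<open>bilateral\<close>. The hypothesis \<open>two\<close> replaces the reflected
  \<open>L_reg\<close> by one whose halves belong to the points 1 - g and 1 - f.\<close>

lemma cleared_relation_of_trig:
  assumes bal: "e + f + g - a - b - c - d = 1"
    and two: "sinpi (f - g) * L_reg (1 - a) (1 - b) (1 - c) (1 - d) (2 - e) (2 - f) (2 - g) =
       sinpi e * L_reg (1 + a - g) (1 + b - g) (1 + c - g) (1 + d - g) (1 + f - g) (2 - g) (1 + e - g)"
    and G: "\<And>t. bilateral a b c d e f g t = p * exp (2 * pi * \<i> * t) + q + r * exp (- (2 * pi * \<i> * t))"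
    and nz: "sinpi f \<noteq> 0" "sinpi g \<noteq> 0" "sinpi (f - g) \<noteq> 0"
      "rGamma (1 - a) \<noteq> 0" "rGamma (1 - b) \<noteq> 0" "rGamma (1 - c) \<noteq> 0" "rGamma (1 - d) \<noteq> 0"
  shows "cleared_relation a b c d e f g = 0"
proof -
  let ?G = "bilateral a b c d e f g"
  define R where "R = rGamma (1 - a) * rGamma (1 - b) * rGamma (1 - c) * rGamma (1 - d)"
  have R: "R \<noteq> 0" using nz by (simp add: R_def)
  have F43_reg_ef: "F43_reg a' b' c' d' f' e' g' = F43_reg a' b' c' d' e' f' g'" "F43_reg a' b' c' d' g' f' e' = F43_reg a' b' c' d' e' f' g'"
    for a' b' c' d' e' f' g' by (simp_all add: F43_reg_def F43_reg_term_def mult_ac)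
  \<comment> \<open>Kept general in the lower parameters, so that the values at 1 - f and 1 - g
    follow by permuting them.\<close>
  have ge: "bilateral a b c d e f g (1 - e) = A (e - a) (e - b) (e - c) (e - d) * F43_reg (1 + a - e) (1 + b - e) (1 + c - e) (1 + d - e) (2 - e) (1 + f - e) (1 + g - e)"
    if "e + f + g - a - b - c - d = 1" for e f g
  proof -
    have "bilateral a b c d e f g (1 - e) = bilateral (1 + a - e) (1 + b - e) (1 + c - e) (1 + d - e) (2 - e) (1 + f - e) (1 + g - e) 0"
      using bilateral_shift_e[of a b c d e f g 0] by simp
    also have "\<dots> = A (e - a) (e - b) (e - c) (e - d) * F43_reg (1 + a - e) (1 + b - e) (1 + c - e) (1 + d - e) (2 - e) (1 + f - e) (1 + g - e)"
      using that by (subst bilateral_0) (simp_all add: A_def algebra_simps)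
    finally show ?thesis .
  qed
  define Fe where "Fe = F43_reg (1 + a - e) (1 + b - e) (1 + c - e) (1 + d - e) (2 - e) (1 + f - e) (1 + g - e)"
  define Ff where "Ff = F43_reg (1 + a - f) (1 + b - f) (1 + c - f) (1 + d - f) (1 + g - f) (2 - f) (1 + e - f)"
  define Fg where "Fg = F43_reg (1 + a - g) (1 + b - g) (1 + c - g) (1 + d - g) (1 + f - g) (2 - g) (1 + e - g)"
  define F0 where "F0 = F43_reg a b c d e f g"
  define Fa where "Fa = F43_reg a (1 + a - e) (1 + a - f) (1 + a - g) (1 + a - b) (1 + a - c) (1 + a - d)"
  have G0: "?G 0 = R * F0" unfolding R_def F0_def using bal by (rule bilateral_0)
  have Ga: "?G (- a) = A (1 - a) (e - a) (f - a) (g - a) * Fa"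
  proof -
    have "?G (- a) = rGamma (1 - a) * rGamma (1 - (1 + a - e)) * rGamma (1 - (1 + a - f)) * rGamma (1 - (1 + a - g)) * Fa"
      unfolding bilateral_reflect[OF bal] Fa_def using bal by (intro bilateral_0) (simp add: algebra_simps)
    then show ?thesis by (simp add: A_def)
  qed
  have Ge: "?G (1 - e) = A (e - a) (e - b) (e - c) (e - d) * Fe"
    unfolding Fe_def using bal by (rule ge)
  have Gf: "?G (1 - f) = A (f - a) (f - b) (f - c) (f - d) * Ff"
  proof -
    have "f + e + g - a - b - c - d = 1" using bal by (simp add: algebra_simps)
    from ge[OF this] show ?thesis unfolding Ff_def bilateral_perm(1)[of a b c d e f g] by (simp add: F43_reg_ef F43_reg_perm(4))
  qed
  have Gg: "?G (1 - g) = A (g - a) (g - b) (g - c) (g - d) * Fg"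
  proof -
    have "g + f + e - a - b - c - d = 1" using bal by (simp add: algebra_simps)
    from ge[OF this] show ?thesis unfolding Fg_def bilateral_perm(2)[of a b c d e f g] by (simp add: F43_reg_ef(1)[of _ _ _ _ "1 + f - g"])
  qed
  have rr: "rGamma z * rGamma (1 - z) = sinpi z / of_real pi" for z :: complex by (rule rGamma_reflection_complex)
  have K1: "A (1 - a) (e - a) (f - a) (g - a) * K_reg a b c d e f g * R =
     (S [a, e - a, f - a, g - a] * ?G 0 + S [a, b, c, d] * ?G (- a)) / of_real pi ^ 4"
  proof -
    have "A (1 - a) (e - a) (f - a) (g - a) * K_reg a b c d e f g * R =
      (rGamma a * rGamma (1 - a)) * (rGamma (e - a) * rGamma (1 + a - e)) * (rGamma (f - a) * rGamma (1 + a - f)) *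
        (rGamma (g - a) * rGamma (1 + a - g)) * (R * F0) +
      (rGamma a * rGamma (1 - a)) * (rGamma b * rGamma (1 - b)) * (rGamma c * rGamma (1 - c)) * (rGamma d * rGamma (1 - d)) *
        (A (1 - a) (e - a) (f - a) (g - a) * Fa)"
      by (simp only: A_def K_reg_def R_def F0_def Fa_def distrib_left distrib_right mult_ac)
    then show ?thesis
      unfolding rr rGamma_reflect G0 Ga
      by (simp add: S_def power4_eq_xxxx add_divide_distrib mult_ac)
  qed
  have L1: "A (e - a) (e - b) (e - c) (e - d) * L_reg a b c d e f g * R =
     (S [e - a, e - b, e - c, e - d] * ?G 0 - S [a, b, c, d] * ?G (1 - e)) / of_real pi ^ 4"
  proof -
    have "A (e - a) (e - b) (e - c) (e - d) * L_reg a b c d e f g * R =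
      (rGamma (e - a) * rGamma (1 + a - e)) * (rGamma (e - b) * rGamma (1 + b - e)) * (rGamma (e - c) * rGamma (1 + c - e)) *
        (rGamma (e - d) * rGamma (1 + d - e)) * (R * F0) -
      (rGamma a * rGamma (1 - a)) * (rGamma b * rGamma (1 - b)) * (rGamma c * rGamma (1 - c)) * (rGamma d * rGamma (1 - d)) *
        (A (e - a) (e - b) (e - c) (e - d) * Fe)"
      by (simp only: A_def L_reg_def R_def F0_def Fe_def left_diff_distrib right_diff_distrib mult_ac)
    then show ?thesis
      unfolding rr rGamma_reflect G0 Ge
      by (simp add: S_def power4_eq_xxxx diff_divide_distrib mult_ac)
  qed
  define Lg where "Lg = L_reg (1 + a - g) (1 + b - g) (1 + c - g) (1 + d - g) (1 + f - g) (2 - g) (1 + e - g)"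
  have L2: "A (f - a) (f - b) (f - c) (f - d) * A (g - a) (g - b) (g - c) (g - d) * A a b c d * Lg * R =
     S [a, b, c, d] * (S [f - a, f - b, f - c, f - d] * ?G (1 - g) - S [g - a, g - b, g - c, g - d] * ?G (1 - f)) / of_real pi ^ 8"
  proof -
    have args: "1 + (1 + z - g) - (1 + f - g) = 1 + z - f" "2 - (1 + f - g) = 1 + g - f" "1 + (2 - g) - (1 + f - g) = 2 - f" for z
      by simp_all
    have Lg: "Lg = rGamma (1 + a - f) * rGamma (1 + b - f) * rGamma (1 + c - f) * rGamma (1 + d - f) * Fg -
      rGamma (1 + a - g) * rGamma (1 + b - g) * rGamma (1 + c - g) * rGamma (1 + d - g) * Ff"
      unfolding Lg_def L_reg_def Fg_def Ff_def args ..
    have "A (f - a) (f - b) (f - c) (f - d) * A (g - a) (g - b) (g - c) (g - d) * A a b c d * Lg * R =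
      ((rGamma a * rGamma (1 - a)) * (rGamma b * rGamma (1 - b)) * (rGamma c * rGamma (1 - c)) * (rGamma d * rGamma (1 - d))) *
      ((rGamma (f - a) * rGamma (1 + a - f)) * (rGamma (f - b) * rGamma (1 + b - f)) * (rGamma (f - c) * rGamma (1 + c - f)) *
        (rGamma (f - d) * rGamma (1 + d - f)) * (A (g - a) (g - b) (g - c) (g - d) * Fg) -
       (rGamma (g - a) * rGamma (1 + a - g)) * (rGamma (g - b) * rGamma (1 + b - g)) * (rGamma (g - c) * rGamma (1 + c - g)) *
        (rGamma (g - d) * rGamma (1 + d - g)) * (A (f - a) (f - b) (f - c) (f - d) * Ff))"
      by (simp only: Lg A_def R_def left_diff_distrib right_diff_distrib mult_ac)
    then show ?thesis
      unfolding rr rGamma_reflect Gg[symmetric] Gf[symmetric]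
      by (simp add: S_def power_numeral_reduce diff_divide_distrib right_diff_distrib mult_ac)
  qed
  define B3 where "B3 = S [f, f - e, g - a, g - b, g - c, g - d] - S [g, g - e, f - a, f - b, f - c, f - d]"
  define B4 where "B4 = S [f - a, g - a] * (S [b, c, d] + S [e - a, f, g])"
  define D where "D = B3 * sinpi e * (S [e - a, f - a, g - a] * ?G 0 + S [b, c, d] * ?G (- a))
     + S [e - a, e, a, b, c, d] * (S [g - a, g - b, g - c, g - d] * ?G (1 - f) - S [f - a, f - b, f - c, f - d] * ?G (1 - g))
     - B4 * sinpi (f - g) * (S [e - a, e - b, e - c, e - d] * ?G 0 - S [a, b, c, d] * ?G (1 - e))"
  have "D = 0"
    unfolding D_def B3_def B4_def G by (rule trig_identity[OF bal nz(1-3)])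
  define AF where "AF = A (f - a) (f - b) (f - c) (f - d) * A (g - a) (g - b) (g - c) (g - d) * A a b c d"
  have "cleared_relation a b c d e f g * R =
      B3 * sinpi e * (A (1 - a) (e - a) (f - a) (g - a) * K_reg a b c d e f g * R)
      - sinpi (e - a) * of_real pi ^ 4 * sinpi a *
        (AF * R * (sinpi (f - g) * L_reg (1 - a) (1 - b) (1 - c) (1 - d) (2 - e) (2 - f) (2 - g)))
      - B4 * (sinpi (f - g) * sinpi a) * (A (e - a) (e - b) (e - c) (e - d) * L_reg a b c d e f g * R)"
    unfolding cleared_relation_def B3_def[symmetric] B4_def[symmetric] AF_def by (simp only: left_diff_distrib right_diff_distrib mult_ac)
  also have "\<dots> = B3 * sinpi e * (A (1 - a) (e - a) (f - a) (g - a) * K_reg a b c d e f g * R)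
      - sinpi (e - a) * of_real pi ^ 4 * sinpi a * sinpi e * (AF * Lg * R)
      - B4 * (sinpi (f - g) * sinpi a) * (A (e - a) (e - b) (e - c) (e - d) * L_reg a b c d e f g * R)"
    unfolding two Lg_def[symmetric] by (simp only: mult_ac)
  also have "\<dots> = sinpi a * D / of_real pi ^ 4"
  proof -
    define P where "P = complex_of_real pi ^ 4"
    have P8: "complex_of_real pi ^ 8 = P * P" by (simp add: P_def flip: power_add)
    have P: "P \<noteq> 0" by (simp add: P_def)
    have S_a: "S [a, b, c, d] = sinpi a * S [b, c, d]" "S [a, e - a, f - a, g - a] = sinpi a * S [e - a, f - a, g - a]"
      "S [e - a, e, a, b, c, d] = sinpi (e - a) * sinpi e * (sinpi a * S [b, c, d])"
      by (simp_all add: S_def mult_ac)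
    have "B * y * ((x * u * G0 + x * v * Ga) / P) - z * P * x * y * (x * v * (m * Gg - n * Gf) / (P * P))
        - C * (w * x) * ((l * G0 - x * v * Ge) / P) =
      x * (B * y * (u * G0 + v * Ga) + z * y * (x * v) * (n * Gf - m * Gg) - C * w * (l * G0 - x * v * Ge)) / P"
      for B C x y z u v w l m n G0 Ga Ge Gf Gg :: complex
      using P by (simp add: field_simps)
    then show ?thesis
      unfolding AF_def K1 L1 L2 D_def S_a P8 P_def[symmetric] .
  qed
  finally show ?thesis using \<open>D = 0\<close> R by simp
qed

lemma not_Ints_between: "of_int n < x \<Longrightarrow> x < of_int n + 1 \<Longrightarrow> x \<notin> \<int>" for x :: real
  by (auto elim!: Ints_cases)

lemma sinpi_of_real_nonzero: "x \<notin> \<int> \<Longrightarrow> sinpi (of_real x) \<noteq> 0" for x :: real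
proof
  assume "x \<notin> \<int>" "sinpi (of_real x) = 0"
  then have "sin (pi * x) = 0" by (simp add: sin_of_real flip: of_real_mult)
  then obtain i :: int where "pi * x = of_int i * pi" by (auto simp: sin_zero_iff_int2)
  then have "x = of_int i" by simp
  then show False using \<open>x \<notin> \<int>\<close> by simp
qed

lemma rGamma_of_real_nonzero: "x > 0 \<Longrightarrow> rGamma (complex_of_real x) \<noteq> 0"
  unfolding rGamma_complex_of_real rGamma_inverse_Gamma[of x]
  by (metis Gamma_real_pos inverse_nonzero_iff_nonzero less_irrefl of_real_eq_0_iff)

text \<open>The box is chosen such that the positivity and non-integrality conditions hold for both
  applications of the two-term relation and for the bilateral sum.\<close>

lemma cleared_relation_near_base_point:
  fixes a b c d e f g :: real
  assumes bal: "e + f + g - a - b - c - d = 1"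
    and near: "\<bar>a - (69/100)\<bar> < (1/500)" "\<bar>b - (61/100)\<bar> < (1/500)" "\<bar>c - (63/100)\<bar> < (1/500)" "\<bar>d - (71/100)\<bar> < (1/500)"
      "\<bar>e - (79/100)\<bar> < (1/500)" "\<bar>f - (29/20)\<bar> < (1/500)" "\<bar>g - (7/5)\<bar> < (1/500)"
  shows "cleared_relation (of_real a) (of_real b) (of_real c) (of_real d) (of_real e) (of_real f) (of_real g) = 0"
proof -
  have n: "(86/125) < a" "a < (173/250)" "(76/125) < b" "b < (153/250)" "(157/250) < c" "c < (79/125)" "(177/250) < d" "d < (89/125)"
    "(197/250) < e" "e < (99/125)" "(181/125) < f" "f < (363/250)" "(699/500) < g" "g < (701/500)"
    using near[unfolded abs_less_iff] by linarith+
  have bal': "complex_of_real e + of_real f + of_real g - of_real a - of_real b - of_real c - of_real d = 1"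
    using arg_cong[OF bal, of complex_of_real] by simp
  \<comment> \<open>The parameters are those of \<open>L_6bar\<close>, for which the convergence
    condition of \<open>L_defect_real\<close> reads e < c + d.\<close>
  have T1: "L_defect (of_real (1 - a)) (of_real (1 - b)) (of_real (1 - c)) (of_real (1 - d)) (of_real (2 - e)) (of_real (2 - f)) (of_real (2 - g)) = 0"
  proof (rule L_defect_real)
    show "2 - e \<notin> \<int>" by (rule not_Ints_between[of 1]) (use n in simp_all)
    show "1 - a - (1 - b) \<notin> \<int>" by (rule not_Ints_between[of "-1"]) (use n in simp_all)
    show "1 - a - (1 - b) + (2 - e) \<notin> \<int>" by (rule not_Ints_between[of 1]) (use n in simp_all)
    show "1 - a - (1 - b) - (2 - e) \<notin> \<int>" by (rule not_Ints_between[of "-2"]) (use n in simp_all)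
  qed (use n bal in linarith)+
  \<comment> \<open>The parameters produced by the first application, with the first two
    exchanged.\<close>
  let ?a = "(2 - g) - (1 - b)" and ?b = "(2 - f) - (1 - b)" and ?d = "1 + (1 - a) - (2 - e)" and ?e = "1 + (1 - a) - (1 - b)"
    and ?f = "1 + (1 - a) + (1 - c) - (2 - e)" and ?g = "1 + (1 - a) + (1 - d) - (2 - e)"
  have T2: "L_defect (of_real ?a) (of_real ?b) (of_real (1 - a)) (of_real ?d) (of_real ?e) (of_real ?f) (of_real ?g) = 0"
  proof (rule L_defect_real)
    show "?e \<notin> \<int>" by (rule not_Ints_between[of 0]) (use n in simp_all)
    show "?a - ?b \<notin> \<int>" by (rule not_Ints_between[of 0]) (use n in simp_all)
    show "?a - ?b + ?e \<notin> \<int>" by (rule not_Ints_between[of 0]) (use n in simp_all)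
    show "?a - ?b - ?e \<notin> \<int>" by (rule not_Ints_between[of "-1"]) (use n in simp_all)
  qed (use n bal in linarith)+
  have two: "sinpi (1 + of_real (2 - g) - of_real (2 - f)) * L_reg (of_real (1 - a)) (of_real (1 - b)) (of_real (1 - c)) (of_real (1 - d)) (of_real (2 - e)) (of_real (2 - f)) (of_real (2 - g)) =
     sinpi (of_real (2 - e)) * L_reg (of_real (2 - g) - of_real (1 - a)) (of_real (2 - g) - of_real (1 - b)) (of_real (2 - g) - of_real (1 - c)) (of_real (2 - g) - of_real (1 - d))
      (1 + of_real (2 - g) - of_real (2 - f)) (of_real (2 - g)) (1 + of_real (2 - g) - of_real (2 - e))"
  proof (rule L_reg_two_term[OF _ T1])
    show "of_real (2 - e) + of_real (2 - f) + of_real (2 - g) - of_real (1 - a) - of_real (1 - b) - of_real (1 - c) - of_real (1 - d) = (1 :: complex)"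
      using bal' by (simp add: algebra_simps)
    show "L_defect (of_real (2 - g) - of_real (1 - b)) (of_real (2 - f) - of_real (1 - b)) (of_real (1 - a)) (1 + of_real (1 - a) - of_real (2 - e))
      (1 + of_real (1 - a) - of_real (1 - b)) (1 + of_real (1 - a) + of_real (1 - c) - of_real (2 - e)) (1 + of_real (1 - a) + of_real (1 - d) - of_real (2 - e)) = 0"
      using T2 by (simp only: of_real_diff of_real_add of_real_1)
    have "sinpi (of_real ?e) \<noteq> 0" by (intro sinpi_of_real_nonzero not_Ints_between[of 0]) (use n in simp_all)
    then show "sinpi (1 + of_real (1 - a) - of_real (1 - b)) \<noteq> 0"
      by (simp only: of_real_diff of_real_add of_real_1 not_False_eq_True)
  qed
  obtain p q r where G: "\<And>t. bilateral (of_real a) (of_real b) (of_real c) (of_real d) (of_real e) (of_real f) (of_real g) t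
     = p * exp (2 * pi * \<i> * t) + q + r * exp (- (2 * pi * \<i> * t))"
    by (rule bilateral_trig[OF bal]) (use n in auto)
  show ?thesis
  proof (rule cleared_relation_of_trig[OF bal' _ G])
    have s1: "sinpi (2 - z) = - sinpi z" for z
      using sinpi_add_nat[of "- z" 2] by (simp add: algebra_simps)
    have s2: "sinpi (1 + of_real f - of_real g) = - sinpi (of_real f - of_real g)"
      using sinpi_1_plus[of "of_real f - of_real g"] by (simp add: algebra_simps)
    have args: "complex_of_real (2 - g) - of_real (1 - z) = 1 + of_real z - of_real g"
      "1 + complex_of_real (2 - g) - of_real (2 - z) = 1 + of_real z - of_real g"
      "complex_of_real (2 - z) = 2 - of_real z" "complex_of_real (1 - z) = 1 - of_real z" for z by simp_all
    show "sinpi (of_real f - of_real g) * L_reg (1 - of_real a) (1 - of_real b) (1 - of_real c) (1 - of_real d) (2 - of_real e) (2 - of_real f) (2 - of_real g) =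
       sinpi (of_real e) * L_reg (1 + of_real a - of_real g) (1 + of_real b - of_real g) (1 + of_real c - of_real g) (1 + of_real d - of_real g) (1 + of_real f - of_real g) (2 - of_real g) (1 + of_real e - of_real g)"
      using two unfolding args(1,2) unfolding args(3,4) s1 s2 by simp
    show "sinpi (of_real f) \<noteq> 0" "sinpi (of_real g) \<noteq> 0"
      by (intro sinpi_of_real_nonzero not_Ints_between[of 1]; use n in simp)+
    have "sinpi (of_real (f - g)) \<noteq> 0"
      by (intro sinpi_of_real_nonzero not_Ints_between[of 0]) (use n in simp_all)
    then show "sinpi (of_real f - of_real g) \<noteq> 0" by simp
    have "rGamma (1 - of_real z) \<noteq> (0 :: complex)" if "z < 1" for z
      using rGamma_of_real_nonzero[of "1 - z"] that by simp
    then show "rGamma (1 - complex_of_real a) \<noteq> 0" "rGamma (1 - complex_of_real b) \<noteq> 0"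
      "rGamma (1 - complex_of_real c) \<noteq> 0" "rGamma (1 - complex_of_real d) \<noteq> 0"
      using n by auto
  qed
qed

section \<open>Analytic continuation to all parameters\<close>

lemma entire_zero_of_real_zero:
  assumes "f holomorphic_on UNIV" "\<eta> > 0" and zero: "\<And>t. \<bar>t\<bar> < \<eta> \<Longrightarrow> f (complex_of_real t) = 0"
  shows "f z = 0"
proof (rule analytic_continuation[OF assms(1), of "of_real ` {-\<eta><..<\<eta>}" 0])
  show "(0::complex) islimpt of_real ` {-\<eta><..<\<eta>}"
    unfolding islimpt_approachable
  proof (intro allI impI)
    fix e :: real assume "e > 0"
    define t where "t = min e \<eta> / 2"
    have t: "0 < t" "t < e" "t < \<eta>" using \<open>e > 0\<close> \<open>\<eta> > 0\<close> by (auto simp: t_def)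
    then show "\<exists>x'\<in>complex_of_real ` {-\<eta><..<\<eta>}. x' \<noteq> 0 \<and> dist x' 0 < e"
      by (intro bexI[of _ "of_real t"]) auto
  qed
qed (use zero in auto)

text \<open>Vanishing is known only on a real box, so real and imaginary parts of the target get
  separate complex variables. The parameters \<open>X x0 z s t\<close> are real for real s and t,
  close to \<open>x0\<close> when these are small, and equal to \<open>z\<close> at s = 1, t = \<i>.
  Continuation is carried out in s for small real t, and then in t at s = 1.\<close>

lemma cleared_relation_zero:
  assumes bal: "e + f + g - a - b - c - d = 1"
  shows "cleared_relation a b c d e f g = 0"
proof -
  define X where "X x0 z s t = complex_of_real x0 + s * of_real (Re z - x0) + t * of_real (Im z)" for x0 z s t
  define P where "P s t = cleared_relation (X (69/100) a s t) (X (61/100) b s t) (X (63/100) c s t) (X (71/100) d s t) (X (79/100) e s t) (X (29/20) f s t) (X (7/5) g s t)" for s t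
  have re: "Re e + Re f + Re g - Re a - Re b - Re c - Re d = 1" and im: "Im e + Im f + Im g - Im a - Im b - Im c - Im d = 0"
    using arg_cong[OF bal, of Re] arg_cong[OF bal, of Im] by simp_all
  have Xbal: "X (79/100) e s t + X (29/20) f s t + X (7/5) g s t - X (69/100) a s t - X (61/100) b s t - X (63/100) c s t - X (71/100) d s t = 1" for s t
  proof -
    have "X (79/100) e s t + X (29/20) f s t + X (7/5) g s t - X (69/100) a s t - X (61/100) b s t - X (63/100) c s t - X (71/100) d s t =
      of_real ((79/100) + (29/20) + (7/5) - (69/100) - (61/100) - (63/100) - (71/100)) +
      s * of_real ((Re e + Re f + Re g - Re a - Re b - Re c - Re d) - ((79/100) + (29/20) + (7/5) - (69/100) - (61/100) - (63/100) - (71/100))) +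
      t * of_real (Im e + Im f + Im g - Im a - Im b - Im c - Im d)"
      unfolding X_def of_real_add of_real_diff by (simp only: distrib_left right_diff_distrib) (simp add: algebra_simps)
    then show ?thesis unfolding re im by simp
  qed
  have hol1: "(\<lambda>s. P s t) holomorphic_on UNIV" for t
    unfolding P_def by (rule cleared_relation_holomorphic[OF Xbal]) (auto simp: X_def intro!: holomorphic_intros)
  have hol2: "(\<lambda>t. P s t) holomorphic_on UNIV" for s
    unfolding P_def by (rule cleared_relation_holomorphic[OF Xbal]) (auto simp: X_def intro!: holomorphic_intros)
  define Ms where "Ms = {\<bar>Re a - (69/100)\<bar> + \<bar>Im a\<bar>, \<bar>Re b - (61/100)\<bar> + \<bar>Im b\<bar>, \<bar>Re c - (63/100)\<bar> + \<bar>Im c\<bar>, \<bar>Re d - (71/100)\<bar> + \<bar>Im d\<bar>, \<bar>Re e - (79/100)\<bar> + \<bar>Im e\<bar>, \<bar>Re f - (29/20)\<bar> + \<bar>Im f\<bar>, \<bar>Re g - (7/5)\<bar> + \<bar>Im g\<bar>}"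
  define M where "M = Max Ms + 1"
  have in_Ms: "\<bar>Re a - (69/100)\<bar> + \<bar>Im a\<bar> \<in> Ms" "\<bar>Re b - (61/100)\<bar> + \<bar>Im b\<bar> \<in> Ms" "\<bar>Re c - (63/100)\<bar> + \<bar>Im c\<bar> \<in> Ms" "\<bar>Re d - (71/100)\<bar> + \<bar>Im d\<bar> \<in> Ms" "\<bar>Re e - (79/100)\<bar> + \<bar>Im e\<bar> \<in> Ms" "\<bar>Re f - (29/20)\<bar> + \<bar>Im f\<bar> \<in> Ms" "\<bar>Re g - (7/5)\<bar> + \<bar>Im g\<bar> \<in> Ms"
    by (simp_all add: Ms_def)
  have less_M: "m < M" if "m \<in> Ms" for m
  proof -
    have "m \<le> Max Ms" using that by (intro Max_ge) (simp_all add: Ms_def)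
    then show ?thesis by (simp add: M_def)
  qed
  note M = in_Ms[THEN less_M]
  have M_pos: "M > 0" by (rule le_less_trans[OF _ M(1)]) simp
  define \<eta> where "\<eta> = (1/500) / M"
  have eta: "\<eta> > 0" using M_pos by (simp add: \<eta>_def)
  have near: "\<bar>x0 + s * (Re z - x0) + t * Im z - x0\<bar> < (1/500)"
    if "\<bar>Re z - x0\<bar> + \<bar>Im z\<bar> < M" "\<bar>s\<bar> < \<eta>" "\<bar>t\<bar> < \<eta>" for x0 s t z
  proof -
    have "\<bar>x0 + s * (Re z - x0) + t * Im z - x0\<bar> \<le> \<bar>s\<bar> * \<bar>Re z - x0\<bar> + \<bar>t\<bar> * \<bar>Im z\<bar>"
      by (simp add: abs_mult[symmetric])
    also have "\<dots> \<le> \<eta> * \<bar>Re z - x0\<bar> + \<eta> * \<bar>Im z\<bar>"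
      using that by (intro add_mono mult_right_mono) auto
    also have "\<dots> = \<eta> * (\<bar>Re z - x0\<bar> + \<bar>Im z\<bar>)" by (simp add: distrib_left)
    also have "\<dots> < \<eta> * M" using eta that by simp
    also have "\<dots> = (1/500)" using M_pos by (simp add: \<eta>_def)
    finally show ?thesis .
  qed
  have base: "P (of_real s) (of_real t) = 0" if st: "\<bar>s\<bar> < \<eta>" "\<bar>t\<bar> < \<eta>" for s t
  proof -
    have X: "X x0 z (of_real s) (of_real t) = of_real (x0 + s * (Re z - x0) + t * Im z)" for x0 z
      by (simp add: X_def)
    have "complex_of_real (((79/100) + s * (Re e - (79/100)) + t * Im e) + ((29/20) + s * (Re f - (29/20)) + t * Im f) + ((7/5) + s * (Re g - (7/5)) + t * Im g)
      - ((69/100) + s * (Re a - (69/100)) + t * Im a) - ((61/100) + s * (Re b - (61/100)) + t * Im b)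
      - ((63/100) + s * (Re c - (63/100)) + t * Im c) - ((71/100) + s * (Re d - (71/100)) + t * Im d)) = of_real 1"
      using Xbal[of "of_real s" "of_real t"] unfolding X by (simp only: of_real_add of_real_diff of_real_1)
    then have b: "((79/100) + s * (Re e - (79/100)) + t * Im e) + ((29/20) + s * (Re f - (29/20)) + t * Im f) + ((7/5) + s * (Re g - (7/5)) + t * Im g)
      - ((69/100) + s * (Re a - (69/100)) + t * Im a) - ((61/100) + s * (Re b - (61/100)) + t * Im b)
      - ((63/100) + s * (Re c - (63/100)) + t * Im c) - ((71/100) + s * (Re d - (71/100)) + t * Im d) = 1"
      by (simp only: of_real_eq_iff)
    show ?thesis unfolding P_def X
      by (rule cleared_relation_near_base_point[OF b]) (intro near M st)+
  qed
  have "P s (of_real t) = 0" if "\<bar>t\<bar> < \<eta>" for s t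
    using entire_zero_of_real_zero[OF hol1 eta] base that by blast
  then have "P 1 \<i> = 0"
    using entire_zero_of_real_zero[OF hol2 eta] by blast
  moreover have "X x0 z 1 \<i> = z" for x0 z
    by (simp add: X_def complex_eq_iff)
  ultimately show ?thesis unfolding P_def by simp
qed

theorem proposition6p10:
  fixes x :: complex7 and a b c d e f g :: complex
  assumes "x = (a, b, c, d, e, f, g)"
    and "x \<in> V"
    and "relation_defined x"
  shows "A (1 - a) (e - a) (f - a) (g - a) * B_3 x * K_p0 x
       + S [e - a] * A (f - a) (f - b) (f - c) (f - d) * A (g - a) (g - b) (g - c) (g - d)
           * A a b c d * L_6bar x
       - A (e - a) (e - b) (e - c) (e - d) * B_4 x * L_6 x = 0"
proof -
  have bal: "e + f + g - a - b - c - d = 1" using assms by (simp add: V_def)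
  then have bal': "(2 - e) + (2 - f) + (2 - g) - (1 - a) - (1 - b) - (1 - c) - (1 - d) = 1" by (simp add: algebra_simps)
  have dfd: "K_defined a b c d e f g" "L_defined a b c d e f g"
    "L_defined (1 - a) (1 - b) (1 - c) (1 - d) (2 - e) (2 - f) (2 - g)" "sinpi (f - g) \<noteq> 0"
    using assms(3) unfolding assms(1) by (simp_all add: S_def)
  have nz: "sinpi a \<noteq> 0" "sinpi e \<noteq> 0" using dfd by (simp_all add: K_defined_def L_defined_def)
  have s2: "sinpi (2 - e) = - sinpi e"
    using sinpi_add_nat[of "- e" 2] by (simp add: algebra_simps)
  define A1 A2 A3 A4 where As: "A1 = A (1 - a) (e - a) (f - a) (g - a)"
    "A2 = A (f - a) (f - b) (f - c) (f - d) * A (g - a) (g - b) (g - c) (g - d) * A a b c d"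
    "A3 = A (e - a) (e - b) (e - c) (e - d)" "A4 = sinpi (e - a)"
  define B3 where "B3 = S [f, f - e, g - a, g - b, g - c, g - d] - S [g, g - e, f - a, f - b, f - c, f - d]"
  define B4 where "B4 = S [f - a, g - a] * (S [b, c, d] + S [e - a, f, g])"
  define Z where "Z = A1 * B_3 x * K_p0 x + A4 * A2 * L_6bar x - A3 * B_4 x * L_6 x"
  define k l m where "k = K_reg a b c d e f g" and "l = L_reg a b c d e f g"
    and "m = L_reg (1 - a) (1 - b) (1 - c) (1 - d) (2 - e) (2 - f) (2 - g)"
  have vals: "B_3 x = B3 / (of_real pi ^ 4 * sinpi (f - g))" "B_4 x = B4 / of_real pi ^ 4"
    "K_p0 x = k / sinpi a" "L_6 x = l / sinpi e" "L_6bar x = - m / sinpi e"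
    unfolding assms(1) using K_eq_K_reg[OF bal dfd(1)] L_eq_L_reg[OF bal dfd(2)] L_eq_L_reg[OF bal' dfd(3)]
    by (simp_all add: B3_def B4_def S_def k_def l_def m_def s2)
  have "Z * (of_real pi ^ 4 * sinpi (f - g) * sinpi a * sinpi e) =
      A1 * B3 * sinpi e * k - A4 * A2 * (of_real pi ^ 4 * sinpi (f - g) * sinpi a) * m
      - A3 * B4 * (sinpi (f - g) * sinpi a) * l"
  proof -
    have "complex_of_real pi ^ 4 \<noteq> 0" by simp
    then show ?thesis
      unfolding Z_def vals using nz dfd(4) by (simp add: divide_simps)
  qed
  also have "\<dots> = cleared_relation a b c d e f g"
    unfolding cleared_relation_def B3_def[symmetric] B4_def[symmetric] k_def l_def m_def As by (simp only: mult.assoc)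
  also have "\<dots> = 0" by (rule cleared_relation_zero[OF bal])
  finally have "Z = 0" using nz dfd(4) by simp
  moreover have "S [e - a] = A4" by (simp add: As S_def)
  ultimately show ?thesis unfolding Z_def As by (simp add: mult.assoc)
qed

end
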